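(* Let $\mathcal H=L^2([0,1],dx)$, let $u$ be the mild solution with $u(0)=0$ of the stochastic heat equation $du(t)=Au(t)\,dt+Q^{1/2}dW_t$ with homogeneous Dirichlet boundary conditions, and let $u_n$ be its spectral Galerkin approximation of order $n$. Let $T>0$ and let $\phi\in\mathcal C_b^2(\mathcal H)$ with $\|\phi\|_{\mathcal C_b^2(\mathcal H)}\le1$. Then, for every $n\ge1$, the weak error $e_n^{w,\phi}(T)=|\mathbb E[\phi(u(T))]-\mathbb E[\phi(u_n(T))]|$ satisfies $$e_n^{w,\phi}(T)\le\frac14\sum_{k=n+1}^\infty\frac{q_k}{\lambda_k}\big(1-e^{-2\lambda_kT}\big).$$
   Context: $A=\frac{d^2}{dx^2}$ with domain $D(A)=H^2(0,1)\cap H_0^1(0,1)$, generating the semigroup $S(t)=e^{tA}$ on $\mathcal H$; $e_k(x)=\sqrt2\sin(k\pi x)$, $Ae_k=-\lambda_ke_k$, $\lambda_k=(k\pi)^2$, $k\ge1$. $W$ is a cylindrical Wiener process on $\mathcal H$, and $Q$ is a symmetric nonnegative trace-class operator with $Qe_k=q_ke_k$, $q_k>0$ for all $k$, $\sum_kq_k<\infty$. The mild solution is $u(t)=\int_0^tS(t-s)Q^{1/2}dW_s$. With $P_n$ the orthogonal projection onto $E_n=\mathrm{span}\{e_1,\dots,e_n\}$ and $A_n=P_nA|_{E_n}$, the Galerkin approximation solves $du_n(t)=A_nu_n(t)dt+P_nQ^{1/2}dW_t$, $u_n(0)=0$, i.e. $u_n(t)=\int_0^te^{(t-s)A_n}P_nQ^{1/2}dW_s=\sum_{k=1}^n\sqrt{q_k}\int_0^te^{-\lambda_k(t-s)}d\beta_k(s)\,e_k$,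 where $\beta_k=\langle W,e_k\rangle$ are independent standard Brownian motions. $\mathcal C_b^2(\mathcal H)$ is the space of bounded, twice Fréchet differentiable $\phi:\mathcal H\to\mathbb R$ with $\|\phi\|_{\mathcal C_b^2(\mathcal H)}=\sup_{x\in\mathcal H}\sum_{j=0}^2\|D_F^j\phi(x)\|_{\mathrm{op}}<\infty$, where $D_F^j\phi(x)$ is the $j$-th Fréchet derivative viewed as a $j$-linear form with its operator norm (the $j=0$ term being the sup-norm of $\phi$). *)

theory Defs
  imports "HOL-Probability.Probability"
begin

section \<open>The Hilbert space \<open>L\<^sup>2([0,1], dx)\<close>\<close>

abbreviation unit_measure :: "real measure" where
  "unit_measure \<equiv> restrict_space lborel {0..1}"

definition sq_integrable :: "(real \<Rightarrow> real) \<Rightarrow> bool" where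
  "sq_integrable f \<longleftrightarrow>
     f \<in> borel_measurable unit_measure \<and> integrable unit_measure (\<lambda>x. (f x)\<^sup>2)"

definition L2_rel :: "(real \<Rightarrow> real) \<Rightarrow> (real \<Rightarrow> real) \<Rightarrow> bool" where
  "L2_rel f g \<longleftrightarrow> sq_integrable f \<and> sq_integrable g \<and> (AE x in unit_measure. f x = g x)"

lemma sq_integrable_zero: "sq_integrable (\<lambda>_. 0)"
  by (simp add: sq_integrable_def)

lemma sq_integrable_mult:
  assumes "sq_integrable f" "sq_integrable g"
  shows "integrable unit_measure (\<lambda>x. f x * g x)"
proof (rule Bochner_Integration.integrable_bound)
  show "integrable unit_measure (\<lambda>x. (f x)\<^sup>2 + (g x)\<^sup>2)"
    using assms by (auto simp: sq_integrable_def)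
  show "(\<lambda>x. f x * g x) \<in> borel_measurable unit_measure"
    using assms by (auto simp: sq_integrable_def)
  show "AE x in unit_measure. norm (f x * g x) \<le> norm ((f x)\<^sup>2 + (g x)\<^sup>2)"
  proof (rule AE_I2)
    fix x
    have "2 * \<bar>f x\<bar> * \<bar>g x\<bar> \<le> \<bar>f x\<bar>\<^sup>2 + \<bar>g x\<bar>\<^sup>2"
      by (rule sum_squares_bound)
    moreover have "0 \<le> \<bar>f x\<bar> * \<bar>g x\<bar>" by simp
    ultimately show "norm (f x * g x) \<le> norm ((f x)\<^sup>2 + (g x)\<^sup>2)"
      unfolding real_norm_def abs_mult power2_abs by linarith
  qed
qed

lemma sq_integrable_add:
  assumes "sq_integrable f" "sq_integrable g"
  shows "sq_integrable (\<lambda>x. f x + g x)"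
proof -
  have "integrable unit_measure (\<lambda>x. (f x)\<^sup>2 + (g x)\<^sup>2 + 2 * (f x * g x))"
    using assms sq_integrable_mult[OF assms] by (auto simp: sq_integrable_def)
  moreover have "(\<lambda>x. (f x + g x)\<^sup>2) = (\<lambda>x. (f x)\<^sup>2 + (g x)\<^sup>2 + 2 * (f x * g x))"
    by (auto simp: power2_sum)
  ultimately show ?thesis
    using assms by (auto simp: sq_integrable_def)
qed

lemma sq_integrable_scale:
  assumes "sq_integrable f"
  shows "sq_integrable (\<lambda>x. c * f x)"
  using assms by (auto simp: sq_integrable_def power_mult_distrib)

lemma part_equivp_L2_rel: "part_equivp L2_rel"
proof (rule part_equivpI)
  show "\<exists>f. L2_rel f f"
    using sq_integrable_zero by (auto simp: L2_rel_def)
  show "symp L2_rel"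
    by (rule sympI) (auto simp: L2_rel_def)
  show "transp L2_rel"
  proof (rule transpI)
    fix f g h assume "L2_rel f g" "L2_rel g h"
    then show "L2_rel f h"
      unfolding L2_rel_def by (auto elim: AE_mp)
  qed
qed

quotient_type L2 = "real \<Rightarrow> real" / partial: L2_rel morphisms rep_L2 L2_of
  by (rule part_equivp_L2_rel)

instantiation L2 :: real_inner
begin

lift_definition zero_L2 :: L2 is "\<lambda>_. 0"
  by (simp add: L2_rel_def sq_integrable_zero)

lift_definition plus_L2 :: "L2 \<Rightarrow> L2 \<Rightarrow> L2" is "\<lambda>f g x. f x + g x"
  unfolding L2_rel_def by (auto intro: sq_integrable_add)

lift_definition scaleR_L2 :: "real \<Rightarrow> L2 \<Rightarrow> L2" is "\<lambda>c f x. c * f x"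
  unfolding L2_rel_def by (auto intro: sq_integrable_scale)

definition uminus_L2 :: "L2 \<Rightarrow> L2" where "uminus_L2 f = (-1) *\<^sub>R f"

definition minus_L2 :: "L2 \<Rightarrow> L2 \<Rightarrow> L2" where "minus_L2 f g = f + - g"

lift_definition inner_L2 :: "L2 \<Rightarrow> L2 \<Rightarrow> real" is
  "\<lambda>f g. integral\<^sup>L unit_measure (\<lambda>x. f x * g x)"
  unfolding L2_rel_def sq_integrable_def by (intro integral_cong_AE) auto

definition norm_L2 :: "L2 \<Rightarrow> real" where "norm_L2 f = sqrt (inner f f)"

definition dist_L2 :: "L2 \<Rightarrow> L2 \<Rightarrow> real" where "dist_L2 f g = norm (f - g)"

definition sgn_L2 :: "L2 \<Rightarrow> L2" where "sgn_L2 f = inverse (norm f) *\<^sub>R f"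

definition uniformity_L2 :: "(L2 \<times> L2) filter" where
  "uniformity_L2 = (INF e\<in>{0<..}. principal {(x, y). dist x y < e})"

definition open_L2 :: "L2 set \<Rightarrow> bool" where
  "open_L2 U \<longleftrightarrow> (\<forall>x\<in>U. \<forall>\<^sub>F (x', y) in uniformity. x' = x \<longrightarrow> y \<in> U)"

instance
proof
  fix f g h :: L2 and a b :: real
  show "f + g + h = f + (g + h)"
    by transfer (auto simp: L2_rel_def add.assoc intro!: sq_integrable_add)
  show "f + g = g + f"
    by transfer (auto simp: L2_rel_def add.commute intro!: sq_integrable_add)
  show "0 + f = f"
    by transfer (auto simp: L2_rel_def)
  show "- f + f = 0"
    unfolding uminus_L2_def
    by transfer (auto simp: L2_rel_def sq_integrable_zero)
  show "f - g = f + - g" by (rule minus_L2_def)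
  show "a *\<^sub>R (f + g) = a *\<^sub>R f + a *\<^sub>R g"
    by transfer (auto simp: L2_rel_def algebra_simps
        intro!: sq_integrable_add sq_integrable_scale)
  show "(a + b) *\<^sub>R f = a *\<^sub>R f + b *\<^sub>R f"
    by transfer (auto simp: L2_rel_def distrib_right
        intro!: sq_integrable_add sq_integrable_scale
          sq_integrable_scale[of _ "a + b", unfolded distrib_right])
  show "a *\<^sub>R b *\<^sub>R f = (a * b) *\<^sub>R f"
    by transfer (auto simp: L2_rel_def mult.assoc intro!: sq_integrable_scale)
  show "1 *\<^sub>R f = f"
    by transfer (auto simp: L2_rel_def)
  show "sgn f = inverse (norm f) *\<^sub>R f" by (rule sgn_L2_def)
  show "dist f g = norm (f - g)" by (rule dist_L2_def)
  show "norm f = sqrt (inner f f)" by (rule norm_L2_def)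
  show "uniformity = (INF e\<in>{0<..}. principal {(x :: L2, y). dist x y < e})"
    by (rule uniformity_L2_def)
  show "open U \<longleftrightarrow> (\<forall>x\<in>U. \<forall>\<^sub>F (x', y) in uniformity. x' = x \<longrightarrow> y \<in> U)" for U :: "L2 set"
    by (rule open_L2_def)
  show "inner f g = inner g f"
    by transfer (simp add: mult.commute)
  show "inner (f + g) h = inner f h + inner g h"
    by transfer (simp add: L2_rel_def distrib_right sq_integrable_mult)
  show "inner (a *\<^sub>R f) g = a * inner f g"
    by transfer (simp add: mult.assoc)
  show "0 \<le> inner f f"
    by transfer simp
  show "inner f f = 0 \<longleftrightarrow> f = 0"
  proof transfer
    fix f assume "L2_rel f f"
    then have f: "sq_integrable f" by (simp add: L2_rel_def)
    then have "integral\<^sup>L unit_measure (\<lambda>x. f x * f x) = 0 \<longleftrightarrow> (AE x in unit_measure. f x * f x = 0)"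
      by (intro integral_nonneg_eq_0_iff_AE sq_integrable_mult) auto
    then show "integral\<^sup>L unit_measure (\<lambda>x. f x * f x) = 0 \<longleftrightarrow> L2_rel f (\<lambda>_. 0)"
      using f by (simp add: L2_rel_def sq_integrable_zero)
  qed
qed

end


section \<open>Sobolev spaces on \<open>(0,1)\<close> and the Dirichlet Laplacian\<close>

text \<open>Test functions of class \<open>C\<^sup>1\<close> with compact support in \<open>(0,1)\<close>; in one dimension they
  yield the same weak derivatives and the same space \<open>H\<^sup>1\<^sub>0\<close> as smooth ones.\<close>

definition test_function :: "(real \<Rightarrow> real) \<Rightarrow> bool" where
  "test_function \<phi> \<longleftrightarrow> \<phi> C1_differentiable_on UNIV \<and>
     (\<exists>K. compact K \<and> K \<subseteq> {0<..<1} \<and> (\<forall>x. x \<notin> K \<longrightarrow> \<phi> x = 0))"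

definition has_weak_deriv :: "L2 \<Rightarrow> L2 \<Rightarrow> bool" where
  "has_weak_deriv f g \<longleftrightarrow>
     (\<forall>\<phi>. test_function \<phi> \<longrightarrow> inner f (L2_of (deriv \<phi>)) = - inner g (L2_of \<phi>))"

definition sobolev_H1 :: "L2 set" where
  "sobolev_H1 = {f. \<exists>g. has_weak_deriv f g}"

definition sobolev_H2 :: "L2 set" where
  "sobolev_H2 = {f. \<exists>g \<in> sobolev_H1. has_weak_deriv f g}"

text \<open>The closure of the test functions with respect to the \<open>H\<^sup>1\<close> norm.\<close>

definition sobolev_H10 :: "L2 set" where
  "sobolev_H10 = {f. \<exists>g \<phi>. has_weak_deriv f g \<and> (\<forall>m. test_function (\<phi> m)) \<and>
     (\<lambda>m. L2_of (\<phi> m)) \<longlonglongrightarrow> f \<and> (\<lambda>m. L2_of (deriv (\<phi> m))) \<longlonglongrightarrow> g}"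

text \<open>Unbounded operators are represented by their graphs.\<close>

definition dirichlet_laplacian :: "(L2 \<times> L2) set" where
  "dirichlet_laplacian = {(f, h). f \<in> sobolev_H2 \<inter> sobolev_H10 \<and>
     (\<exists>g. has_weak_deriv f g \<and> has_weak_deriv g h)}"

definition eigenfun :: "nat \<Rightarrow> L2" where
  "eigenfun k = L2_of (\<lambda>x. sqrt 2 * sin (real k * pi * x))"

definition eigenval :: "nat \<Rightarrow> real" where
  "eigenval k = (real k * pi)\<^sup>2"


section \<open>Operators\<close>

definition C0_semigroup :: "(real \<Rightarrow> 'h \<Rightarrow> 'h :: real_normed_vector) \<Rightarrow> bool" where
  "C0_semigroup S \<longleftrightarrow>
     (\<forall>t\<ge>0. bounded_linear (S t)) \<and> S 0 = id \<and>
     (\<forall>s\<ge>0. \<forall>t\<ge>0. S (s + t) = S s \<circ> S t) \<and>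
     (\<forall>x. ((\<lambda>t. S t x) \<longlongrightarrow> x) (at_right 0))"

definition semigroup_generator :: "(real \<Rightarrow> 'h \<Rightarrow> 'h :: real_normed_vector) \<Rightarrow> ('h \<times> 'h) set" where
  "semigroup_generator S = {(x, y). ((\<lambda>t. (S t x - x) /\<^sub>R t) \<longlongrightarrow> y) (at_right 0)}"

definition symmetric_nonneg :: "('h \<Rightarrow> 'h :: real_inner) \<Rightarrow> bool" where
  "symmetric_nonneg R \<longleftrightarrow> bounded_linear R \<and>
     (\<forall>x y. inner (R x) y = inner x (R y)) \<and> (\<forall>x. 0 \<le> inner (R x) x)"

definition trace_class :: "('h \<Rightarrow> 'h :: real_inner) \<Rightarrow> bool" where
  "trace_class R \<longleftrightarrow> (\<exists>a b :: nat \<Rightarrow> 'h. summable (\<lambda>j. norm (a j) * norm (b j)) \<and>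
     (\<forall>x. (\<lambda>j. inner (a j) x *\<^sub>R b j) sums R x))"

text \<open>The nonnegative symmetric square root is unique, so this determines \<open>R = Q\<^bsup>1/2\<^esup>\<close>.\<close>

definition is_sqrt_of :: "('h \<Rightarrow> 'h :: real_inner) \<Rightarrow> ('h \<Rightarrow> 'h) \<Rightarrow> bool" where
  "is_sqrt_of R Q \<longleftrightarrow> symmetric_nonneg R \<and> R \<circ> R = Q"

text \<open>Computed in the orthonormal basis \<open>e\<^sub>1, e\<^sub>2, \<dots>\<close>; the value does not depend on that choice.\<close>

definition hs_norm_sq :: "(L2 \<Rightarrow> L2) \<Rightarrow> ennreal" where
  "hs_norm_sq R = (\<Sum>k. ennreal ((norm (R (eigenfun (Suc k))))\<^sup>2))"


section \<open>Cylindrical Wiener process and stochastic integral\<close>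

definition standard_brownian_motion :: "'w measure \<Rightarrow> (real \<Rightarrow> 'w \<Rightarrow> real) \<Rightarrow> bool" where
  "standard_brownian_motion M B \<longleftrightarrow>
     prob_space M \<and>
     (\<forall>t\<ge>0. B t \<in> borel_measurable M) \<and>
     (AE \<omega> in M. B 0 \<omega> = 0) \<and>
     (\<forall>s t. 0 \<le> s \<and> s < t \<longrightarrow>
        distributed M lborel (\<lambda>\<omega>. B t \<omega> - B s \<omega>) (normal_density 0 (sqrt (t - s)))) \<and>
     (\<forall>n (\<tau> :: nat \<Rightarrow> real). 0 \<le> \<tau> 0 \<and> (\<forall>i<n. \<tau> i < \<tau> (Suc i)) \<longrightarrow>
        prob_space.indep_vars M (\<lambda>_. borel) (\<lambda>i \<omega>. B (\<tau> (Suc i)) \<omega> - B (\<tau> i) \<omega>) {..<n}) \<and>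
     (AE \<omega> in M. continuous_on {0..} (\<lambda>t. B t \<omega>))"

text \<open>\<open>W t h\<close> stands for \<open>\<langle>W\<^sub>t, h\<rangle>\<close>.\<close>

definition cylindrical_wiener ::
  "'w measure \<Rightarrow> (real \<Rightarrow> 'h :: real_inner \<Rightarrow> 'w \<Rightarrow> real) \<Rightarrow> bool" where
  "cylindrical_wiener M W \<longleftrightarrow>
     prob_space M \<and>
     (\<forall>t\<ge>0. \<forall>a b g h. AE \<omega> in M. W t (a *\<^sub>R g + b *\<^sub>R h) \<omega> = a * W t g \<omega> + b * W t h \<omega>) \<and>
     (\<forall>n (f :: nat \<Rightarrow> 'h). (\<forall>i<n. \<forall>j<n. inner (f i) (f j) = (if i = j then 1 else 0)) \<longrightarrow>
        (\<forall>i<n. standard_brownian_motion M (\<lambda>t. W t (f i))) \<and>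
        prob_space.indep_vars M (\<lambda>_. Pi\<^sub>M {0..} (\<lambda>_. borel))
          (\<lambda>i \<omega>. \<lambda>t\<in>{0..}. W t (f i) \<omega>) {..<n})"

text \<open>An elementary integrand is a finite sum of terms
  \<open>1\<^bsub>(a,b]\<^esub>(s) \<langle>g, \<cdot>\<rangle> f\<close>, represented by the list of its tuples \<open>(a, b, g, f)\<close>.\<close>

type_synonym 'h elementary = "(real \<times> real \<times> 'h \<times> 'h) list"

definition elementary_on :: "real \<Rightarrow> 'h elementary \<Rightarrow> bool" where
  "elementary_on t E \<longleftrightarrow> (\<forall>(a, b, g, f) \<in> set E. 0 \<le> a \<and> a \<le> b \<and> b \<le> t)"

definition elementary_fun :: "'h :: real_inner elementary \<Rightarrow> real \<Rightarrow> 'h \<Rightarrow> 'h" where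
  "elementary_fun E s x = (\<Sum>(a, b, g, f) \<leftarrow> E. (indicator {a<..b} s * inner g x) *\<^sub>R f)"

definition elementary_integral ::
  "(real \<Rightarrow> 'h \<Rightarrow> 'w \<Rightarrow> real) \<Rightarrow> 'h :: real_inner elementary \<Rightarrow> 'w \<Rightarrow> 'h" where
  "elementary_integral W E \<omega> = (\<Sum>(a, b, g, f) \<leftarrow> E. (W b g \<omega> - W a g \<omega>) *\<^sub>R f)"

text \<open>\<open>X\<close> is a version of \<open>\<integral>\<^sub>0\<^sup>t \<Phi>(s) dW\<^sub>s\<close> for a deterministic operator-valued \<open>\<Phi>\<close>: the integral is
  the extension by the Ito isometry of the one on elementary integrands, from the Hilbert-Schmidt
  norm in \<open>L\<^sup>2(0,t)\<close> to the norm of \<open>L\<^sup>2(\<Omega>; L\<^sup>2(0,1))\<close>.\<close>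

definition is_stochastic_integral ::
  "'w measure \<Rightarrow> (real \<Rightarrow> L2 \<Rightarrow> 'w \<Rightarrow> real) \<Rightarrow> (real \<Rightarrow> L2 \<Rightarrow> L2) \<Rightarrow> real \<Rightarrow> ('w \<Rightarrow> L2) \<Rightarrow> bool" where
  "is_stochastic_integral M W \<Phi> t X \<longleftrightarrow>
     X \<in> borel_measurable M \<and>
     (\<exists>E. (\<forall>m :: nat. elementary_on t (E m)) \<and>
        (\<lambda>m. \<integral>\<^sup>+s\<in>{0..t}. hs_norm_sq (\<lambda>x. elementary_fun (E m) s x - \<Phi> s x) \<partial>lborel) \<longlonglongrightarrow> 0 \<and>
        (\<lambda>m. \<integral>\<^sup>+\<omega>. ennreal ((norm (elementary_integral W (E m) \<omega> - X \<omega>))\<^sup>2) \<partial>M) \<longlonglongrightarrow> 0)"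


section \<open>The stochastic heat equation and its spectral Galerkin approximation\<close>

text \<open>Initial value \<open>u(0) = 0\<close>; \<open>R\<close> plays the role of \<open>Q\<^bsup>1/2\<^esup>\<close>.\<close>

definition mild_solution ::
  "'w measure \<Rightarrow> (real \<Rightarrow> L2 \<Rightarrow> 'w \<Rightarrow> real) \<Rightarrow> (real \<Rightarrow> L2 \<Rightarrow> L2) \<Rightarrow> (L2 \<Rightarrow> L2) \<Rightarrow>
     (real \<Rightarrow> 'w \<Rightarrow> L2) \<Rightarrow> bool" where
  "mild_solution M W S R u \<longleftrightarrow>
     (\<forall>t\<ge>0. is_stochastic_integral M W (\<lambda>s. S (t - s) \<circ> R) t (u t))"

definition galerkin_proj :: "nat \<Rightarrow> L2 \<Rightarrow> L2" where
  "galerkin_proj n x = (\<Sum>k=1..n. inner (eigenfun k) x *\<^sub>R eigenfun k)"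

text \<open>\<open>A\<^sub>n\<close>; only meaningful on the span of \<open>e\<^sub>1, \<dots>, e\<^sub>n\<close>, which lies in the domain of \<open>A\<close>.\<close>

definition galerkin_op :: "nat \<Rightarrow> L2 \<Rightarrow> L2" where
  "galerkin_op n x = galerkin_proj n (THE y. (x, y) \<in> dirichlet_laplacian)"

text \<open>\<open>exp(t A\<^sub>n) P\<^sub>n\<close>, by the exponential series.\<close>

definition galerkin_semigroup :: "nat \<Rightarrow> real \<Rightarrow> L2 \<Rightarrow> L2" where
  "galerkin_semigroup n t x =
     (\<Sum>j. (t ^ j / fact j) *\<^sub>R (galerkin_op n ^^ j) (galerkin_proj n x))"

definition galerkin_solution ::
  "'w measure \<Rightarrow> (real \<Rightarrow> L2 \<Rightarrow> 'w \<Rightarrow> real) \<Rightarrow> (L2 \<Rightarrow> L2) \<Rightarrow> nat \<Rightarrow> (real \<Rightarrow> 'w \<Rightarrow> L2) \<Rightarrow> bool" where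
  "galerkin_solution M W R n v \<longleftrightarrow>
     (\<forall>t\<ge>0. is_stochastic_integral M W (\<lambda>s. galerkin_semigroup n (t - s) \<circ> R) t (v t))"

definition weak_error ::
  "'w measure \<Rightarrow> ('h \<Rightarrow> real) \<Rightarrow> ('w \<Rightarrow> 'h) \<Rightarrow> ('w \<Rightarrow> 'h) \<Rightarrow> real" where
  "weak_error M \<phi> X Y =
     \<bar>prob_space.expectation M (\<lambda>\<omega>. \<phi> (X \<omega>)) - prob_space.expectation M (\<lambda>\<omega>. \<phi> (Y \<omega>))\<bar>"


section \<open>The space \<open>C\<^sub>b\<^sup>2\<close>\<close>

text \<open>The second derivative takes values in iterated spaces of bounded operators, isometric to
  bounded bilinear forms with their operator norm.\<close>

definition deriv1 ::
  "('h :: real_normed_vector \<Rightarrow> 'b :: real_normed_vector) \<Rightarrow> 'h \<Rightarrow> 'h \<Rightarrow>\<^sub>L 'b" where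
  "deriv1 \<phi> x = Blinfun (frechet_derivative \<phi> (at x))"

definition deriv2 ::
  "('h :: real_normed_vector \<Rightarrow> 'b :: real_normed_vector) \<Rightarrow> 'h \<Rightarrow> 'h \<Rightarrow>\<^sub>L 'h \<Rightarrow>\<^sub>L 'b" where
  "deriv2 \<phi> = deriv1 (deriv1 \<phi>)"

definition Cb2_norm :: "('h :: real_normed_vector \<Rightarrow> real) \<Rightarrow> ennreal" where
  "Cb2_norm \<phi> = (SUP x. (SUP y. ennreal \<bar>\<phi> y\<bar>) + ennreal (norm (deriv1 \<phi> x)) + ennreal (norm (deriv2 \<phi> x)))"

definition Cb2 :: "('h :: real_normed_vector \<Rightarrow> real) set" where
  "Cb2 = {\<phi>. bounded (range \<phi>) \<and> (\<forall>x. \<phi> differentiable (at x)) \<and>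
     (\<forall>x. deriv1 \<phi> differentiable (at x)) \<and> Cb2_norm \<phi> < \<infinity>}"

end

theory Submission
  imports Defs
begin

text \<open>The sines are complete by Weierstrass' theorem, so the Hilbert-Schmidt norm obeys Parseval's identity
  and the Ito isometry holds for elementary integrands. Consequently \<open>u(T)\<close> and \<open>u\<^sub>n(T)\<close> are
  \<open>L\<^sup>2(\<Omega>)\<close>-limits of the sums \<open>\<Sum>\<^bsub>k \<le> K\<^esub> c\<^sub>k \<xi>\<^sub>k e\<^sub>k\<close> and \<open>\<Sum>\<^bsub>k \<le> n\<^esub> c\<^sub>k \<xi>\<^sub>k e\<^sub>k\<close> with \<open>c\<^sub>k\<^sup>2 = q\<^sub>k\<close>,
  where \<open>\<xi>\<^sub>k\<close> is the left-endpoint Riemann sum of \<open>\<integral> exp (- \<lambda>\<^sub>k (T - s)) d\<beta>\<^sub>k(s)\<close>. The difference \<open>h\<close> of the two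
  sums is centred and independent of the second one, \<open>J\<close>, so in the Taylor expansion
  \<open>\<phi>(J + h) = \<phi>(J) + D\<phi>(J) h + O(\<parallel>h\<parallel>\<^sup>2 / 2)\<close> the linear term has mean zero, and
  \<open>E \<parallel>h\<parallel>\<^sup>2 / 2 = \<Sum>\<^bsub>n < k \<le> K\<^esub> q\<^sub>k E \<xi>\<^sub>k\<^sup>2 / 2\<close>, where \<open>E \<xi>\<^sub>k\<^sup>2 \<le> \<integral>\<^sub>0\<^sup>T exp (- 2 \<lambda>\<^sub>k (T - s)) ds\<close>
  because the integrand is increasing.\<close>

section \<open>The sine basis of \<open>L\<^sup>2([0,1])\<close>\<close>

text \<open>\<open>S\<close> is known only through its generator and \<open>Qhalf\<close> only
  through its square, so both first have to be diagonalised on the sines. This needs the sines in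
  the domain of the Laplacian, hence in H^1_0, although they do not have compact support: hence the
  cutoffs. The two solutions are known only as limits of unspecified elementary integrals. The
  isometry lets one explicit family replace these, and setting the coefficients \<open>c k\<close>
  to 0 for k > n puts the Galerkin solution into the same family. On a common time grid the two sums
  then differ exactly by the modes n < k \<le> K, which are driven by Brownian motions independent
  of the first n. The constant 1/4 is the Taylor factor 1/2 times the 1/2 in the integral (1 - exp
  (-2 \<lambda> T)) / (2 \<lambda>) of exp (-2 \<lambda> (T - s)) over [0,T].\<close>

lemma L2_rel_refl: "sq_integrable f \<Longrightarrow> L2_rel f f"
  by (simp add: L2_rel_def)

lemma L2_exhaust:
  obtains f where "sq_integrable f" "x = L2_of f"
  using L2.abs_induct[of "\<lambda>x. \<exists>f. sq_integrable f \<and> x = L2_of f" x] by (auto simp: L2_rel_def)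

lemma inner_L2_of:
  "sq_integrable f \<Longrightarrow> sq_integrable g \<Longrightarrow> inner (L2_of f) (L2_of g) = (\<integral>x. f x * g x \<partial>unit_measure)"
  by (simp add: inner_L2.abs_eq L2_rel_refl)

lemma L2_of_add:
  "sq_integrable f \<Longrightarrow> sq_integrable g \<Longrightarrow> L2_of f + L2_of g = L2_of (\<lambda>x. f x + g x)"
  by (simp add: plus_L2.abs_eq L2_rel_refl)

lemma L2_of_scaleR: "sq_integrable f \<Longrightarrow> c *\<^sub>R L2_of f = L2_of (\<lambda>x. c * f x)"
  by (simp add: scaleR_L2.abs_eq L2_rel_refl)

lemma sq_integrable_diff:
  assumes "sq_integrable f" "sq_integrable g"
  shows "sq_integrable (\<lambda>x. f x - g x)"
  using sq_integrable_add[OF assms(1) sq_integrable_scale[OF assms(2), of "-1"]] by simp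

lemma L2_of_diff:
  assumes "sq_integrable f" "sq_integrable g"
  shows "L2_of f - L2_of g = L2_of (\<lambda>x. f x - g x)"
proof -
  have "L2_of f - L2_of g = L2_of f + (-1) *\<^sub>R L2_of g" by simp
  also have "\<dots> = L2_of (\<lambda>x. f x + (-1) * g x)"
    using assms by (simp only: L2_of_scaleR L2_of_add sq_integrable_scale)
  finally show ?thesis by simp
qed

lemma L2_of_zero: "L2_of (\<lambda>x. 0) = 0"
  by (simp add: zero_L2.abs_eq)

lemma sq_integrable_sum:
  assumes "\<And>i. i \<in> I \<Longrightarrow> sq_integrable (f i)"
  shows "sq_integrable (\<lambda>x. \<Sum>i\<in>I. f i x)"
  using assms by (induction I rule: infinite_finite_induct)
    (auto intro: sq_integrable_zero sq_integrable_add)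

lemma norm_L2_of: "sq_integrable f \<Longrightarrow> (norm (L2_of f))\<^sup>2 = (\<integral>x. (f x)\<^sup>2 \<partial>unit_measure)"
  unfolding power2_norm_eq_inner by (simp add: inner_L2_of power2_eq_square)

lemma finite_measure_unit: "finite_measure unit_measure"
  by (rule finite_measureI) (simp add: emeasure_restrict_space space_restrict_space)

lemma measurable_unit_iff: "f \<in> borel_measurable unit_measure \<longleftrightarrow> f \<in> borel_measurable (restrict_space borel {0..1})"
  by (rule arg_cong[where f = "\<lambda>A. f \<in> A"], rule measurable_cong_sets)
    (use sets_restrict_space_cong[OF sets_lborel] in auto)

lemma sq_integrable_bounded:
  fixes f :: "real \<Rightarrow> real"
  assumes "f \<in> borel_measurable unit_measure" "\<And>x. x \<in> {0..1} \<Longrightarrow> \<bar>f x\<bar> \<le> C"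
  shows "sq_integrable f"
proof -
  interpret finite_measure unit_measure by (rule finite_measure_unit)
  have "(f x)\<^sup>2 \<le> C\<^sup>2" if "x \<in> {0..1}" for x
    using assms(2)[OF that] by (metis abs_ge_zero order_trans power2_abs power_mono)
  then show ?thesis unfolding sq_integrable_def using assms(1)
    by (auto intro!: integrable_const_bound[where B = "C\<^sup>2"] AE_I2 simp: space_restrict_space)
qed

lemma sq_integrable_continuous:
  fixes f :: "real \<Rightarrow> real"
  assumes "continuous_on {0..1} f"
  shows "sq_integrable f"
proof -
  obtain C where "\<And>x. x \<in> {0..1} \<Longrightarrow> \<bar>f x\<bar> \<le> C"
    using compact_imp_bounded[OF compact_continuous_image[OF assms compact_Icc]]
    by (force simp: bounded_iff)
  then show ?thesis
    using borel_measurable_continuous_on_restrict[OF assms]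
    by (intro sq_integrable_bounded) (auto simp: measurable_unit_iff)
qed

lemma integral_unit_measure: "(\<integral>x. f x \<partial>unit_measure) = (LINT x:{0..1}|lborel. (f x::real))"
  by (simp add: integral_restrict_space set_lebesgue_integral_def)

lemma integral_unit_FTC:
  assumes "\<And>x. (F has_real_derivative f x) (at x)" "continuous_on UNIV f"
  shows "(\<integral>x. f x \<partial>unit_measure) = F 1 - F (0::real)"
  unfolding integral_unit_measure set_lebesgue_integral_def real_scaleR_def
  by (subst mult.commute, rule integral_FTC_Icc_real)
    (use assms in \<open>auto simp: continuous_on_eq_continuous_at\<close>)

text \<open>Dominated convergence for squares. As \<open>L2_of\<close> is meaningful only on square
  integrable functions, the domination by \<open>g\<close> is first passed to \<open>f m\<close> and
  to the limit; then (f m - f')^2 \<le> 4 g^2 is an integrable majorant.\<close>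

lemma L2_of_tendsto:
  assumes [measurable]: "\<And>m. f m \<in> borel_measurable unit_measure" "f' \<in> borel_measurable unit_measure"
    and lim: "AE x in unit_measure. (\<lambda>m. f m x) \<longlonglongrightarrow> f' x"
    and g: "sq_integrable g" "\<And>m x. x \<in> {0..1} \<Longrightarrow> \<bar>f m x\<bar> \<le> g x"
  shows "(\<lambda>m. L2_of (f m)) \<longlonglongrightarrow> L2_of f'"
proof -
  have g_int: "integrable unit_measure (\<lambda>x. (g x)\<^sup>2)" using g(1) by (simp add: sq_integrable_def)
  have le: "AE x in unit_measure. \<bar>f' x\<bar> \<le> g x"
    using lim AE_space
  proof eventually_elim
    case (elim x)
    have "(\<lambda>m. \<bar>f m x\<bar>) \<longlonglongrightarrow> \<bar>f' x\<bar>" using elim by (intro tendsto_rabs) auto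
    then show ?case using elim g(2)[of x]
      by (intro LIMSEQ_le_const2) (auto simp: space_restrict_space)
  qed
  have sq: "sq_integrable (f m)" for m
    unfolding sq_integrable_def using g_int
    by (auto intro!: Bochner_Integration.integrable_bound[OF g_int] AE_I2 abs_le_square_iff[THEN iffD1]
        order_trans[OF g(2) abs_ge_self] simp: space_restrict_space)
  have sq': "sq_integrable f'"
    unfolding sq_integrable_def
  proof safe
    show "integrable unit_measure (\<lambda>x. (f' x)\<^sup>2)"
      using le by (intro Bochner_Integration.integrable_bound[OF g_int])
        (auto elim!: eventually_mono intro!: abs_le_square_iff[THEN iffD1] dest: order_trans[OF _ abs_ge_self])
  qed simp
  have "(\<lambda>m. \<integral>x. (f m x - f' x)\<^sup>2 \<partial>unit_measure) \<longlonglongrightarrow> (\<integral>x. 0 \<partial>unit_measure)"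
  proof (rule integral_dominated_convergence[where w = "\<lambda>x. 4 * (g x)\<^sup>2"])
    show "AE x in unit_measure. (\<lambda>m. (f m x - f' x)\<^sup>2) \<longlonglongrightarrow> 0"
      using lim by eventually_elim (auto intro!: tendsto_eq_intros)
    show "AE x in unit_measure. norm ((f m x - f' x)\<^sup>2) \<le> 4 * (g x)\<^sup>2" for m
      using le AE_space
    proof eventually_elim
      case (elim x)
      have "\<bar>f m x\<bar> \<le> g x" using elim g(2) by (auto simp: space_restrict_space)
      then have "\<bar>f m x - f' x\<bar> \<le> \<bar>2 * g x\<bar>" using elim by linarith
      then have "(f m x - f' x)\<^sup>2 \<le> (2 * g x)\<^sup>2" by (rule abs_le_square_iff[THEN iffD1])
      then show ?case by (simp add: power_mult_distrib)
    qed
  qed (use g_int in auto)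
  then have "(\<lambda>m. (norm (L2_of (f m) - L2_of f'))\<^sup>2) \<longlonglongrightarrow> 0"
    by (simp add: L2_of_diff norm_L2_of sq sq' sq_integrable_diff)
  then have "(\<lambda>m. norm (L2_of (f m) - L2_of f')) \<longlonglongrightarrow> 0"
    using tendsto_real_sqrt by fastforce
  then show ?thesis
    by (simp add: LIM_zero_iff tendsto_norm_zero_iff)
qed

lemma L2_of_sum:
  assumes "\<And>i. i \<in> I \<Longrightarrow> sq_integrable (f i)"
  shows "L2_of (\<lambda>x. \<Sum>i\<in>I. f i x) = (\<Sum>i\<in>I. L2_of (f i))"
  using assms
proof (induction I rule: infinite_finite_induct)
  case (insert i I)
  then show ?case
    using L2_of_add[of "f i" "\<lambda>x. \<Sum>i\<in>I. f i x"] by (simp add: sq_integrable_sum)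
qed (auto simp: L2_of_zero)

lemma AE_unit_measure_interior:
  assumes "\<And>x. 0 < x \<Longrightarrow> x < 1 \<Longrightarrow> P x"
  shows "AE x in unit_measure. P x"
proof -
  have "AE x in lborel. x \<noteq> (0::real)" "AE x in lborel. x \<noteq> (1::real)"
    by (rule AE_lborel_singleton)+
  then have "AE x in lborel. x \<in> {0..1} \<longrightarrow> P x"
    by eventually_elim (use assms in auto)
  then show ?thesis by (subst AE_restrict_space_iff) auto
qed

section \<open>Density of the span of the sines\<close>

lemma sq_integrable_eigenfun: "sq_integrable (\<lambda>x. sqrt 2 * sin (real k * pi * x))"
  by (intro sq_integrable_continuous continuous_intros)

text \<open>Each factor cos (pi x) is absorbed by 2 sin (k pi x) cos (pi x) = sin ((k+1) pi x) + sin
  ((k-1) pi x), which shifts the frequency; the induction therefore runs over all k at once.\<close>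

lemma sin_cos_power_in_span:
  "L2_of (\<lambda>x. sin (real k * pi * x) * cos (pi * x) ^ i) \<in> span (range eigenfun)"
proof (induction i arbitrary: k)
  case 0
  have "L2_of (\<lambda>x. sin (real k * pi * x)) = (1 / sqrt 2) *\<^sub>R eigenfun k"
    by (simp add: eigenfun_def L2_of_scaleR sq_integrable_eigenfun)
  then show ?case by (simp add: span_scale span_base)
next
  case (Suc i)
  show ?case
  proof (cases k)
    case 0
    then show ?thesis by (simp add: L2_of_zero span_zero)
  next
    case k: (Suc j)
    let ?f = "\<lambda>k x. sin (real k * pi * x) * cos (pi * x) ^ i"
    have sq: "sq_integrable (?f k)" for k
      by (intro sq_integrable_continuous continuous_intros)
    have eq: "sin (real k * pi * x) * cos (pi * x) ^ Suc i = (1 / 2) * (?f (Suc k) x + ?f j x)" for x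
    proof -
      have "sin (real k * pi * x + pi * x) + sin (real k * pi * x - pi * x)
          = 2 * (sin (real k * pi * x) * cos (pi * x))"
        by (simp add: sin_add sin_diff)
      moreover have "real (Suc k) * pi * x = real k * pi * x + pi * x"
        "real j * pi * x = real k * pi * x - pi * x"
        by (simp_all add: k algebra_simps)
      ultimately have "sin (real (Suc k) * pi * x) + sin (real j * pi * x)
          = 2 * (sin (real k * pi * x) * cos (pi * x))"
        by simp
      then have "(sin (real (Suc k) * pi * x) + sin (real j * pi * x)) * cos (pi * x) ^ i
          = 2 * (sin (real k * pi * x) * cos (pi * x)) * cos (pi * x) ^ i"
        by (rule arg_cong)
      then show ?thesis by (simp add: algebra_simps del: of_nat_Suc)
    qed
    have "L2_of (\<lambda>x. sin (real k * pi * x) * cos (pi * x) ^ Suc i)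
        = (1 / 2) *\<^sub>R (L2_of (?f (Suc k)) + L2_of (?f j))"
      unfolding eq by (simp only: L2_of_scaleR L2_of_add sq sq_integrable_add)
    then show ?thesis
      using Suc.IH[of "Suc k"] Suc.IH[of j] by (simp only: span_scale span_add)
  qed
qed

lemma sin_polynomial_in_span:
  assumes "real_polynomial_function p"
  shows "L2_of (\<lambda>x. sin (pi * x) * p (cos (pi * x))) \<in> span (range eigenfun)"
proof -
  obtain a n where p: "p = (\<lambda>x. \<Sum>i\<le>n. a i * x ^ i)"
    using assms real_polynomial_function_iff_sum by auto
  have sq: "sq_integrable (\<lambda>x. sin (pi * x) * cos (pi * x) ^ i)" for i
    by (intro sq_integrable_continuous continuous_intros)
  have "(\<lambda>x. sin (pi * x) * p (cos (pi * x)))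
      = (\<lambda>x. \<Sum>i\<le>n. a i * (sin (pi * x) * cos (pi * x) ^ i))"
    by (auto simp: p sum_distrib_left ac_simps)
  then have "L2_of (\<lambda>x. sin (pi * x) * p (cos (pi * x)))
      = (\<Sum>i\<le>n. a i *\<^sub>R L2_of (\<lambda>x. sin (pi * x) * cos (pi * x) ^ i))"
    by (simp add: L2_of_sum L2_of_scaleR sq sq_integrable_scale)
  then show ?thesis
    using sin_cos_power_in_span[of 1] by (auto intro!: span_sum span_scale)
qed

text \<open>Since \<open>sin (k \<pi> x) = sin (\<pi> x) U\<^bsub>k-1\<^esub>(cos (\<pi> x))\<close>, Weierstrass' theorem in the variable \<open>cos (\<pi> x)\<close>
  approximates \<open>g(x) / max (sin (\<pi> x)) \<epsilon>\<close>.\<close>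

lemma continuous_in_closure_eigenfun:
  fixes g :: "real \<Rightarrow> real"
  assumes g: "continuous_on {0..1} g"
  shows "L2_of g \<in> closure (span (range eigenfun))"
proof -
  define r where "r m x = g x / max (sin (pi * x)) (1 / real (Suc m))" for m x
  \<comment> \<open>The variable is y = cos (pi x), so x = arccos y / pi maps [-1,1] back onto
    [0,1].\<close>
  have "\<exists>p. real_polynomial_function p \<and> (\<forall>y\<in>{-1..1}. \<bar>r m (arccos y / pi) - p y\<bar> < 1 / real (Suc m))" for m
  proof -
    have "continuous_on {0..1} (r m)"
      unfolding r_def by (intro continuous_intros g) (auto simp: max_def)
    then have "continuous_on {-1..1} (\<lambda>y. r m (arccos y / pi))"
      by (rule continuous_on_compose2)
        (auto intro!: continuous_intros simp: arccos_lbound arccos_ubound divide_simps)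
    then show ?thesis
      using Stone_Weierstrass_real_polynomial_function[of "{-1..1::real}" _ "1 / real (Suc m)"]
      by (metis compact_Icc of_nat_0_less_iff zero_less_Suc zero_less_divide_1_iff)
  qed
  then obtain p where p: "\<And>m. real_polynomial_function (p m)"
    "\<And>m y. y \<in> {-1..1} \<Longrightarrow> \<bar>r m (arccos y / pi) - p m y\<bar> < 1 / real (Suc m)"
    by metis
  let ?f = "\<lambda>m x. sin (pi * x) * p m (cos (pi * x))"
  let ?h = "\<lambda>m x. sin (pi * x) * r m x"
  have s01: "0 \<le> sin (pi * x)" if "x \<in> {0..1}" for x
    using that by (intro sin_ge_zero) (auto simp: mult_le_cancel_left1)
  have near: "\<bar>?h m x - ?f m x\<bar> \<le> 1 / real (Suc m)" if x: "x \<in> {0..1}" for m x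
  proof -
    have "arccos (cos (pi * x)) / pi = x"
      using x by (subst arccos_cos) (auto simp: mult_le_cancel_left1)
    then have "\<bar>r m x - p m (cos (pi * x))\<bar> < 1 / real (Suc m)"
      using p(2)[of "cos (pi * x)" m] by simp
    then have "\<bar>sin (pi * x)\<bar> * \<bar>r m x - p m (cos (pi * x))\<bar> \<le> 1 * (1 / real (Suc m))"
      by (intro mult_mono) auto
    then show ?thesis by (simp add: abs_mult[symmetric] right_diff_distrib)
  qed
  \<comment> \<open>The quotient sin / max(sin, 1/(m+1)) lies in [0,1], so the majorant does not
    depend on m even though \<open>r m\<close> blows up near the endpoints.\<close>
  have h_le: "\<bar>?h m x\<bar> \<le> \<bar>g x\<bar>" if x: "x \<in> {0..1}" for m x
  proof -
    have "\<bar>?h m x\<bar> = \<bar>g x\<bar> * (sin (pi * x) / max (sin (pi * x)) (1 / real (Suc m)))"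
      using s01[OF x] by (simp add: r_def abs_mult max_def)
    also have "\<dots> \<le> \<bar>g x\<bar> * 1"
      by (intro mult_left_mono) (auto simp: divide_le_eq_1 less_max_iff_disj)
    finally show ?thesis by simp
  qed
  have lim: "(\<lambda>m. ?f m x) \<longlonglongrightarrow> g x" if x: "0 < x" "x < 1" for x
  proof -
    have pos: "0 < sin (pi * x)" using x by (intro sin_gt_zero) auto
    have inv: "(\<lambda>m. 1 / real (Suc m)) \<longlonglongrightarrow> 0"
      using LIMSEQ_inverse_real_of_nat by (simp add: inverse_eq_divide)
    have "\<forall>\<^sub>F m in sequentially. 1 / real (Suc m) < sin (pi * x)"
      using inv pos by (rule order_tendstoD)
    then have "\<forall>\<^sub>F m in sequentially. ?h m x = g x"
      by eventually_elim (use pos in \<open>auto simp: r_def max_def\<close>)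
    then have 1: "(\<lambda>m. ?h m x) \<longlonglongrightarrow> g x" by (rule tendsto_eventually)
    have "(\<lambda>m. ?h m x - ?f m x) \<longlonglongrightarrow> 0"
      using near[of x] x by (intro Lim_null_comparison[OF _ inv]) auto
    from tendsto_diff[OF 1 this] show ?thesis by simp
  qed
  have p_cont: "continuous_on UNIV (p m)" for m
    using p(1) by (simp add: continuous_on_polymonial_function real_polynomial_function_eq)
  have f_sq: "sq_integrable (?f m)" for m
    by (intro sq_integrable_continuous continuous_intros continuous_on_compose2[OF p_cont]) auto
  have "(\<lambda>m. L2_of (?f m)) \<longlonglongrightarrow> L2_of g"
  proof (rule L2_of_tendsto[where g = "\<lambda>x. \<bar>g x\<bar> + 1"])
    show "?f m \<in> borel_measurable unit_measure" for m
      using f_sq by (simp add: sq_integrable_def)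
    show "g \<in> borel_measurable unit_measure"
      using sq_integrable_continuous[OF g] by (simp add: sq_integrable_def)
    show "AE x in unit_measure. (\<lambda>m. ?f m x) \<longlonglongrightarrow> g x"
      by (rule AE_unit_measure_interior) (rule lim)
    show "sq_integrable (\<lambda>x. \<bar>g x\<bar> + 1)"
      by (intro sq_integrable_continuous continuous_intros g)
    show "\<bar>?f m x\<bar> \<le> \<bar>g x\<bar> + 1" if "x \<in> {0..1}" for m x
    proof -
      have "1 / real (Suc m) \<le> 1" by simp
      then show ?thesis using near[OF that, of m] h_le[OF that, of m] by linarith
    qed
  qed
  then show ?thesis
    unfolding closure_sequential using sin_polynomial_in_span[OF p(1)]
    by (intro exI[of _ "\<lambda>m. L2_of (?f m)"]) simp
qed

text \<open>Two reductions to continuous functions. A bounded measurable function is an almost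
  everywhere limit of continuous ones, and an arbitrary square integrable function is the limit of
  its truncations to [-n, n]; \<open>L2_of_tendsto\<close> applies in both cases.\<close>

lemma closure_span_eigenfun: "closure (span (range eigenfun)) = UNIV"
proof -
  let ?V = "closure (span (range eigenfun))"
  have bounded_case: "L2_of f \<in> ?V"
    if [measurable]: "f \<in> borel_measurable unit_measure" and C: "\<And>x. x \<in> {0..1} \<Longrightarrow> \<bar>f x\<bar> \<le> C" for f and C :: real
  proof -
    \<comment> \<open>Extension by zero, because \<open>measurable_on\<close> produces its
      continuous approximations on the whole line.\<close>
    define F where "F x = (if x \<in> {0..1} then f x else 0)" for x
    have "F \<in> borel_measurable borel"
      unfolding F_def using that(1) by (subst measurable_restrict_space_iff[symmetric]) (auto simp: measurable_unit_iff)
    then have "F \<in> borel_measurable (lebesgue_on UNIV)"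
      unfolding lebesgue_on_UNIV_eq by (intro measurable_completion) simp
    then have "F measurable_on UNIV"
      by (simp add: measurable_on_iff_borel_measurable)
    then obtain N g where N: "negligible N" and g: "\<And>n. continuous_on UNIV (g n)"
      "\<And>x. x \<notin> N \<Longrightarrow> (\<lambda>n. g n x) \<longlonglongrightarrow> F x"
      unfolding measurable_on_def by auto
    have "AE x in lebesgue. x \<notin> N"
      using N by (simp add: AE_not_in negligible_iff_null_sets)
    then have "AE x in lborel. x \<notin> N" by (simp add: AE_completion_iff)
    then have AE: "AE x in unit_measure. x \<notin> N"
      by (subst AE_restrict_space_iff) auto
    \<comment> \<open>Clipping to [-C, C] supplies a majorant and leaves the limit unchanged, since
      f takes its values there.\<close>
    let ?h = "\<lambda>n x. max (-C) (min C (g n x))"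
    have cont: "continuous_on {0..1} (?h n)" for n
      by (intro continuous_intros continuous_on_subset[OF g(1)]) auto
    have "(\<lambda>n. L2_of (?h n)) \<longlonglongrightarrow> L2_of f"
    proof (rule L2_of_tendsto[where g = "\<lambda>x. \<bar>C\<bar>"])
      show "?h n \<in> borel_measurable unit_measure" for n
        using sq_integrable_continuous[OF cont] by (simp add: sq_integrable_def)
      show "AE x in unit_measure. (\<lambda>n. ?h n x) \<longlonglongrightarrow> f x"
        using AE AE_space
      proof eventually_elim
        case (elim x)
        have "(\<lambda>n. ?h n x) \<longlonglongrightarrow> max (-C) (min C (f x))"
          using elim g(2)[of x] by (intro tendsto_intros) (auto simp: F_def space_restrict_space)
        then show ?case using C[of x] elim by (auto simp: space_restrict_space max_def min_def abs_if split: if_splits)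
      qed
      show "sq_integrable (\<lambda>x. \<bar>C\<bar>)" by (intro sq_integrable_continuous continuous_intros)
    qed (auto simp: that)
    from closed_sequentially[OF closed_closure continuous_in_closure_eigenfun[OF cont] this]
    show ?thesis .
  qed
  have "x \<in> ?V" for x
  proof -
    obtain f where f: "sq_integrable f" "x = L2_of f" by (rule L2_exhaust)
    then have [measurable]: "f \<in> borel_measurable unit_measure" by (simp add: sq_integrable_def)
    let ?h = "\<lambda>n x. max (- real n) (min (real n) (f x))"
    have "(\<lambda>n. L2_of (?h n)) \<longlonglongrightarrow> L2_of f"
    proof (rule L2_of_tendsto[where g = "\<lambda>x. \<bar>f x\<bar>"])
      show "sq_integrable (\<lambda>x. \<bar>f x\<bar>)" using f by (simp add: sq_integrable_def)
      have "(\<lambda>n. ?h n x) \<longlonglongrightarrow> f x" for x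
      proof -
        obtain n0 where n0: "\<bar>f x\<bar> \<le> real n0" using real_arch_simple by blast
        have "?h n x = f x" if "n \<ge> n0" for n
        proof -
          have "\<bar>f x\<bar> \<le> real n" using n0 that by linarith
          then show ?thesis by (auto simp: max_def min_def abs_if split: if_splits)
        qed
        then have "\<forall>\<^sub>F n in sequentially. ?h n x = f x"
          unfolding eventually_sequentially by blast
        then show ?thesis by (rule tendsto_eventually)
      qed
      then show "AE x in unit_measure. (\<lambda>n. ?h n x) \<longlonglongrightarrow> f x" by simp
    qed (auto simp: max_def min_def)
    moreover have "L2_of (?h n) \<in> ?V" for n
      by (rule bounded_case[where C = "real n"]) auto
    ultimately have "L2_of f \<in> ?V"
      by (blast intro: closed_sequentially[OF closed_closure, of "\<lambda>n. L2_of (?h n)"])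
    then show ?thesis by (simp add: f(2))
  qed
  then show ?thesis by blast
qed

section \<open>Orthonormality, Galerkin projections and Parseval's identity\<close>

lemma integral_cos_unit:
  "(\<integral>x. cos (real_of_int m * pi * x) \<partial>unit_measure) = (if m = 0 then 1 else 0)"
proof (cases "m = 0")
  case True
  then show ?thesis
    using integral_unit_FTC[of "\<lambda>x. x" "\<lambda>_. 1"] by (auto intro: derivative_eq_intros)
next
  case False
  have "(\<integral>x. cos (real_of_int m * pi * x) \<partial>unit_measure)
      = sin (real_of_int m * pi * 1) / (real_of_int m * pi) - sin (real_of_int m * pi * 0) / (real_of_int m * pi)"
    using False by (intro integral_unit_FTC) (auto intro!: derivative_eq_intros continuous_intros)
  also have "\<dots> = 0" using sin_times_pi_eq_0[of "real_of_int m"] by simp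
  finally show ?thesis using False by simp
qed

text \<open>From 2 sin a sin b = cos (a - b) - cos (a + b). The frequency j - k may be negative,
  hence the integers; j + k never vanishes for indices from 1 on.\<close>

lemma eigenfun_orthonormal:
  assumes "j \<ge> 1" "k \<ge> 1"
  shows "inner (eigenfun j) (eigenfun k) = (if j = k then 1 else 0)"
proof -
  have "inner (eigenfun j) (eigenfun k)
      = (\<integral>x. cos (real_of_int (int j - int k) * pi * x) - cos (real_of_int (int j + int k) * pi * x) \<partial>unit_measure)"
  proof -
    have "(sqrt 2 * sin (real j * pi * x)) * (sqrt 2 * sin (real k * pi * x))
      = cos (real_of_int (int j - int k) * pi * x) - cos (real_of_int (int j + int k) * pi * x)" for x
      by (simp add: cos_add cos_diff left_diff_distrib distrib_right)
    then show ?thesis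
      unfolding eigenfun_def by (subst inner_L2_of[OF sq_integrable_eigenfun sq_integrable_eigenfun]) simp
  qed
  also have "\<dots> = (if int j - int k = 0 then 1 else 0) - (if int j + int k = 0 then 1 else 0)"
  proof -
    interpret finite_measure unit_measure by (rule finite_measure_unit)
    have "integrable unit_measure (\<lambda>x. cos (a * x))" for a :: real
      by (rule integrable_const_bound[where B = 1]) (auto simp: measurable_unit_iff intro!: measurable_restrict_space1)
    then show ?thesis
      by (subst Bochner_Integration.integral_diff) (simp_all only: integral_cos_unit)
  qed
  finally show ?thesis using assms by auto
qed

lemma norm_eigenfun: "k \<ge> 1 \<Longrightarrow> norm (eigenfun k) = 1"
  using eigenfun_orthonormal[of k k] by (simp add: norm_eq_sqrt_inner)

text \<open>The span is taken over \<open>range eigenfun\<close>, which includes index 0; this index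
  contributes nothing to it.\<close>

lemma eigenfun_0: "eigenfun 0 = 0"
  by (simp add: eigenfun_def L2_of_zero)

lemma inner_galerkin_proj:
  assumes "k \<ge> 1"
  shows "inner (galerkin_proj n x) (eigenfun k) = (if k \<le> n then inner (eigenfun k) x else 0)"
proof -
  have "inner (galerkin_proj n x) (eigenfun k)
      = (\<Sum>j=1..n. if j = k then inner (eigenfun k) x else 0)"
    unfolding galerkin_proj_def inner_sum_left
    using assms by (intro sum.cong) (auto simp: eigenfun_orthonormal)
  then show ?thesis using assms by (auto simp: sum.delta)
qed

lemma galerkin_proj_residual:
  "(norm (x - galerkin_proj n x))\<^sup>2 = (norm x)\<^sup>2 - (\<Sum>k=1..n. (inner (eigenfun k) x)\<^sup>2)"
proof -
  have 1: "inner x (galerkin_proj n x) = (\<Sum>k=1..n. (inner (eigenfun k) x)\<^sup>2)"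
    unfolding galerkin_proj_def by (simp add: inner_sum_right inner_commute power2_eq_square)
  have "inner (galerkin_proj n x) (galerkin_proj n x)
      = (\<Sum>k=1..n. inner (eigenfun k) x * inner (galerkin_proj n x) (eigenfun k))"
    by (subst (2) galerkin_proj_def) (simp add: inner_sum_right)
  also have "\<dots> = (\<Sum>k=1..n. (inner (eigenfun k) x)\<^sup>2)"
    by (intro sum.cong) (auto simp: inner_galerkin_proj power2_eq_square)
  finally have 2: "inner (galerkin_proj n x) (galerkin_proj n x) = (\<Sum>k=1..n. (inner (eigenfun k) x)\<^sup>2)" .
  show ?thesis
    unfolding power2_norm_eq_inner inner_diff_left inner_diff_right
    using 1 2 by (simp add: inner_commute)
qed

lemma galerkin_proj_span:
  assumes "y \<in> span (range eigenfun)"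
  shows "\<exists>N. \<forall>n\<ge>N. galerkin_proj n y = y"
  using assms
proof (induction rule: span_induct_alt)
  case base
  show ?case by (simp add: galerkin_proj_def)
next
  case (step c x y)
  then obtain N k where N: "\<forall>n\<ge>N. galerkin_proj n y = y" and x: "x = eigenfun k" by auto
  have "galerkin_proj n x = x" if "n \<ge> k" for n
  proof (cases "k = 0")
    case False
    have "galerkin_proj n x = (\<Sum>j=1..n. if j = k then eigenfun k else 0)"
      unfolding galerkin_proj_def x using False by (intro sum.cong) (auto simp: eigenfun_orthonormal)
    then show ?thesis using False that by (auto simp: sum.delta x)
  qed (simp add: x eigenfun_0 galerkin_proj_def)
  moreover have "galerkin_proj n (c *\<^sub>R x + y) = c *\<^sub>R galerkin_proj n x + galerkin_proj n y" for n
    by (simp add: galerkin_proj_def inner_add_right scaleR_add_left sum.distrib scaleR_sum_right)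
  ultimately show ?case using N by (intro exI[of _ "max N k"]) auto
qed

lemma galerkin_proj_contraction: "norm (x - galerkin_proj n x) \<le> norm x"
proof -
  have "(norm (x - galerkin_proj n x))\<^sup>2 \<le> (norm x)\<^sup>2"
    unfolding galerkin_proj_residual by (simp add: sum_nonneg)
  then show ?thesis by (simp add: power2_le_iff_abs_le)
qed

text \<open>The map x - P_n x is a contraction that vanishes, for large n, on any given y of the
  dense span, so its value at x is at most the distance from x to y.\<close>

lemma galerkin_proj_tendsto: "(\<lambda>n. galerkin_proj n x) \<longlonglongrightarrow> x"
proof (rule LIMSEQ_I)
  fix e :: real assume "e > 0"
  have "x \<in> closure (span (range eigenfun))" by (simp add: closure_span_eigenfun)
  then obtain y where y: "y \<in> span (range eigenfun)" "dist y x < e"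
    using \<open>e > 0\<close> by (auto simp: closure_approachable)
  obtain N where N: "\<And>n. n \<ge> N \<Longrightarrow> galerkin_proj n y = y"
    using galerkin_proj_span[OF y(1)] by auto
  have "norm (galerkin_proj n x - x) < e" if "n \<ge> N" for n
  proof -
    have "galerkin_proj n (x - y) = galerkin_proj n x - galerkin_proj n y"
      by (simp add: galerkin_proj_def inner_diff_right scaleR_diff_left sum_subtractf)
    then have "norm (galerkin_proj n x - x) = norm ((x - y) - galerkin_proj n (x - y))"
      using N[OF that] by (simp add: norm_minus_commute algebra_simps)
    also have "\<dots> \<le> norm (x - y)" by (rule galerkin_proj_contraction)
    also have "\<dots> < e" using y(2) by (simp add: dist_norm norm_minus_commute)
    finally show ?thesis .
  qed
  then show "\<exists>N. \<forall>n\<ge>N. norm (galerkin_proj n x - x) < e" by blast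
qed

lemma parseval: "(\<lambda>k. inner (eigenfun (Suc k)) x * inner (eigenfun (Suc k)) y) sums inner x y"
proof -
  have "(\<lambda>n. inner (galerkin_proj n x) y) \<longlonglongrightarrow> inner x y"
    by (intro tendsto_intros galerkin_proj_tendsto)
  moreover have "inner (galerkin_proj n x) y
      = (\<Sum>k<n. inner (eigenfun (Suc k)) x * inner (eigenfun (Suc k)) y)" for n
    unfolding galerkin_proj_def inner_sum_left
    by (rule sum.reindex_bij_witness[of _ Suc "\<lambda>k. k - 1"]) auto
  ultimately show ?thesis by (simp add: sums_def)
qed

lemma eigenfun_total:
  assumes "\<And>k. k \<ge> 1 \<Longrightarrow> inner (eigenfun k) x = 0"
  shows "x = 0"
  using parseval[of x x] assms sums_unique2[OF sums_zero, of "inner x x"] by simp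

section \<open>The Dirichlet Laplacian and its semigroup\<close>

lemma DERIV_imp_continuous_on:
  assumes "\<And>x. (f has_real_derivative f' x) (at x)"
  shows "continuous_on S f"
  using assms by (intro continuous_at_imp_continuous_on ballI DERIV_isCont)

lemma test_functionD:
  assumes "test_function \<psi>"
  shows "\<And>x. (\<psi> has_real_derivative deriv \<psi> x) (at x)" "continuous_on UNIV (deriv \<psi>)"
    "\<psi> 0 = 0" "\<psi> 1 = 0"
proof -
  obtain D K where D: "\<And>x. (\<psi> has_vector_derivative D x) (at x)" "continuous_on UNIV D"
    and K: "K \<subseteq> {0<..<1}" "\<And>x. x \<notin> K \<Longrightarrow> \<psi> x = 0"
    using assms unfolding test_function_def C1_differentiable_on_def by auto
  have D': "(\<psi> has_real_derivative D x) (at x)" for x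
    using D(1) by (simp add: has_real_derivative_iff_has_vector_derivative)
  then have "deriv \<psi> = D" by (auto intro: DERIV_imp_deriv)
  then show "\<And>x. (\<psi> has_real_derivative deriv \<psi> x) (at x)" "continuous_on UNIV (deriv \<psi>)"
    using D' D(2) by auto
  have "0 \<notin> K" "1 \<notin> K" using K(1) by fastforce+
  then show "\<psi> 0 = 0" "\<psi> 1 = 0" using K(2) by auto
qed

lemma sq_integrable_test_function:
  assumes "test_function \<psi>"
  shows "sq_integrable \<psi>" "sq_integrable (deriv \<psi>)"
proof -
  have "continuous_on {0..1} \<psi>"
    using test_functionD(1)[OF assms] by (auto intro!: DERIV_atLeastAtMost_imp_continuous_on)
  then show "sq_integrable \<psi>" by (rule sq_integrable_continuous)
  show "sq_integrable (deriv \<psi>)"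
    using test_functionD(2)[OF assms] by (auto intro: sq_integrable_continuous continuous_on_subset)
qed

lemma inner_test_by_parts:
  assumes F: "\<And>x. (F has_real_derivative F' x) (at x)" "continuous_on UNIV F'"
    and \<psi>: "test_function \<psi>"
  shows "inner (L2_of F) (L2_of (deriv \<psi>)) = - inner (L2_of F') (L2_of \<psi>)"
proof -
  note t = test_functionD[OF \<psi>]
  have contF: "continuous_on UNIV F" and cont\<psi>: "continuous_on UNIV \<psi>"
    by (rule DERIV_imp_continuous_on, rule F t)+
  have sq: "sq_integrable F" "sq_integrable F'"
    using contF F(2) by (auto intro: sq_integrable_continuous continuous_on_subset)
  note sq\<psi> = sq_integrable_test_function[OF \<psi>]
  have "(\<integral>x. F' x * \<psi> x + F x * deriv \<psi> x \<partial>unit_measure) = F 1 * \<psi> 1 - F 0 * \<psi> 0"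
    by (rule integral_unit_FTC)
      (auto intro!: derivative_eq_intros F t continuous_intros contF cont\<psi>)
  then have "(\<integral>x. F' x * \<psi> x \<partial>unit_measure) + (\<integral>x. F x * deriv \<psi> x \<partial>unit_measure) = 0"
    using sq sq\<psi> by (simp add: sq_integrable_mult t)
  then show ?thesis
    using sq sq\<psi> by (simp add: inner_L2_of)
qed

lemma has_weak_deriv_classical:
  assumes "\<And>x. (F has_real_derivative F' x) (at x)" "continuous_on UNIV F'"
  shows "has_weak_deriv (L2_of F) (L2_of F')"
  unfolding has_weak_deriv_def using inner_test_by_parts[OF assms] by blast

text \<open>A \<open>C\<^sup>1\<close> step from \<open>0\<close> (for \<open>z \<le> 0\<close>) to \<open>1\<close> (as \<open>z \<rightarrow> \<infinity>\<close>). Evaluated at \<open>m x (1 - x) - 1\<close> it cuts off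
  near the boundary, and the derivative of the cutoff has size \<open>m\<close> only where \<open>x (1 - x)\<close> is of order \<open>1/m\<close>.\<close>

definition step :: "real \<Rightarrow> real" where
  "step z = (max 0 z)\<^sup>2 / (1 + (max 0 z)\<^sup>2)"

definition step' :: "real \<Rightarrow> real" where
  "step' z = 2 * max 0 z / (1 + (max 0 z)\<^sup>2)\<^sup>2"

text \<open>Squaring removes the kink of the positive part: at 0 the difference quotient is bounded
  by |h|.\<close>

lemma DERIV_max_0_squared: "((\<lambda>z. (max 0 z)\<^sup>2) has_real_derivative 2 * max 0 z) (at z)"
proof -
  consider "z > 0" | "z < 0" | "z = 0" by linarith
  then show ?thesis
  proof cases
    case 1
    have "((\<lambda>z. z\<^sup>2) has_real_derivative 2 * max 0 z) (at z)"
      using 1 by (auto intro!: derivative_eq_intros)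
    then show ?thesis
      by (rule has_field_derivative_transform_within_open[where S = "{0<..}"]) (use 1 in auto)
  next
    case 2
    have "((\<lambda>z. 0) has_real_derivative 2 * max 0 z) (at z)"
      using 2 by auto
    then show ?thesis
      by (rule has_field_derivative_transform_within_open[where S = "{..<0}"]) (use 2 in auto)
  next
    case 3
    have "((\<lambda>h. ((max 0 h)\<^sup>2 - 0) / h) \<longlongrightarrow> 0) (at (0::real))"
    proof (rule Lim_null_comparison)
      show "\<forall>\<^sub>F h in at (0::real). norm (((max 0 h)\<^sup>2 - 0) / h) \<le> \<bar>h\<bar>"
        by (auto simp: max_def power2_eq_square abs_mult)
      show "((\<lambda>h. \<bar>h\<bar>) \<longlongrightarrow> 0) (at (0::real))" by (auto intro!: tendsto_eq_intros)
    qed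
    then show ?thesis using 3 by (simp add: DERIV_def)
  qed
qed

lemma DERIV_step: "(step has_real_derivative step' z) (at z)"
proof -
  have ne: "1 + (max 0 z)\<^sup>2 \<noteq> 0" for z :: real
    using add_pos_nonneg[of 1 "(max 0 z)\<^sup>2"] by (metis less_irrefl zero_le_power2 zero_less_one)
  show ?thesis
    unfolding step_def[abs_def] step'_def
    by (rule derivative_eq_intros DERIV_max_0_squared refl ne)+
      (simp add: power2_eq_square algebra_simps)
qed

lemma step_bounds: "0 \<le> step z" "step z \<le> 1"
  by (auto simp: step_def divide_le_eq_1 add_pos_nonneg)

lemma one_add_sq_pos: "0 < 1 + (z::real)\<^sup>2"
  by (simp add: add_pos_nonneg)

text \<open>At the argument z = m x (1 - x) - 1 of the cutoff, the factor z + 1 is m x (1 - x),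
  which is what the derivative of the cutoff times a function vanishing linearly at both ends
  produces. The 3 comes from 2 z (z + 1) \<le> 3 (1 + z^2) \<le> 3 (1 + z^2)^2.\<close>

lemma step'_bound:
  assumes "z \<ge> -1"
  shows "\<bar>(z + 1) * step' z\<bar> \<le> 3"
proof (cases "z \<le> 0")
  case False
  have "0 \<le> (z - 1)\<^sup>2" by simp
  then have "2 * z \<le> 1 + z\<^sup>2" by (simp add: power2_eq_square algebra_simps)
  then have "(z + 1) * (2 * z) \<le> 3 * (1 + z\<^sup>2)"
    by (simp add: algebra_simps power2_eq_square)
  also have "\<dots> \<le> 3 * (1 + z\<^sup>2)\<^sup>2"
  proof -
    have "(1 + z\<^sup>2) * 1 \<le> (1 + z\<^sup>2) * (1 + z\<^sup>2)" by (intro mult_left_mono) auto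
    then show ?thesis by (simp add: power2_eq_square)
  qed
  finally have "(z + 1) * (2 * z) \<le> 3 * (1 + z\<^sup>2)\<^sup>2" .
  then have "(z + 1) * (2 * z) / (1 + z\<^sup>2)\<^sup>2 \<le> 3"
    using one_add_sq_pos[of z] by (simp add: divide_le_eq)
  then show ?thesis using False by (simp add: step'_def max_def)
qed (simp add: step'_def)

lemma step_at_top: "(step \<longlongrightarrow> 1) at_top"
proof -
  have "((\<lambda>z::real. 1 - 1 / (1 + z\<^sup>2)) \<longlongrightarrow> 1 - 0) at_top"
    by (intro tendsto_intros tendsto_divide_0 filterlim_at_top_imp_at_infinity
        filterlim_tendsto_add_at_top filterlim_pow_at_top filterlim_ident) auto
  then have "((\<lambda>z::real. 1 - 1 / (1 + z\<^sup>2)) \<longlongrightarrow> 1) at_top" by simp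
  moreover have "\<forall>\<^sub>F z in at_top. 1 - 1 / (1 + z\<^sup>2) = step z"
    using eventually_ge_at_top[of 0]
  proof eventually_elim
    case (elim z)
    then show ?case using one_add_sq_pos[of z] by (simp add: step_def max_def field_simps)
  qed
  ultimately show ?thesis by (rule Lim_transform_eventually)
qed

text \<open>Gives pointwise decay of the same product at interior points, where m x (1 - x) - 1
  tends to infinity.\<close>

lemma step'_at_top: "((\<lambda>z. (z + 1) * step' z) \<longlongrightarrow> 0) at_top"
proof (rule Lim_null_comparison)
  show "\<forall>\<^sub>F z in at_top. norm ((z + 1) * step' z) \<le> 4 / (1 + z\<^sup>2)"
    using eventually_ge_at_top[of 1]
  proof eventually_elim
    case (elim z)
    have "(z + 1) * (2 * z) \<le> (2 * z) * (2 * z)" using elim by (intro mult_right_mono) auto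
    also have "\<dots> \<le> 4 * (1 + z\<^sup>2)" by (simp add: power2_eq_square)
    finally have "(z + 1) * (2 * z) \<le> 4 * (1 + z\<^sup>2)" .
    then have "(z + 1) * (2 * z) / (1 + z\<^sup>2)\<^sup>2 \<le> 4 * (1 + z\<^sup>2) / (1 + z\<^sup>2)\<^sup>2"
      by (rule divide_right_mono) simp
    also have "\<dots> = 4 / (1 + z\<^sup>2)"
    proof -
      have "4 * w / w\<^sup>2 = 4 / w" if "w > 0" for w :: real using that by (simp add: power2_eq_square)
      from this[OF one_add_sq_pos] show ?thesis .
    qed
    finally show ?case using elim by (simp add: step'_def max_def)
  qed
  show "((\<lambda>z::real. 4 / (1 + z\<^sup>2)) \<longlongrightarrow> 0) at_top"
    by (intro tendsto_divide_0 tendsto_intros filterlim_at_top_imp_at_infinity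
        filterlim_tendsto_add_at_top filterlim_pow_at_top filterlim_ident) auto
qed

text \<open>The sine is bounded by its slope times the distance to either endpoint, and min x (1 -
  x) \<le> 2 x (1 - x) because the larger of the two factors is at least 1/2. This decay compensates
  the factor m in the derivative of the cutoff.\<close>

lemma abs_sin_le_boundary:
  assumes "x \<in> {0..1}"
  shows "\<bar>sin (real k * pi * x)\<bar> \<le> 2 * (real k * pi) * (x * (1 - x))"
proof -
  have a: "\<bar>sin (real k * pi * x)\<bar> \<le> real k * pi * x" if "x \<ge> 0" for x
    using abs_sin_x_le_abs_x[of "real k * pi * x"] that by (simp add: abs_mult)
  have "sin (real k * pi * (1 - x)) = - (cos (real k * pi) * sin (real k * pi * x))"
    by (simp add: right_diff_distrib sin_diff)
  then have "\<bar>sin (real k * pi * x)\<bar> = \<bar>sin (real k * pi * (1 - x))\<bar>"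
    by (simp add: cos_npi abs_mult power_abs)
  then have b: "\<bar>sin (real k * pi * x)\<bar> \<le> real k * pi * (1 - x)"
    using a[of "1 - x"] assms by simp
  have "min x (1 - x) \<le> 2 * (x * (1 - x))"
  proof (cases "x \<le> 1 / 2")
    case True
    then have "x * 1 \<le> x * (2 * (1 - x))" using assms by (intro mult_left_mono) auto
    then have "x \<le> 2 * (x * (1 - x))" by (simp add: algebra_simps)
    then show ?thesis using min.cobounded1[of x "1 - x"] by linarith
  next
    case False
    then have "1 * (1 - x) \<le> (2 * x) * (1 - x)" using assms by (intro mult_right_mono) auto
    then have "1 - x \<le> 2 * (x * (1 - x))" by (simp add: algebra_simps)
    then show ?thesis using min.cobounded2[of x "1 - x"] by linarith
  qed
  then have "real k * pi * min x (1 - x) \<le> real k * pi * (2 * (x * (1 - x)))"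
    by (rule mult_left_mono) simp
  moreover have "\<bar>sin (real k * pi * x)\<bar> \<le> real k * pi * min x (1 - x)"
    using a[of x] b assms by (simp add: min_def)
  moreover have "real k * pi * (2 * (x * (1 - x))) = 2 * (real k * pi) * (x * (1 - x))"
    by (simp add: algebra_simps)
  ultimately show ?thesis by linarith
qed

section \<open>The sines in the domain of the Dirichlet Laplacian\<close>

definition eigenfun' :: "nat \<Rightarrow> L2" where
  "eigenfun' k = L2_of (\<lambda>x. sqrt 2 * (real k * pi) * cos (real k * pi * x))"

lemma eigenfun_weak_deriv: "has_weak_deriv (eigenfun k) (eigenfun' k)"
  unfolding eigenfun_def eigenfun'_def
  by (rule has_weak_deriv_classical) (auto intro!: derivative_eq_intros continuous_intros)

lemma sq_integrable_eigenfun': "sq_integrable (\<lambda>x. sqrt 2 * (real k * pi) * cos (real k * pi * x))"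
  by (intro sq_integrable_continuous continuous_intros)

lemma scaleR_eigenfun_eigenval:
  "- eigenval k *\<^sub>R eigenfun k = L2_of (\<lambda>x. - (sqrt 2 * (real k * pi)\<^sup>2 * sin (real k * pi * x)))"
  unfolding eigenfun_def L2_of_scaleR[OF sq_integrable_eigenfun] by (simp add: eigenval_def ac_simps)

lemma eigenfun'_weak_deriv: "has_weak_deriv (eigenfun' k) (- eigenval k *\<^sub>R eigenfun k)"
  unfolding eigenfun'_def scaleR_eigenfun_eigenval
  by (rule has_weak_deriv_classical)
    (auto intro!: derivative_eq_intros continuous_intros simp: power2_eq_square)

text \<open>The approximants are e_k times the cutoff. The derivative has a main term, converging to
  e_k', and a term with the derivative of the cutoff, which is bounded uniformly and tends to 0 at
  interior points. Convergence of the functions and of their derivatives is used both for membership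
  in H^1_0 and to test weak derivatives against e_k itself.\<close>

lemma eigenfun_test_approx:
  obtains \<psi> where "\<And>m. test_function (\<psi> m)" "(\<lambda>m. L2_of (\<psi> m)) \<longlonglongrightarrow> eigenfun k"
    "(\<lambda>m. L2_of (deriv (\<psi> m))) \<longlonglongrightarrow> eigenfun' k"
proof -
  define y where "y m x = real (Suc m) * (x * (1 - x)) - 1" for m x
  define f where "f x = sqrt 2 * sin (real k * pi * x)" for x
  define f' where "f' x = sqrt 2 * (real k * pi) * cos (real k * pi * x)" for x
  define \<psi> where "\<psi> m x = f x * step (y m x)" for m x
  define \<psi>' where "\<psi>' m x = f' x * step (y m x) + f x * (step' (y m x) * (real (Suc m) * (1 - 2 * x)))" for m x
  define C where "C = sqrt 2 * (real k * pi)"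
  have C: "C \<ge> 0" by (simp add: C_def)
  have y': "((\<lambda>x. y m x) has_real_derivative real (Suc m) * (1 - 2 * x)) (at x)" for m x
    unfolding y_def by (auto intro!: derivative_eq_intros simp: algebra_simps)
  have f_deriv: "(f has_real_derivative f' x) (at x)" for x
    unfolding f_def f'_def by (auto intro!: derivative_eq_intros)
  have step_deriv: "((\<lambda>x. step (y m x)) has_real_derivative step' (y m x) * (real (Suc m) * (1 - 2 * x))) (at x)" for m x
    using DERIV_chain2[OF DERIV_step y'] by simp
  have \<psi>_deriv: "(\<psi> m has_real_derivative \<psi>' m x) (at x)" for m x
    unfolding \<psi>_def \<psi>'_def
    by (rule derivative_eq_intros f_deriv step_deriv refl)+ simp
  then have deriv_\<psi>: "deriv (\<psi> m) = \<psi>' m" for m by (auto intro: DERIV_imp_deriv)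
  have step_cont: "continuous_on UNIV step"
    by (rule DERIV_imp_continuous_on, rule DERIV_step)
  have step'_cont: "continuous_on UNIV step'"
    unfolding step'_def using one_add_sq_pos
    by (intro continuous_intros) (metis less_irrefl power_eq_0_iff)
  have y_cont: "continuous_on S (y m)" for S m
    unfolding y_def by (intro continuous_intros)
  have \<psi>_cont: "continuous_on UNIV (\<psi> m)" for m
    by (rule DERIV_imp_continuous_on, rule \<psi>_deriv)
  have \<psi>'_cont: "continuous_on UNIV (\<psi>' m)" for m
    unfolding \<psi>'_def f_def f'_def
    by (intro continuous_intros continuous_on_compose2[OF step_cont y_cont]
        continuous_on_compose2[OF step'_cont y_cont]) auto
  have test: "test_function (\<psi> m)" for m
    unfolding test_function_def
  \<comment> \<open>\<open>step\<close> vanishes on (-\<infinity>, 0], and \<open>y m\<close> is -1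
    at both endpoints, so the closed set where \<open>y m\<close> is nonnegative stays inside the
    open interval.\<close>
  proof (intro conjI exI[of _ "{0..1} \<inter> {x. 0 \<le> y m x}"])
    show "\<psi> m C1_differentiable_on UNIV"
      unfolding C1_differentiable_on_def using \<psi>_deriv \<psi>'_cont
      by (auto simp: has_real_derivative_iff_has_vector_derivative)
    let ?K = "{0..1} \<inter> {x. 0 \<le> y m x}"
    show "compact ?K"
      by (intro compact_Int_closed closed_Collect_le y_cont continuous_intros) auto
    show "?K \<subseteq> {0<..<1}"
    proof
      fix x assume x: "x \<in> ?K"
      then have "x \<noteq> 0" "x \<noteq> 1" by (auto simp: y_def)
      then show "x \<in> {0<..<1}" using x by auto
    qed
    show "\<forall>x. x \<notin> ?K \<longrightarrow> \<psi> m x = 0"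
    proof (intro allI impI)
      fix x assume x: "x \<notin> ?K"
      have "y m x \<le> 0"
      proof (cases "x \<in> {0..1}")
        case False
        then have "x * (1 - x) \<le> 0"
            by (cases "x < 0") (auto intro: mult_nonpos_nonneg mult_nonneg_nonpos)
        then have "real (Suc m) * (x * (1 - x)) \<le> 0"
          by (rule mult_nonneg_nonpos[rotated]) simp
        then show ?thesis by (simp add: y_def)
      qed (use x in auto)
      then show "\<psi> m x = 0" by (simp add: \<psi>_def step_def)
    qed
  qed
  have y_top: "filterlim (\<lambda>m. y m x) at_top sequentially" if "0 < x" "x < 1" for x
  proof -
    have "filterlim (\<lambda>m. -1 + x * (1 - x) * real (Suc m)) at_top sequentially"
      using that by (intro filterlim_tendsto_add_at_top[OF tendsto_const]
          filterlim_tendsto_pos_mult_at_top[OF tendsto_const]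
          filterlim_compose[OF filterlim_real_sequentially filterlim_Suc]) auto
    then show ?thesis by (simp add: y_def algebra_simps)
  qed
  have f_le: "\<bar>f x\<bar> \<le> 2 * C * (x * (1 - x))" if "x \<in> {0..1}" for x
    using abs_sin_le_boundary[OF that, of k] by (simp add: f_def C_def abs_mult)
  have second: "\<bar>f x * (step' (y m x) * (real (Suc m) * (1 - 2 * x)))\<bar> \<le> 2 * C * \<bar>(y m x + 1) * step' (y m x)\<bar>"
    if x: "x \<in> {0..1}" for m x
  proof -
    have "\<bar>f x * (step' (y m x) * (real (Suc m) * (1 - 2 * x)))\<bar>
        = \<bar>f x\<bar> * (\<bar>step' (y m x)\<bar> * real (Suc m)) * \<bar>1 - 2 * x\<bar>"
      by (simp add: abs_mult)
    also have "\<dots> \<le> (2 * C * (x * (1 - x))) * (\<bar>step' (y m x)\<bar> * real (Suc m)) * 1"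
      using f_le[OF x] x C by (intro mult_mono mult_right_mono mult_nonneg_nonneg) auto
    also have "\<dots> = 2 * C * ((y m x + 1) * \<bar>step' (y m x)\<bar>)"
      by (simp add: y_def)
    also have "\<dots> \<le> 2 * C * \<bar>(y m x + 1) * step' (y m x)\<bar>"
      using C by (intro mult_left_mono) (auto simp: abs_mult mult_right_mono)
    finally show ?thesis .
  qed
  have "(\<lambda>m. L2_of (\<psi> m)) \<longlonglongrightarrow> L2_of f"
  proof (rule L2_of_tendsto[where g = "\<lambda>x. \<bar>f x\<bar>"])
    show "\<psi> m \<in> borel_measurable unit_measure" for m
      using sq_integrable_test_function[OF test] by (simp add: sq_integrable_def)
    show "f \<in> borel_measurable unit_measure" using sq_integrable_eigenfun unfolding f_def sq_integrable_def by blast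
    show "AE x in unit_measure. (\<lambda>m. \<psi> m x) \<longlonglongrightarrow> f x"
    proof (rule AE_unit_measure_interior)
      fix x :: real assume "0 < x" "x < 1"
      then have "(\<lambda>m. f x * step (y m x)) \<longlonglongrightarrow> f x * 1"
        by (intro tendsto_intros filterlim_compose[OF step_at_top y_top])
      then show "(\<lambda>m. \<psi> m x) \<longlonglongrightarrow> f x" by (simp add: \<psi>_def)
    qed
    show "sq_integrable (\<lambda>x. \<bar>f x\<bar>)"
      unfolding f_def by (intro sq_integrable_continuous continuous_intros)
    show "\<bar>\<psi> m x\<bar> \<le> \<bar>f x\<bar>" for m x
      using step_bounds[of "y m x"] by (simp add: \<psi>_def abs_mult mult_left_le)
  qed
  moreover have "(\<lambda>m. L2_of (\<psi>' m)) \<longlonglongrightarrow> L2_of f'"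
  \<comment> \<open>6 C is the factor 2 C of \<open>second\<close> times the bound 3 of
    \<open>step'_bound\<close>.\<close>
  proof (rule L2_of_tendsto[where g = "\<lambda>x. \<bar>f' x\<bar> + 6 * C"])
    show "\<psi>' m \<in> borel_measurable unit_measure" for m
      using sq_integrable_test_function[OF test] by (simp add: sq_integrable_def deriv_\<psi>)
    show "f' \<in> borel_measurable unit_measure" using sq_integrable_eigenfun' unfolding f'_def sq_integrable_def by blast
    show "AE x in unit_measure. (\<lambda>m. \<psi>' m x) \<longlonglongrightarrow> f' x"
    proof (rule AE_unit_measure_interior)
      fix x :: real assume x: "0 < x" "x < 1"
      have 1: "(\<lambda>m. f' x * step (y m x)) \<longlonglongrightarrow> f' x * 1"
        using x by (intro tendsto_intros filterlim_compose[OF step_at_top y_top])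
      have lim0: "(\<lambda>m. 2 * C * \<bar>(y m x + 1) * step' (y m x)\<bar>) \<longlonglongrightarrow> 2 * C * \<bar>0\<bar>"
        using x by (intro tendsto_intros filterlim_compose[OF step'_at_top y_top])
      have "(\<lambda>m. f x * (step' (y m x) * (real (Suc m) * (1 - 2 * x)))) \<longlonglongrightarrow> 0"
      proof (rule Lim_null_comparison)
        show "\<forall>\<^sub>F m in sequentially. norm (f x * (step' (y m x) * (real (Suc m) * (1 - 2 * x))))
            \<le> 2 * C * \<bar>(y m x + 1) * step' (y m x)\<bar>"
          unfolding real_norm_def by (rule always_eventually, rule allI, rule second) (use x in auto)
        show "(\<lambda>m. 2 * C * \<bar>(y m x + 1) * step' (y m x)\<bar>) \<longlonglongrightarrow> 0" using lim0 by simp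
      qed
      from tendsto_add[OF 1 this] show "(\<lambda>m. \<psi>' m x) \<longlonglongrightarrow> f' x" by (simp add: \<psi>'_def)
    qed
    show "sq_integrable (\<lambda>x. \<bar>f' x\<bar> + 6 * C)"
      unfolding f'_def by (intro sq_integrable_continuous continuous_intros)
    show "\<bar>\<psi>' m x\<bar> \<le> \<bar>f' x\<bar> + 6 * C" if x: "x \<in> {0..1}" for m x
    proof -
      have "-1 \<le> y m x" using x by (auto simp: y_def)
      then have "2 * C * \<bar>(y m x + 1) * step' (y m x)\<bar> \<le> 2 * C * 3"
        using C by (intro mult_left_mono step'_bound) auto
      moreover have "\<bar>f' x * step (y m x)\<bar> \<le> \<bar>f' x\<bar>"
        using step_bounds[of "y m x"] by (simp add: abs_mult mult_left_le)
      ultimately show ?thesis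
        using second[OF x, of m] unfolding \<psi>'_def by linarith
    qed
  qed
  ultimately show ?thesis
    using test by (intro that[of \<psi>]) (auto simp: deriv_\<psi> f_def[abs_def] f'_def[abs_def] eigenfun_def eigenfun'_def)
qed

lemma eigenfun_dirichlet: "(eigenfun k, - eigenval k *\<^sub>R eigenfun k) \<in> dirichlet_laplacian"
proof -
  have "eigenfun k \<in> sobolev_H2"
    unfolding sobolev_H2_def sobolev_H1_def using eigenfun_weak_deriv eigenfun'_weak_deriv by blast
  moreover have "eigenfun k \<in> sobolev_H10"
  proof -
    obtain \<psi> where "\<And>m. test_function (\<psi> m)" "(\<lambda>m. L2_of (\<psi> m)) \<longlonglongrightarrow> eigenfun k"
      "(\<lambda>m. L2_of (deriv (\<psi> m))) \<longlonglongrightarrow> eigenfun' k"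
      by (rule eigenfun_test_approx[of k]) (rule that)
    then show ?thesis
      unfolding sobolev_H10_def
      by (intro CollectI exI[of _ "eigenfun' k"] exI[of _ \<psi>]) (simp add: eigenfun_weak_deriv)
  qed
  ultimately show ?thesis
    unfolding dirichlet_laplacian_def using eigenfun_weak_deriv eigenfun'_weak_deriv by blast
qed

text \<open>e_k is not a test function, but both sides are continuous along its H^1 approximation by
  test functions.\<close>

lemma weak_deriv_against_eigenfun:
  assumes "has_weak_deriv f g"
  shows "inner f (eigenfun' k) = - inner g (eigenfun k)"
proof -
  obtain \<psi> where \<psi>: "\<And>m. test_function (\<psi> m)" "(\<lambda>m. L2_of (\<psi> m)) \<longlonglongrightarrow> eigenfun k"
    "(\<lambda>m. L2_of (deriv (\<psi> m))) \<longlonglongrightarrow> eigenfun' k"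
    by (rule eigenfun_test_approx[of k]) (rule that)
  have "(\<lambda>m. inner f (L2_of (deriv (\<psi> m)))) \<longlonglongrightarrow> inner f (eigenfun' k)"
    by (intro tendsto_intros \<psi>)
  moreover have "(\<lambda>m. - inner g (L2_of (\<psi> m))) \<longlonglongrightarrow> - inner g (eigenfun k)"
    by (intro tendsto_intros \<psi>)
  ultimately show ?thesis
    using assms \<psi>(1) unfolding has_weak_deriv_def by (auto dest: LIMSEQ_unique)
qed

lemma has_weak_deriv_unique:
  assumes "has_weak_deriv f g" "has_weak_deriv f h"
  shows "g = h"
proof -
  have "g - h = 0"
    using weak_deriv_against_eigenfun[OF assms(1)] weak_deriv_against_eigenfun[OF assms(2)]
    by (intro eigenfun_total) (auto simp: inner_diff_right inner_commute)
  then show ?thesis by simp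
qed

text \<open>Two integrations by parts without boundary terms. Moving the derivative from h to e_k
  works because e_k is approximated by test functions. The cosine e_k' is not, so for the second one
  the approximation of f in H^1_0 is used instead.\<close>

lemma inner_dirichlet_laplacian:
  assumes "(f, h) \<in> dirichlet_laplacian"
  shows "inner h (eigenfun k) = - eigenval k * inner f (eigenfun k)"
proof -
  obtain g where g: "has_weak_deriv f g" "has_weak_deriv g h" and "f \<in> sobolev_H10"
    using assms by (auto simp: dirichlet_laplacian_def)
  then obtain g' \<psi> where "has_weak_deriv f g'" and \<psi>: "\<And>m. test_function (\<psi> m)"
    "(\<lambda>m. L2_of (\<psi> m)) \<longlonglongrightarrow> f" "(\<lambda>m. L2_of (deriv (\<psi> m))) \<longlonglongrightarrow> g'"
    unfolding sobolev_H10_def by auto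
  \<comment> \<open>The derivative in the definition of \<open>sobolev_H10\<close> is a priori
    another weak derivative of f; uniqueness identifies it with g.\<close>
  then have lim: "(\<lambda>m. L2_of (deriv (\<psi> m))) \<longlonglongrightarrow> g"
    using has_weak_deriv_unique[OF g(1)] by blast
  have "(\<lambda>m. inner (eigenfun' k) (L2_of (deriv (\<psi> m)))) \<longlonglongrightarrow> inner (eigenfun' k) g"
    by (intro tendsto_intros lim)
  moreover have "(\<lambda>m. - inner (- eigenval k *\<^sub>R eigenfun k) (L2_of (\<psi> m)))
      \<longlonglongrightarrow> - inner (- eigenval k *\<^sub>R eigenfun k) f"
    by (intro tendsto_intros \<psi>)
  moreover have "inner (eigenfun' k) (L2_of (deriv (\<psi> m)))
      = - inner (- eigenval k *\<^sub>R eigenfun k) (L2_of (\<psi> m))" for m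
    using eigenfun'_weak_deriv[of k] \<psi>(1) unfolding has_weak_deriv_def by blast
  ultimately have "inner (eigenfun' k) g = - inner (- eigenval k *\<^sub>R eigenfun k) f"
    by (auto dest: LIMSEQ_unique)
  then show ?thesis
    using weak_deriv_against_eigenfun[OF g(2), of k] by (simp add: inner_commute)
qed

section \<open>The semigroups and the square root of Q on the sines\<close>

lemma eigenval_pos: "k \<ge> 1 \<Longrightarrow> eigenval k > 0"
  by (simp add: eigenval_def)

lemma eigenval_inj: "eigenval j = eigenval k \<Longrightarrow> j = k"
  by (simp add: eigenval_def power2_eq_iff_nonneg)

text \<open>No continuity away from 0 is assumed. With h = t/(n+1), both sides are (n+1)-th powers
  of numbers of modulus at most 1, so they differ by at most n+1 times |c h - exp (-a h)|, which is
  o(h).\<close>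

lemma real_semigroup_eq_exp:
  fixes c :: "real \<Rightarrow> real"
  assumes mult: "\<And>s t. s \<ge> 0 \<Longrightarrow> t \<ge> 0 \<Longrightarrow> c (s + t) = c s * c t" and c0: "c 0 = 1"
    and deriv: "((\<lambda>h. (c h - 1) / h) \<longlongrightarrow> - a) (at_right 0)" and a: "a > 0" and t: "t > 0"
  shows "c t = exp (- a * t)"
proof -
  have pow: "c (real n * h) = c h ^ n" if "h \<ge> 0" for n h
    using that by (induction n) (auto simp: c0 mult distrib_right)
  have id: "((\<lambda>h::real. h) \<longlongrightarrow> 0) (at_right 0)" by (rule tendsto_ident_at)
  have "((\<lambda>h. (c h - 1) / h * h + 1) \<longlongrightarrow> - a * 0 + 1) (at_right 0)"
    by (intro tendsto_intros deriv id)
  then have "\<forall>\<^sub>F h in at_right 0. 0 < (c h - 1) / h * h + 1"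
    by (rule order_tendstoD) simp
  moreover have "\<forall>\<^sub>F h in at_right 0. (c h - 1) / h < 0"
    using deriv by (rule order_tendstoD) (use a in simp)
  moreover have "\<forall>\<^sub>F h in at_right 0. h > (0::real)" by (rule eventually_at_right_less)
  \<comment> \<open>The quotient tends to -a < 0, which forces c h < 1, while c h \<rightarrow> 1
    keeps it positive.\<close>
  ultimately have small: "\<forall>\<^sub>F h in at_right 0. \<bar>c h\<bar> \<le> 1"
    by eventually_elim (auto simp: divide_less_0_iff)
  have expd: "((\<lambda>h. (exp (- a * h) - 1) / h) \<longlongrightarrow> - a) (at_right 0)"
  proof -
    have "((\<lambda>h. exp (- a * h)) has_real_derivative - a) (at 0)"
      by (auto intro!: derivative_eq_intros)
    then have "((\<lambda>h. (exp (- a * h) - 1) / h) \<longlongrightarrow> - a) (at 0)"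
      by (simp add: DERIV_def)
    then show ?thesis by (rule tendsto_mono[rotated]) (simp add: at_within_le_nhds at_le)
  qed
  have "((\<lambda>h. (c h - 1) / h - (exp (- a * h) - 1) / h) \<longlongrightarrow> - a - (- a)) (at_right 0)"
    by (intro tendsto_intros deriv expd)
  then have diff: "((\<lambda>h. (c h - exp (- a * h)) / h) \<longlongrightarrow> 0) (at_right 0)"
    by (simp add: diff_divide_distrib)
  define h where "h n = t / real (Suc n)" for n
  have h: "h n > 0" for n using t by (simp add: h_def)
  have "h \<longlonglongrightarrow> 0"
    unfolding h_def by (rule real_tendsto_divide_at_top[OF tendsto_const]
        filterlim_compose[OF filterlim_real_sequentially filterlim_Suc])+
  then have h_lim: "filterlim h (at_right 0) sequentially"
    using h less_imp_neq[OF h, symmetric] by (auto simp: filterlim_at intro!: always_eventually)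
  have "\<forall>\<^sub>F n in sequentially. \<bar>c t - exp (- a * t)\<bar> \<le> t * \<bar>(c (h n) - exp (- a * h n)) / h n\<bar>"
    using eventually_compose_filterlim[OF small h_lim]
  proof eventually_elim
    case (elim n)
    have t_eq: "t = real (Suc n) * h n" by (simp add: h_def)
    have "norm (c (h n) ^ Suc n - exp (- a * h n) ^ Suc n) \<le> real (Suc n) * norm (c (h n) - exp (- a * h n))"
      using elim a h[of n] by (intro norm_power_diff) auto
    moreover have "c (h n) ^ Suc n = c t"
      using pow[of "h n" "Suc n"] h[of n] t_eq by simp
    moreover have "exp (- a * h n) ^ Suc n = exp (- a * t)"
      unfolding exp_of_nat_mult[symmetric] using t_eq by (simp add: ac_simps)
    moreover have "t * \<bar>(c (h n) - exp (- a * h n)) / h n\<bar> = real (Suc n) * \<bar>c (h n) - exp (- a * h n)\<bar>"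
      using h[of n] by (subst t_eq) (simp add: abs_mult)
    ultimately show ?case by simp
  qed
  moreover have "(\<lambda>n. t * \<bar>(c (h n) - exp (- a * h n)) / h n\<bar>) \<longlonglongrightarrow> t * \<bar>0\<bar>"
    by (intro tendsto_intros filterlim_compose[OF diff h_lim])
  ultimately have "\<bar>c t - exp (- a * t)\<bar> \<le> t * \<bar>0\<bar>"
    by (intro tendsto_lowerbound[of "\<lambda>n. t * \<bar>(c (h n) - exp (- a * h n)) / h n\<bar>" _ sequentially]) auto
  then show ?thesis by simp
qed

text \<open>The vector \<open>S(t) e\<^sub>k\<close> is again an eigenvector for the simple eigenvalue \<open>- \<lambda>\<^sub>k\<close>, hence a multiple
  \<open>c(t) e\<^sub>k\<close>.  This avoids local boundedness of \<open>S\<close> (Banach-Steinhaus).\<close>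

lemma dirichlet_semigroup_eigenfun:
  assumes C0: "C0_semigroup S" and gen: "semigroup_generator S = dirichlet_laplacian"
    and t: "t \<ge> 0" and k: "k \<ge> 1"
  shows "S t (eigenfun k) = exp (- eigenval k * t) *\<^sub>R eigenfun k"
proof -
  define c where "c t = inner (S t (eigenfun k)) (eigenfun k)" for t
  have lin: "bounded_linear (S t)" if "t \<ge> 0" for t using C0 that by (simp add: C0_semigroup_def)
  have S_add: "S (s + t) x = S s (S t x)" if "s \<ge> 0" "t \<ge> 0" for s t x
    using C0 that by (simp add: C0_semigroup_def)
  have lim: "((\<lambda>h. (S h (eigenfun k) - eigenfun k) /\<^sub>R h) \<longlongrightarrow> - eigenval k *\<^sub>R eigenfun k) (at_right 0)"
    using eigenfun_dirichlet[of k] unfolding gen[symmetric] semigroup_generator_def by blast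
  have S_eq: "S t (eigenfun k) = c t *\<^sub>R eigenfun k" if t: "t \<ge> 0" for t
  proof -
    interpret bounded_linear "S t" by (rule lin[OF t])
    \<comment> \<open>\<open>S t\<close> is bounded and commutes with \<open>S h\<close>, so it
      carries the limit of difference quotients at e_k to one at \<open>S t\<close> e_k.\<close>
    have "((\<lambda>h. S t ((S h (eigenfun k) - eigenfun k) /\<^sub>R h)) \<longlongrightarrow> S t (- eigenval k *\<^sub>R eigenfun k)) (at_right 0)"
      by (intro tendsto lim)
    moreover have "\<forall>\<^sub>F h in at_right 0. S t ((S h (eigenfun k) - eigenfun k) /\<^sub>R h)
        = (S h (S t (eigenfun k)) - S t (eigenfun k)) /\<^sub>R h"
      using eventually_at_right_less[of 0]
    proof eventually_elim
      case (elim h)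
      have "S h (S t (eigenfun k)) = S t (S h (eigenfun k))"
        using S_add[of h t] S_add[of t h] t elim by (simp add: add.commute)
      then show ?case by (simp add: scaleR diff)
    qed
    ultimately have "((\<lambda>h. (S h (S t (eigenfun k)) - S t (eigenfun k)) /\<^sub>R h)
        \<longlongrightarrow> - eigenval k *\<^sub>R S t (eigenfun k)) (at_right 0)"
      by (simp add: Lim_transform_eventually scaleR neg)
    then have "(S t (eigenfun k), - eigenval k *\<^sub>R S t (eigenfun k)) \<in> dirichlet_laplacian"
      unfolding gen[symmetric] semigroup_generator_def by simp
    \<comment> \<open>The j-th coefficient of an element of the domain is multiplied by -\<lambda>_j
      under the Laplacian, here also by -\<lambda>_k; distinct eigenvalues leave only j = k.\<close>
    then have eig: "eigenval k * inner (S t (eigenfun k)) (eigenfun j) = eigenval j * inner (S t (eigenfun k)) (eigenfun j)" for j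
      using inner_dirichlet_laplacian[of _ _ j] by fastforce
    have "S t (eigenfun k) - c t *\<^sub>R eigenfun k = 0"
    proof (rule eigenfun_total)
      fix j :: nat assume j: "j \<ge> 1"
      show "inner (eigenfun j) (S t (eigenfun k) - c t *\<^sub>R eigenfun k) = 0"
        using eig[of j] eigenval_inj[of j k] j k
        by (cases "j = k") (auto simp: inner_diff_right eigenfun_orthonormal c_def inner_commute)
    qed
    then show ?thesis by simp
  qed
  show ?thesis
  proof (cases "t = 0")
    case True
    then show ?thesis using C0 by (simp add: C0_semigroup_def)
  next
    case False
    have "c t = exp (- eigenval k * t)"
    proof (rule real_semigroup_eq_exp)
      show "c (s + t) = c s * c t" if "s \<ge> 0" "t \<ge> 0" for s t
      proof -
        interpret bounded_linear "S s" by (rule lin[OF that(1)])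
        have "S (s + t) (eigenfun k) = S s (S t (eigenfun k))"
          using that by (rule S_add)
        also have "\<dots> = (c s * c t) *\<^sub>R eigenfun k"
          using that by (simp add: S_eq scaleR)
        finally have "S (s + t) (eigenfun k) = (c s * c t) *\<^sub>R eigenfun k" .
        moreover have "eigenfun k \<noteq> 0" using norm_eigenfun[OF k] by force
        ultimately show ?thesis using that S_eq[of "s + t"] by simp
      qed
      show "c 0 = 1" using C0 k by (simp add: c_def C0_semigroup_def eigenfun_orthonormal)
      have "((\<lambda>h. inner ((S h (eigenfun k) - eigenfun k) /\<^sub>R h) (eigenfun k))
          \<longlongrightarrow> inner (- eigenval k *\<^sub>R eigenfun k) (eigenfun k)) (at_right 0)"
        by (intro tendsto_intros lim)
      then show "((\<lambda>h. (c h - 1) / h) \<longlongrightarrow> - eigenval k) (at_right 0)"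
        using k by (simp add: inner_diff_left c_def eigenfun_orthonormal divide_inverse ac_simps)
    qed (use k t False eigenval_pos in auto)
    then show ?thesis using S_eq[OF t] by simp
  qed
qed

text \<open>The Laplacian is read as the generator of \<open>S\<close>: limits of difference
  quotients are additive, which gives the value on a linear combination, and unique, which resolves
  the \<open>THE\<close> in \<open>galerkin_op\<close>.\<close>

lemma galerkin_op_sum:
  assumes C0: "C0_semigroup S" and gen: "semigroup_generator S = dirichlet_laplacian"
  shows "galerkin_op n (\<Sum>k=1..n. a k *\<^sub>R eigenfun k) = (\<Sum>k=1..n. (- eigenval k * a k) *\<^sub>R eigenfun k)"
proof -
  let ?x = "\<Sum>k=1..n. a k *\<^sub>R eigenfun k" and ?y = "\<Sum>k=1..n. (- eigenval k * a k) *\<^sub>R eigenfun k"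
  have lim: "((\<lambda>h. (S h (eigenfun k) - eigenfun k) /\<^sub>R h) \<longlongrightarrow> - eigenval k *\<^sub>R eigenfun k) (at_right 0)" for k
    using eigenfun_dirichlet[of k] unfolding gen[symmetric] semigroup_generator_def by blast
  have "((\<lambda>h. \<Sum>k=1..n. a k *\<^sub>R ((S h (eigenfun k) - eigenfun k) /\<^sub>R h))
      \<longlongrightarrow> (\<Sum>k=1..n. a k *\<^sub>R (- eigenval k *\<^sub>R eigenfun k))) (at_right 0)"
    by (intro tendsto_intros lim)
  moreover have "\<forall>\<^sub>F h in at_right 0. (\<Sum>k=1..n. a k *\<^sub>R ((S h (eigenfun k) - eigenfun k) /\<^sub>R h))
      = (S h ?x - ?x) /\<^sub>R h"
    using eventually_at_right_less[of 0]
  proof eventually_elim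
    case (elim h)
    interpret bounded_linear "S h" using C0 elim by (simp add: C0_semigroup_def)
    show ?case
      by (simp add: sum scaleR sum_subtractf[symmetric] scaleR_right.sum scaleR_right_diff_distrib ac_simps)
  qed
  ultimately have "((\<lambda>h. (S h ?x - ?x) /\<^sub>R h) \<longlongrightarrow> (\<Sum>k=1..n. a k *\<^sub>R (- eigenval k *\<^sub>R eigenfun k))) (at_right 0)"
    by (rule Lim_transform_eventually)
  then have lim_x: "((\<lambda>h. (S h ?x - ?x) /\<^sub>R h) \<longlongrightarrow> ?y) (at_right 0)"
    by (simp add: mult.commute)
  have "(THE y. (?x, y) \<in> dirichlet_laplacian) = ?y"
    unfolding gen[symmetric] semigroup_generator_def mem_Collect_eq prod.case
    using lim_x by (rule the_equality) (rule tendsto_unique[OF trivial_limit_at_right_real _ lim_x])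
  moreover have "galerkin_proj n ?y = ?y"
  proof -
    have "inner (eigenfun j) ?y = - eigenval j * a j" if j: "j \<in> {1..n}" for j
    proof -
      have "inner (eigenfun j) ?y = (\<Sum>k=1..n. if k = j then - eigenval k * a k else 0)"
        unfolding inner_sum_right using j by (intro sum.cong) (auto simp: eigenfun_orthonormal)
      then show ?thesis using j by (simp add: sum.delta)
    qed
    then show ?thesis unfolding galerkin_proj_def by (intro sum.cong) auto
  qed
  ultimately show ?thesis by (simp add: galerkin_op_def)
qed

text \<open>Powers of A_n multiply the k-th coefficient by powers of -\<lambda>_k, so the operator
  series splits into n scalar exponential series.\<close>

lemma galerkin_semigroup_eq:
  assumes "C0_semigroup S" "semigroup_generator S = dirichlet_laplacian"
  shows "galerkin_semigroup n t x = (\<Sum>k=1..n. (exp (- eigenval k * t) * inner (eigenfun k) x) *\<^sub>R eigenfun k)"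
proof -
  have "(galerkin_op n ^^ j) (galerkin_proj n x) = (\<Sum>k=1..n. ((- eigenval k) ^ j * inner (eigenfun k) x) *\<^sub>R eigenfun k)" for j
  proof (induction j)
    case 0
    then show ?case by (simp add: galerkin_proj_def)
  next
    case (Suc j)
    then show ?case
      using galerkin_op_sum[OF assms, of n "\<lambda>k. (- eigenval k) ^ j * inner (eigenfun k) x"]
      by (simp add: mult.assoc)
  qed
  note powers = this
  have eq: "(t ^ j / fact j) *\<^sub>R (galerkin_op n ^^ j) (galerkin_proj n x)
      = (\<Sum>k=1..n. (((- eigenval k * t) ^ j /\<^sub>R fact j) * inner (eigenfun k) x) *\<^sub>R eigenfun k)" for j
  proof -
    have "(t ^ j / fact j) *\<^sub>R (b ^ j * a) *\<^sub>R e = (((b * t) ^ j /\<^sub>R fact j) * a) *\<^sub>R e"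
      for a b and e :: L2
      by (simp add: power_mult_distrib divide_inverse ac_simps)
    note * = this
    show ?thesis
      unfolding powers scaleR_sum_right by (intro sum.cong refl *)
  qed
  have "(\<lambda>j. \<Sum>k=1..n. (((- eigenval k * t) ^ j /\<^sub>R fact j) * inner (eigenfun k) x) *\<^sub>R eigenfun k)
      sums (\<Sum>k=1..n. (exp (- eigenval k * t) * inner (eigenfun k) x) *\<^sub>R eigenfun k)"
    by (intro sums_sum bounded_linear.sums[OF bounded_linear_scaleR_left] sums_mult2 exp_converges)
  then show ?thesis unfolding galerkin_semigroup_def eq by (rule sums_unique[symmetric])
qed

text \<open>The factorisation (R + sqrt c) (R - sqrt c) x = (Q - c) x = 0 makes y = R x - sqrt c x
  satisfy R y = - sqrt c y, and a nonnegative operator allows this only for y = 0.\<close>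

lemma sqrt_operator_eigenvector:
  assumes R: "is_sqrt_of R Q" and Q: "Q x = c *\<^sub>R x" and c: "c > 0"
  shows "R x = sqrt c *\<^sub>R x"
proof -
  interpret bounded_linear R using R by (simp add: is_sqrt_of_def symmetric_nonneg_def)
  define y where "y = R x - sqrt c *\<^sub>R x"
  have "R (R x) = c *\<^sub>R x" using R Q by (auto simp: is_sqrt_of_def)
  then have "R y = - sqrt c *\<^sub>R y"
    using c by (simp add: y_def diff scaleR scaleR_right_diff_distrib)
  moreover have "0 \<le> inner (R y) y" using R unfolding is_sqrt_of_def symmetric_nonneg_def by blast
  ultimately have "sqrt c * inner y y \<le> 0" by simp
  then have "inner y y \<le> 0" using c by (simp add: mult_le_0_iff)
  then have "y = 0" using inner_ge_zero[of y] by (metis antisym inner_eq_zero_iff)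
  then show ?thesis by (simp add: y_def)
qed

section \<open>Covariance of the cylindrical Wiener process\<close>

text \<open>The sum is a continuous function of real coordinates, so it factors through the product
  space \<open>nat \<Rightarrow> real\<close>, where measurability is coordinatewise.\<close>

lemma measurable_scaleR_sum:
  fixes v :: "nat \<Rightarrow> 'b::real_normed_vector"
  assumes c: "\<And>i. i \<in> I \<Longrightarrow> c i \<in> borel_measurable M"
  shows "(\<lambda>\<omega>. \<Sum>i\<in>I. c i \<omega> *\<^sub>R v i) \<in> borel_measurable M"
proof -
  have "continuous_on UNIV (\<lambda>x :: nat \<Rightarrow> real. \<Sum>i\<in>I. x i *\<^sub>R v i)"
    by (intro continuous_on_sum continuous_on_scaleR continuous_on_const continuous_on_product_coordinates)
  then have "(\<lambda>x :: nat \<Rightarrow> real. \<Sum>i\<in>I. x i *\<^sub>R v i) \<in> borel_measurable borel"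
    by (rule borel_measurable_continuous_onI)
  moreover have "(\<lambda>\<omega> i. if i \<in> I then c i \<omega> else 0) \<in> borel_measurable M"
  proof (rule measurable_coordinatewise_then_product)
    show "(\<lambda>\<omega>. if i \<in> I then c i \<omega> else 0) \<in> borel_measurable M" for i
      using c by (cases "i \<in> I") simp_all
  qed
  ultimately have "(\<lambda>\<omega>. \<Sum>i\<in>I. (if i \<in> I then c i \<omega> else 0) *\<^sub>R v i) \<in> borel_measurable M"
    by (rule measurable_compose[rotated])
  then show ?thesis by simp
qed

text \<open>The Hilbert space is not an instance of class \<open>second_countable_topology\<close>, so sums of measurable
  vectors are handled through real coordinates.\<close>

lemma measurable_norm_diff_scaleR_sum:
  fixes v :: "nat \<Rightarrow> 'b::real_inner"
  assumes X[measurable]: "X \<in> borel_measurable M" and c[measurable]: "\<And>i. i \<in> I \<Longrightarrow> c i \<in> borel_measurable M"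
  shows "(\<lambda>\<omega>. norm (X \<omega> - (\<Sum>i\<in>I. c i \<omega> *\<^sub>R v i))) \<in> borel_measurable M"
proof -
  have "(\<lambda>x. norm x) \<in> borel_measurable borel" "(\<lambda>x. inner x w) \<in> borel_measurable borel" for w :: 'b
    by (intro borel_measurable_continuous_onI continuous_intros)+
  then have [measurable]: "(\<lambda>\<omega>. norm (X \<omega>)) \<in> borel_measurable M" "(\<lambda>\<omega>. inner (X \<omega>) w) \<in> borel_measurable M" for w
    using measurable_compose[OF X] by blast+
  define Y where "Y \<omega> = (\<Sum>i\<in>I. c i \<omega> *\<^sub>R v i)" for \<omega>
  have XY: "inner (X \<omega>) (Y \<omega>) = (\<Sum>i\<in>I. c i \<omega> * inner (X \<omega>) (v i))" for \<omega>
    by (simp add: Y_def inner_sum_right)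
  have YY: "inner (Y \<omega>) (Y \<omega>) = (\<Sum>i\<in>I. c i \<omega> * (\<Sum>j\<in>I. c j \<omega> * inner (v i) (v j)))" for \<omega>
    by (simp add: Y_def inner_sum_left) (simp add: inner_sum_right)
  have "norm (X \<omega> - Y \<omega>) = sqrt ((norm (X \<omega>))\<^sup>2 - 2 * inner (X \<omega>) (Y \<omega>) + inner (Y \<omega>) (Y \<omega>))" for \<omega>
    unfolding norm_eq_sqrt_inner[of "X \<omega> - _"] power2_norm_eq_inner
    by (simp add: inner_diff_left inner_diff_right inner_commute)
  then have "(\<lambda>\<omega>. norm (X \<omega> - Y \<omega>)) \<in> borel_measurable M"
    unfolding XY YY by simp
  then show ?thesis by (simp add: Y_def)
qed

text \<open>The law of the increments gives the first two moments, started from B 0 = 0 almost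
  everywhere. The covariance needs no independence: 2 B_s B_t = B_s^2 + B_t^2 - (B_t -
  B_s)^2.\<close>

lemma brownian_moments:
  assumes B: "standard_brownian_motion M B" and s: "s \<ge> 0" and t: "t \<ge> 0"
  shows "B t \<in> borel_measurable M" "integrable M (\<lambda>\<omega>. (B t \<omega>)\<^sup>2)" "integrable M (B t)"
    "(\<integral>\<omega>. B t \<omega> \<partial>M) = 0" "integrable M (\<lambda>\<omega>. B s \<omega> * B t \<omega>)" "(\<integral>\<omega>. B s \<omega> * B t \<omega> \<partial>M) = min s t"
proof -
  interpret prob_space M using B by (simp add: standard_brownian_motion_def)
  have meas: "B t \<in> borel_measurable M" if "t \<ge> 0" for t
    using B that by (simp add: standard_brownian_motion_def)
  have zero: "AE \<omega> in M. B 0 \<omega> = 0" using B by (simp add: standard_brownian_motion_def)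
  have incr: "integrable M (\<lambda>\<omega>. (B t \<omega> - B s \<omega>)\<^sup>2) \<and> (\<integral>\<omega>. (B t \<omega> - B s \<omega>)\<^sup>2 \<partial>M) = t - s
      \<and> (\<integral>\<omega>. B t \<omega> - B s \<omega> \<partial>M) = 0" if "0 \<le> s" "s < t" for s t
  proof -
    have d: "distributed M lborel (\<lambda>\<omega>. B t \<omega> - B s \<omega>) (normal_density 0 (sqrt (t - s)))"
      using B that by (simp add: standard_brownian_motion_def)
    have pos: "0 < sqrt (t - s)" using that by simp
    have "integrable lborel (\<lambda>x. normal_density 0 (sqrt (t - s)) x * x\<^sup>2)"
      using integrable_normal_moment[OF pos, of 0 2] by simp
    then have "integrable M (\<lambda>\<omega>. (B t \<omega> - B s \<omega>)\<^sup>2)"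
      by (subst (asm) distributed_integrable[OF d]) auto
    moreover have "(\<integral>x. normal_density 0 (sqrt (t - s)) x * x\<^sup>2 \<partial>lborel) = t - s"
      using integral_normal_moment_even[OF pos, of 0 1] that by (simp add: fact_2)
    then have "(\<integral>\<omega>. (B t \<omega> - B s \<omega>)\<^sup>2 \<partial>M) = t - s"
      by (subst (asm) distributed_integral[OF d]) auto
    moreover have "(\<integral>x. normal_density 0 (sqrt (t - s)) x * x \<partial>lborel) = 0"
      using integral_normal_moment_nz_1[OF pos, of 0] by simp
    then have "(\<integral>\<omega>. B t \<omega> - B s \<omega> \<partial>M) = 0"
      by (subst (asm) distributed_integral[OF d]) auto
    ultimately show ?thesis by blast
  qed
  have single: "integrable M (\<lambda>\<omega>. (B t \<omega>)\<^sup>2) \<and> (\<integral>\<omega>. (B t \<omega>)\<^sup>2 \<partial>M) = t \<and> (\<integral>\<omega>. B t \<omega> \<partial>M) = 0"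
    if t: "t \<ge> 0" for t
  proof (cases "t = 0")
    case True
    note [measurable] = meas[of 0]
    have 1: "integrable M (\<lambda>\<omega>. (B 0 \<omega>)\<^sup>2) = integrable M (\<lambda>\<omega>. 0::real)"
      "(\<integral>\<omega>. (B 0 \<omega>)\<^sup>2 \<partial>M) = (\<integral>\<omega>. 0 \<partial>M)" "(\<integral>\<omega>. B 0 \<omega> \<partial>M) = (\<integral>\<omega>. 0 \<partial>M)"
      by (intro integrable_cong_AE integral_cong_AE; use zero in \<open>auto intro: meas\<close>)+
    then show ?thesis using True by simp
  next
    case False
    note [measurable] = meas[of 0] meas[OF t]
    have 1: "integrable M (\<lambda>\<omega>. (B t \<omega>)\<^sup>2) = integrable M (\<lambda>\<omega>. (B t \<omega> - B 0 \<omega>)\<^sup>2)"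
      "(\<integral>\<omega>. (B t \<omega>)\<^sup>2 \<partial>M) = (\<integral>\<omega>. (B t \<omega> - B 0 \<omega>)\<^sup>2 \<partial>M)"
      "(\<integral>\<omega>. B t \<omega> \<partial>M) = (\<integral>\<omega>. B t \<omega> - B 0 \<omega> \<partial>M)"
      by (intro integrable_cong_AE integral_cong_AE; use zero in \<open>auto\<close>)+
    then show ?thesis using incr[of 0 t] False t by simp
  qed
  show "B t \<in> borel_measurable M" "integrable M (\<lambda>\<omega>. (B t \<omega>)\<^sup>2)" "(\<integral>\<omega>. B t \<omega> \<partial>M) = 0"
    using meas single t by auto
  show "integrable M (B t)"
    using single[OF t] meas[OF t] by (blast intro: square_integrable_imp_integrable)
  have prod: "integrable M (\<lambda>\<omega>. B s \<omega> * B t \<omega>) \<and> (\<integral>\<omega>. B s \<omega> * B t \<omega> \<partial>M) = s" if "0 \<le> s" "s \<le> t" for s t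
  proof (cases "s = t")
    case True
    then show ?thesis using single[of s] that by (simp add: power2_eq_square)
  next
    case False
    then have h: "s < t" "0 \<le> t" using that by auto
    have i: "integrable M (\<lambda>\<omega>. (B t \<omega> - B s \<omega>)\<^sup>2)" "(\<integral>\<omega>. (B t \<omega> - B s \<omega>)\<^sup>2 \<partial>M) = t - s"
      and a: "integrable M (\<lambda>\<omega>. (B s \<omega>)\<^sup>2)" "(\<integral>\<omega>. (B s \<omega>)\<^sup>2 \<partial>M) = s"
      and b: "integrable M (\<lambda>\<omega>. (B t \<omega>)\<^sup>2)" "(\<integral>\<omega>. (B t \<omega>)\<^sup>2 \<partial>M) = t"
      using incr[OF that(1) h(1)] single[OF that(1)] single[OF h(2)] by blast+
    have eq: "(\<lambda>\<omega>. B s \<omega> * B t \<omega>) = (\<lambda>\<omega>. ((B s \<omega>)\<^sup>2 + (B t \<omega>)\<^sup>2 - (B t \<omega> - B s \<omega>)\<^sup>2) / 2)"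
      by (simp add: fun_eq_iff power2_diff)
    show ?thesis unfolding eq using i a b by simp
  qed
  show "integrable M (\<lambda>\<omega>. B s \<omega> * B t \<omega>)" "(\<integral>\<omega>. B s \<omega> * B t \<omega> \<partial>M) = min s t"
    using prod[of s t] prod[of t s] s t by (cases "s \<le> t"; simp add: min_def mult.commute)+
qed

section \<open>The Wiener process in unit, orthogonal and arbitrary directions\<close>

lemma cylindrical_wiener_prob_space: "cylindrical_wiener M W \<Longrightarrow> prob_space M"
  by (simp add: cylindrical_wiener_def)

lemma cylindrical_wiener_linear:
  assumes "cylindrical_wiener M W" "t \<ge> 0"
  shows "AE \<omega> in M. W t (a *\<^sub>R g + b *\<^sub>R h) \<omega> = a * W t g \<omega> + b * W t h \<omega>"
  using assms(1)[unfolded cylindrical_wiener_def, THEN conjunct2, THEN conjunct1] assms(2) by blast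

lemma cylindrical_wiener_orthonormal:
  fixes n :: nat and f :: "nat \<Rightarrow> 'h::real_inner"
  assumes "cylindrical_wiener M W"
    and "\<And>i j. i < n \<Longrightarrow> j < n \<Longrightarrow> inner (f i) (f j) = (if i = j then 1 else 0)"
  shows "\<And>i. i < n \<Longrightarrow> standard_brownian_motion M (\<lambda>t. W t (f i))"
    "prob_space.indep_vars M (\<lambda>_. Pi\<^sub>M {0..} (\<lambda>_. borel)) (\<lambda>i \<omega>. \<lambda>t\<in>{0..}. W t (f i) \<omega>) {..<n}"
proof -
  have "\<forall>i<n. \<forall>j<n. inner (f i) (f j) = (if i = j then 1 else 0)"
    using assms(2) by blast
  then have "(\<forall>i<n. standard_brownian_motion M (\<lambda>t. W t (f i))) \<and>
      prob_space.indep_vars M (\<lambda>_. Pi\<^sub>M {0..} (\<lambda>_. borel)) (\<lambda>i \<omega>. \<lambda>t\<in>{0..}. W t (f i) \<omega>) {..<n}"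
    by (rule assms(1)[unfolded cylindrical_wiener_def, THEN conjunct2, THEN conjunct2, rule_format (no_asm)])
  then show "\<And>i. i < n \<Longrightarrow> standard_brownian_motion M (\<lambda>t. W t (f i))"
    "prob_space.indep_vars M (\<lambda>_. Pi\<^sub>M {0..} (\<lambda>_. borel)) (\<lambda>i \<omega>. \<lambda>t\<in>{0..}. W t (f i) \<omega>) {..<n}"
    by blast+
qed

lemma cylindrical_wiener_unit:
  assumes "cylindrical_wiener M W" "norm e = 1"
  shows "standard_brownian_motion M (\<lambda>t. W t e)"
  by (rule cylindrical_wiener_orthonormal(1)[OF assms(1), of 1 "\<lambda>_. e" 0])
    (use assms(2) in \<open>auto simp: norm_eq_1\<close>)

lemma cylindrical_wiener_orthogonal:
  fixes e f :: "'h::real_inner"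
  assumes W: "cylindrical_wiener M W" and e: "norm e = 1" and f: "norm f = 1" and ef: "inner e f = 0"
    and s: "s \<ge> 0" and t: "t \<ge> 0"
  shows "integrable M (\<lambda>\<omega>. W s e \<omega> * W t f \<omega>)" "(\<integral>\<omega>. W s e \<omega> * W t f \<omega> \<partial>M) = 0"
proof -
  interpret prob_space M using W by (rule cylindrical_wiener_prob_space)
  let ?F = "\<lambda>i::nat. if i = 0 then e else f"
  have "inner (?F i) (?F j) = (if i = j then 1 else 0)" if "i < 2" "j < 2" for i j
    using that e f ef by (auto simp: norm_eq_1 inner_commute less_2_cases_iff)
  then have ind: "indep_vars (\<lambda>_. Pi\<^sub>M {0..} (\<lambda>_. borel)) (\<lambda>i \<omega>. \<lambda>t\<in>{0..}. W t (?F i) \<omega>) {..<2}"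
    using cylindrical_wiener_orthonormal(2)[OF W, of 2 ?F] by simp
  \<comment> \<open>The whole paths in directions e and f are independent; evaluation at the times s
    and t passes this on to the two values.\<close>
  have "indep_var borel ((\<lambda>x. x 0 s) \<circ> (\<lambda>\<omega>. restrict (\<lambda>i. \<lambda>t\<in>{0..}. W t (?F i) \<omega>) {0}))
      borel ((\<lambda>x. x 1 t) \<circ> (\<lambda>\<omega>. restrict (\<lambda>i. \<lambda>t\<in>{0..}. W t (?F i) \<omega>) {1}))"
  proof (rule indep_var_compose[OF indep_var_restrict[OF ind]])
    have "(\<lambda>x. x i r) \<in> borel_measurable (Pi\<^sub>M {i} (\<lambda>_. Pi\<^sub>M {0..} (\<lambda>_. borel :: real measure)))"
      if "0 \<le> r" for r and i :: nat
      using that by (intro measurable_compose[where f = "\<lambda>x. x i" and g = "\<lambda>y. y r"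
            and N = "Pi\<^sub>M {0..} (\<lambda>_. borel)"] measurable_component_singleton) auto
    then show "(\<lambda>x. x 0 s) \<in> borel_measurable (Pi\<^sub>M {0::nat} (\<lambda>_. Pi\<^sub>M {0..} (\<lambda>_. borel :: real measure)))"
      "(\<lambda>x. x 1 t) \<in> borel_measurable (Pi\<^sub>M {1::nat} (\<lambda>_. Pi\<^sub>M {0..} (\<lambda>_. borel :: real measure)))"
      using s t by blast+
  qed auto
  then have iv: "indep_var borel (W s e) borel (W t f)"
    using s t by (simp add: o_def)
  note be = brownian_moments[OF cylindrical_wiener_unit[OF W e] s s]
  note bf = brownian_moments[OF cylindrical_wiener_unit[OF W f] t t]
  show "integrable M (\<lambda>\<omega>. W s e \<omega> * W t f \<omega>)"
    by (rule indep_var_integrable[OF iv be(3) bf(3)])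
  show "(\<integral>\<omega>. W s e \<omega> * W t f \<omega> \<partial>M) = 0"
    by (subst indep_var_lebesgue_integral[OF iv be(3) bf(3)]) (simp add: be(4))
qed

text \<open>Only \<open>W t h\<close> with \<open>\<parallel>h\<parallel> = 1\<close> is known to be measurable; by linearity, \<open>W t g\<close> has the
  following measurable version.\<close>

definition wiener_version :: "(real \<Rightarrow> 'h::real_inner \<Rightarrow> 'w \<Rightarrow> real) \<Rightarrow> real \<Rightarrow> 'h \<Rightarrow> 'w \<Rightarrow> real" where
  "wiener_version W t g \<omega> = norm g * W t (g /\<^sub>R norm g) \<omega>"

lemma wiener_version_AE:
  assumes W: "cylindrical_wiener M W" and t: "t \<ge> 0"
  shows "AE \<omega> in M. W t g \<omega> = wiener_version W t g \<omega>"
  using cylindrical_wiener_linear[OF W t, of "norm g" "g /\<^sub>R norm g" 0 0]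
  by (cases "g = 0") (simp_all add: wiener_version_def)

lemma wiener_version_measurable:
  assumes W: "cylindrical_wiener M W" and t: "t \<ge> 0"
  shows "wiener_version W t g \<in> borel_measurable M"
proof (cases "g = 0")
  case False
  then have "W t (g /\<^sub>R norm g) \<in> borel_measurable M"
    using brownian_moments(1)[OF cylindrical_wiener_unit[OF W] t t] by simp
  then show ?thesis unfolding wiener_version_def[abs_def] by simp
qed (simp add: wiener_version_def[abs_def])

text \<open>Gram-Schmidt: h is split into its component along u = g / |g| and a multiple of a unit
  vector v orthogonal to u. Linearity of W reduces the covariance to that of one Brownian motion,
  plus a cross term of mean zero.\<close>

lemma wiener_version_covariance:
  fixes g h :: "'h::real_inner"
  assumes W: "cylindrical_wiener M W" and s: "s \<ge> 0" and t: "t \<ge> 0"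
  shows "integrable M (\<lambda>\<omega>. wiener_version W s g \<omega> * wiener_version W t h \<omega>)
    \<and> (\<integral>\<omega>. wiener_version W s g \<omega> * wiener_version W t h \<omega> \<partial>M) = min s t * inner g h"
proof (cases "g = 0")
  case False
  define u where "u = g /\<^sub>R norm g"
  define r where "r = h - inner u h *\<^sub>R u"
  define v where "v = r /\<^sub>R norm r"
  have u: "norm u = 1" using False by (simp add: u_def)
  have g: "wiener_version W s g = (\<lambda>\<omega>. norm g * W s u \<omega>)" by (simp add: wiener_version_def[abs_def] u_def)
  have inner_gh: "inner g h = norm g * inner u h" using False by (simp add: u_def)
  have h: "h = inner u h *\<^sub>R u + norm r *\<^sub>R v"
  proof -
    have "norm r *\<^sub>R v = r" by (cases "r = 0") (simp_all add: v_def)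
    then show ?thesis by (simp add: r_def)
  qed
  note bu = brownian_moments[OF cylindrical_wiener_unit[OF W u]]
  have [measurable]: "W s u \<in> borel_measurable M" "wiener_version W t h \<in> borel_measurable M"
    "W t u \<in> borel_measurable M"
    using bu(1)[OF s s] bu(1)[OF t t] wiener_version_measurable[OF W t] by auto
  have "AE \<omega> in M. W t h \<omega> = inner u h * W t u \<omega> + norm r * W t v \<omega>"
    using cylindrical_wiener_linear[OF W t, of "inner u h" u "norm r" v] unfolding h[symmetric] .
  then have AE: "AE \<omega> in M. wiener_version W t h \<omega> = inner u h * W t u \<omega> + norm r * W t v \<omega>"
    using wiener_version_AE[OF W t, of h] by eventually_elim simp
  \<comment> \<open>The factor \<open>norm r\<close> stays inside: for r = 0 the vector v is 0
    rather than a unit vector, and \<open>W t v\<close> is not known to be measurable.\<close>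
  have cross: "integrable M (\<lambda>\<omega>. norm r * (W s u \<omega> * W t v \<omega>)) \<and> (\<integral>\<omega>. norm r * (W s u \<omega> * W t v \<omega>) \<partial>M) = 0
    \<and> (\<lambda>\<omega>. norm r * W t v \<omega>) \<in> borel_measurable M"
  proof (cases "r = 0")
    case r: False
    then have v: "norm v = 1" by (simp add: v_def)
    have "inner u r = 0" using u by (simp add: r_def inner_diff_right norm_eq_1)
    then have "inner u v = 0" by (simp add: v_def)
    then show ?thesis
      using cylindrical_wiener_orthogonal[OF W u v _ s t] brownian_moments(1)[OF cylindrical_wiener_unit[OF W v] t t] by simp
  qed simp
  then have [measurable]: "(\<lambda>\<omega>. norm r * W t v \<omega>) \<in> borel_measurable M" by blast
  let ?R = "\<lambda>\<omega>. norm g * inner u h * (W s u \<omega> * W t u \<omega>) + norm g * (norm r * (W s u \<omega> * W t v \<omega>))"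
  have R: "integrable M ?R" "(\<integral>\<omega>. ?R \<omega> \<partial>M) = min s t * inner g h"
    using cross bu(5,6)[OF s t] by (simp_all add: inner_gh)
  have eq: "AE \<omega> in M. wiener_version W s g \<omega> * wiener_version W t h \<omega> = ?R \<omega>"
    using AE by eventually_elim (simp add: g algebra_simps)
  have meas: "(\<lambda>\<omega>. wiener_version W s g \<omega> * wiener_version W t h \<omega>) \<in> borel_measurable M" by (simp add: g)
  show ?thesis
    using integrable_cong_AE[OF meas borel_measurable_integrable[OF R(1)] eq]
      integral_cong_AE[OF meas borel_measurable_integrable[OF R(1)] eq] R by simp
qed (simp add: wiener_version_def)

definition wiener_increment :: "(real \<Rightarrow> 'h::real_inner \<Rightarrow> 'w \<Rightarrow> real) \<Rightarrow> real \<Rightarrow> real \<Rightarrow> 'h \<Rightarrow> 'w \<Rightarrow> real" where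
  "wiener_increment W a b g \<omega> = wiener_version W b g \<omega> - wiener_version W a g \<omega>"

lemma wiener_increment_measurable:
  assumes "cylindrical_wiener M W" "0 \<le> a" "a \<le> b"
  shows "wiener_increment W a b g \<in> borel_measurable M"
  unfolding wiener_increment_def[abs_def]
  using assms by (intro borel_measurable_diff wiener_version_measurable) auto

text \<open>As min s t is the length of the intersection of (0,s] and (0,t], the four covariances
  combine to the overlap of (a,b] and (c,d].\<close>

lemma wiener_increment_covariance:
  assumes W: "cylindrical_wiener M W" and ab: "0 \<le> a" "a \<le> b" and cd: "0 \<le> c" "c \<le> d"
  shows "integrable M (\<lambda>\<omega>. wiener_increment W a b g \<omega> * wiener_increment W c d h \<omega>)
    \<and> (\<integral>\<omega>. wiener_increment W a b g \<omega> * wiener_increment W c d h \<omega> \<partial>M)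
      = inner g h * (\<integral>s. indicator {a<..b} s * indicator {c<..d} s \<partial>lborel)"
proof -
  have eq: "(\<lambda>\<omega>. wiener_increment W a b g \<omega> * wiener_increment W c d h \<omega>)
    = (\<lambda>\<omega>. wiener_version W b g \<omega> * wiener_version W d h \<omega> - wiener_version W b g \<omega> * wiener_version W c h \<omega>
      - wiener_version W a g \<omega> * wiener_version W d h \<omega> + wiener_version W a g \<omega> * wiener_version W c h \<omega>)"
    by (simp add: wiener_increment_def fun_eq_iff algebra_simps)
  have "(\<lambda>s. indicator {a<..b} s * indicator {c<..d} s :: real) = indicator {max a c<..min b d}"
    by (auto simp: indicator_def fun_eq_iff)
  then have "(\<integral>s. indicator {a<..b} s * indicator {c<..d} s \<partial>lborel) = measure lborel {max a c<..min b d}"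
    by simp
  also have "\<dots> = max 0 (min b d - max a c)" by (auto simp: measure_def max_def min_def)
  also have "\<dots> = min b d - min b c - min a d + min a c"
    using ab cd by (auto simp: min_def max_def)
  finally have len: "(\<integral>s. indicator {a<..b} s * indicator {c<..d} s \<partial>lborel) = min b d - min b c - min a d + min a c" .
  have pos: "0 \<le> b" "0 \<le> d" using ab cd by auto
  note cov = wiener_version_covariance[OF W]
  show ?thesis
    unfolding eq len using cov[OF pos(1) pos(2), of g h] cov[OF pos(1) cd(1), of g h]
      cov[OF ab(1) pos(2), of g h] cov[OF ab(1) cd(1), of g h]
    by (simp add: algebra_simps)
qed

section \<open>Taylor expansion in \<open>C\<^sub>b\<^sup>2\<close>\<close>

lemma has_derivative_deriv1:
  assumes "f differentiable (at x)"
  shows "(f has_derivative blinfun_apply (deriv1 f x)) (at x)"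
proof -
  have d: "(f has_derivative frechet_derivative f (at x)) (at x)"
    using assms frechet_derivative_works by blast
  then show ?thesis
    unfolding deriv1_def by (subst bounded_linear_Blinfun_apply) (auto intro: has_derivative_bounded_linear)
qed

text \<open>Applied to \<phi> itself, and to \<open>deriv1 \<phi>\<close>, whose derivative is
  \<open>deriv2 \<phi>\<close>.\<close>

lemma lipschitz_of_deriv1:
  assumes "\<And>x. f differentiable (at x)" "\<And>x. norm (deriv1 f x) \<le> B"
  shows "norm (f x - f y) \<le> B * norm (x - y)"
proof (rule differentiable_bound[of UNIV])
  show "(f has_derivative blinfun_apply (deriv1 f x)) (at x within UNIV)" for x
    using has_derivative_deriv1[OF assms(1)] by simp
  show "onorm (blinfun_apply (deriv1 f x)) \<le> B" for x
    using assms(2)[of x] by (simp add: norm_blinfun.rep_eq)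
qed auto

lemma Cb2_norm_bounds:
  assumes "Cb2_norm \<phi> \<le> 1"
  shows "norm (deriv1 \<phi> x) \<le> 1" "norm (deriv2 \<phi> x) \<le> 1"
proof -
  have "(SUP y. ennreal \<bar>\<phi> y\<bar>) + ennreal (norm (deriv1 \<phi> x)) + ennreal (norm (deriv2 \<phi> x)) \<le> Cb2_norm \<phi>"
    unfolding Cb2_norm_def by (rule SUP_upper) simp
  also have "\<dots> \<le> 1" by fact
  finally have le: "(SUP y. ennreal \<bar>\<phi> y\<bar>) + ennreal (norm (deriv1 \<phi> x)) + ennreal (norm (deriv2 \<phi> x)) \<le> 1" .
  have "ennreal (norm (deriv2 \<phi> x)) \<le> 1"
    by (rule order_trans[OF _ le]) (rule add_increasing, auto)
  then show "norm (deriv2 \<phi> x) \<le> 1" by (simp add: ennreal_le_1)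
  have "ennreal (norm (deriv1 \<phi> x)) \<le> 1"
    by (rule order_trans[OF _ le]) (rule add_increasing2, simp, rule add_increasing, auto)
  then show "norm (deriv1 \<phi> x) \<le> 1" by (simp add: ennreal_le_1)
qed

lemma taylor_second_order_bound:
  fixes \<phi> :: "'h::real_normed_vector \<Rightarrow> real"
  assumes diff: "\<And>x. \<phi> differentiable (at x)"
    and lip: "\<And>x y. norm (deriv1 \<phi> x - deriv1 \<phi> y) \<le> norm (x - y)"
  shows "\<bar>\<phi> (x + h) - \<phi> x - deriv1 \<phi> x h\<bar> \<le> (norm h)\<^sup>2 / 2"
proof -
  define g where "g t = \<phi> (x + t *\<^sub>R h) - t * deriv1 \<phi> x h" for t :: real
  have g': "(g has_real_derivative deriv1 \<phi> (x + t *\<^sub>R h) h - deriv1 \<phi> x h) (at t)" for t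
  proof -
    have "((\<lambda>t. \<phi> (x + t *\<^sub>R h)) has_derivative (\<lambda>s. deriv1 \<phi> (x + t *\<^sub>R h) (s *\<^sub>R h))) (at t)"
      by (rule has_derivative_compose[OF _ has_derivative_deriv1[OF diff]])
        (auto intro!: derivative_eq_intros)
    moreover have "(\<lambda>s. deriv1 \<phi> (x + t *\<^sub>R h) (s *\<^sub>R h)) = (*) (deriv1 \<phi> (x + t *\<^sub>R h) h)"
      by (simp add: fun_eq_iff blinfun.scaleR_right)
    ultimately have "((\<lambda>t. \<phi> (x + t *\<^sub>R h)) has_real_derivative deriv1 \<phi> (x + t *\<^sub>R h) h) (at t)"
      by (simp only: has_field_derivative_def)
    then show ?thesis
      unfolding g_def by (auto intro!: derivative_eq_intros)
  qed
  have g'_le: "\<bar>deriv1 \<phi> (x + t *\<^sub>R h) h - deriv1 \<phi> x h\<bar> \<le> t * (norm h)\<^sup>2" if "t \<ge> 0" for t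
  proof -
    have "\<bar>(deriv1 \<phi> (x + t *\<^sub>R h) - deriv1 \<phi> x) h\<bar> \<le> norm (deriv1 \<phi> (x + t *\<^sub>R h) - deriv1 \<phi> x) * norm h"
      using norm_blinfun[of "deriv1 \<phi> (x + t *\<^sub>R h) - deriv1 \<phi> x" h] by simp
    also have "\<dots> \<le> norm (x + t *\<^sub>R h - x) * norm h"
      by (intro mult_right_mono lip) auto
    finally show ?thesis using that by (simp add: blinfun.diff_left power2_eq_square)
  qed
  \<comment> \<open>\<sigma> = 1 and \<sigma> = -1 give the upper and the lower estimate.\<close>
  have le: "\<sigma> * g 1 - (norm h)\<^sup>2 / 2 \<le> \<sigma> * g 0" if \<sigma>: "\<bar>\<sigma>\<bar> = 1" for \<sigma> :: real
  proof -
    let ?p = "\<lambda>t. \<sigma> * g t - t\<^sup>2 / 2 * (norm h)\<^sup>2"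
    have "?p 1 \<le> ?p 0"
    proof (rule DERIV_nonpos_imp_nonincreasing[of 0 1 ?p])
      fix t :: real assume t: "0 \<le> t" "t \<le> 1"
      let ?d = "\<sigma> * (deriv1 \<phi> (x + t *\<^sub>R h) h - deriv1 \<phi> x h) - t * (norm h)\<^sup>2"
      have "(?p has_real_derivative ?d) (at t)"
        by (auto intro!: derivative_eq_intros g')
      moreover have "?d \<le> 0"
      proof -
        have "\<sigma> * (deriv1 \<phi> (x + t *\<^sub>R h) h - deriv1 \<phi> x h) \<le> \<bar>deriv1 \<phi> (x + t *\<^sub>R h) h - deriv1 \<phi> x h\<bar>"
          using abs_ge_self[of "\<sigma> * (deriv1 \<phi> (x + t *\<^sub>R h) h - deriv1 \<phi> x h)"] \<sigma> by (simp add: abs_mult)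
        then show ?thesis using g'_le[OF t(1)] by linarith
      qed
      ultimately show "\<exists>y. (?p has_real_derivative y) (at t) \<and> y \<le> 0" by blast
    qed simp
    then show ?thesis by simp
  qed
  have "\<phi> (x + h) - deriv1 \<phi> x h - (norm h)\<^sup>2 / 2 \<le> \<phi> x"
    "deriv1 \<phi> x h - \<phi> (x + h) - (norm h)\<^sup>2 / 2 \<le> - \<phi> x"
    using le[of 1] le[of "-1"] by (simp_all add: g_def)
  then show ?thesis by linarith
qed

section \<open>The Ito isometry\<close>

lemma norm_scaleR_sum_squared:
  fixes v :: "'i \<Rightarrow> 'b::real_inner"
  shows "(norm (\<Sum>i\<in>I. c i *\<^sub>R v i))\<^sup>2 = (\<Sum>i\<in>I. \<Sum>j\<in>I. c i * c j * inner (v i) (v j))"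
  unfolding power2_norm_eq_inner inner_sum_left
  by (simp add: inner_sum_right sum_distrib_left ac_simps)

abbreviation lower :: "real \<times> real \<times> 'h \<times> 'h \<Rightarrow> real" where "lower x \<equiv> fst x"
abbreviation upper :: "real \<times> real \<times> 'h \<times> 'h \<Rightarrow> real" where "upper x \<equiv> fst (snd x)"
abbreviation source :: "real \<times> real \<times> 'h \<times> 'h \<Rightarrow> 'h" where "source x \<equiv> fst (snd (snd x))"
abbreviation target :: "real \<times> real \<times> 'h \<times> 'h \<Rightarrow> 'h" where "target x \<equiv> snd (snd (snd x))"

lemma elementary_fun_nth:
  "elementary_fun E s x =
    (\<Sum>i<length E. (indicator {lower (E ! i)<..upper (E ! i)} s * inner (source (E ! i)) x) *\<^sub>R target (E ! i))"
  by (simp add: elementary_fun_def sum_list_sum_nth atLeast0LessThan case_prod_beta)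

lemma elementary_on_nth:
  "elementary_on t E \<Longrightarrow> i < length E \<Longrightarrow> 0 \<le> lower (E ! i) \<and> lower (E ! i) \<le> upper (E ! i) \<and> upper (E ! i) \<le> t"
  by (auto simp: elementary_on_def case_prod_beta dest!: nth_mem)

text \<open>Measurable counterpart of \<open>elementary_integral\<close>, equal to it almost
  everywhere; the original involves W in directions that need not be unit vectors.\<close>

definition elementary_version ::
  "(real \<Rightarrow> 'h \<Rightarrow> 'w \<Rightarrow> real) \<Rightarrow> 'h :: real_inner elementary \<Rightarrow> 'w \<Rightarrow> 'h" where
  "elementary_version W E \<omega> =
    (\<Sum>i<length E. wiener_increment W (lower (E ! i)) (upper (E ! i)) (source (E ! i)) \<omega> *\<^sub>R target (E ! i))"

lemma elementary_version_AE:
  assumes W: "cylindrical_wiener M W" and E: "elementary_on t E"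
  shows "AE \<omega> in M. elementary_integral W E \<omega> = elementary_version W E \<omega>"
proof -
  have "AE \<omega> in M. \<forall>i\<in>{..<length E}. W (upper (E ! i)) (source (E ! i)) \<omega> - W (lower (E ! i)) (source (E ! i)) \<omega>
      = wiener_increment W (lower (E ! i)) (upper (E ! i)) (source (E ! i)) \<omega>"
  proof (rule AE_finite_allI)
    fix i assume "i \<in> {..<length E}"
    then have "0 \<le> lower (E ! i)" "0 \<le> upper (E ! i)" using elementary_on_nth[OF E, of i] by auto
    from wiener_version_AE[OF W this(1), of "source (E ! i)"] wiener_version_AE[OF W this(2), of "source (E ! i)"]
    show "AE \<omega> in M. W (upper (E ! i)) (source (E ! i)) \<omega> - W (lower (E ! i)) (source (E ! i)) \<omega>
      = wiener_increment W (lower (E ! i)) (upper (E ! i)) (source (E ! i)) \<omega>"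
      by eventually_elim (simp add: wiener_increment_def)
  qed simp
  then show ?thesis
    by eventually_elim
      (simp add: elementary_integral_def elementary_version_def sum_list_sum_nth atLeast0LessThan case_prod_beta)
qed

lemma elementary_version_increment_measurable:
  assumes W: "cylindrical_wiener M W" and E: "elementary_on t E" and i: "i < length E"
  shows "wiener_increment W (lower (E ! i)) (upper (E ! i)) (source (E ! i)) \<in> borel_measurable M"
  using elementary_on_nth[OF E i] by (intro wiener_increment_measurable[OF W]) auto

lemma elementary_version_measurable:
  assumes "cylindrical_wiener M W" "elementary_on t E"
  shows "elementary_version W E \<in> borel_measurable M"
  unfolding elementary_version_def[abs_def]
  using elementary_version_increment_measurable[OF assms] by (intro measurable_scaleR_sum) auto

lemma norm_diff_elementary_version_measurable:
  assumes "cylindrical_wiener M W" "elementary_on t E" "X \<in> borel_measurable M"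
  shows "(\<lambda>\<omega>. norm (X \<omega> - elementary_version W E \<omega>)) \<in> borel_measurable M"
  unfolding elementary_version_def
  using elementary_version_increment_measurable[OF assms(1,2)] assms(3)
  by (intro measurable_norm_diff_scaleR_sum) auto

lemma integral_double_sum:
  fixes f :: "'i \<Rightarrow> 'j \<Rightarrow> 'a \<Rightarrow> real"
  assumes "\<And>i j. i \<in> I \<Longrightarrow> j \<in> J \<Longrightarrow> integrable M (f i j)"
  shows "(\<integral>x. (\<Sum>i\<in>I. \<Sum>j\<in>J. f i j x) \<partial>M) = (\<Sum>i\<in>I. \<Sum>j\<in>J. \<integral>x. f i j x \<partial>M)"
proof -
  have "(\<integral>x. (\<Sum>i\<in>I. \<Sum>j\<in>J. f i j x) \<partial>M) = (\<Sum>i\<in>I. \<integral>x. (\<Sum>j\<in>J. f i j x) \<partial>M)"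
    using assms by (intro Bochner_Integration.integral_sum Bochner_Integration.integrable_sum)
  also have "\<dots> = (\<Sum>i\<in>I. \<Sum>j\<in>J. \<integral>x. f i j x \<partial>M)"
    using assms by (intro sum.cong refl Bochner_Integration.integral_sum)
  finally show ?thesis .
qed

text \<open>Both sides equal the integral of the finite double sum H. On the probability side it
  comes from the covariance of increments; on the Hilbert-Schmidt side Parseval's identity sums the
  products of coefficients of two sources to their inner product.\<close>

lemma ito_isometry_elementary:
  assumes W: "cylindrical_wiener M W" and E: "elementary_on t E"
  shows "(\<integral>\<^sup>+\<omega>. ennreal ((norm (elementary_version W E \<omega>))\<^sup>2) \<partial>M)
    = (\<integral>\<^sup>+s\<in>{0..t}. hs_norm_sq (elementary_fun E s) \<partial>lborel)"
proof -
  let ?n = "length E"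
  let ?c = "\<lambda>i. wiener_increment W (lower (E ! i)) (upper (E ! i)) (source (E ! i))"
  let ?ind = "\<lambda>i s. indicator {lower (E ! i)<..upper (E ! i)} s :: real"
  let ?w = "\<lambda>i j. inner (source (E ! i)) (source (E ! j)) * inner (target (E ! i)) (target (E ! j))"
  define H where "H s = (\<Sum>i<?n. \<Sum>j<?n. ?ind i s * ?ind j s * ?w i j)" for s
  note on = elementary_on_nth[OF E]
  have norm_sq: "(norm (elementary_version W E \<omega>))\<^sup>2
      = (\<Sum>i<?n. \<Sum>j<?n. ?c i \<omega> * ?c j \<omega> * inner (target (E ! i)) (target (E ! j)))" for \<omega>
    unfolding elementary_version_def by (rule norm_scaleR_sum_squared)
  have cov: "integrable M (\<lambda>\<omega>. ?c i \<omega> * ?c j \<omega>)"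
    "(\<integral>\<omega>. ?c i \<omega> * ?c j \<omega> \<partial>M) = inner (source (E ! i)) (source (E ! j)) * (\<integral>s. ?ind i s * ?ind j s \<partial>lborel)"
    if "i < ?n" "j < ?n" for i j
    using wiener_increment_covariance[OF W, of "lower (E ! i)" "upper (E ! i)" "lower (E ! j)" "upper (E ! j)"
        "source (E ! i)" "source (E ! j)"] on[OF that(1)] on[OF that(2)] by auto
  have int_ind: "integrable lborel (\<lambda>s. ?ind i s * ?ind j s)" for i j
  proof -
    have "(\<lambda>s. ?ind i s * ?ind j s) = indicator {max (lower (E ! i)) (lower (E ! j))<..min (upper (E ! i)) (upper (E ! j))}"
      by (auto simp: indicator_def fun_eq_iff)
    then show ?thesis
      by (simp only:) (intro integrable_real_indicator emeasure_bounded_finite bounded_Ioc, simp)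
  qed
  have int_norm: "integrable M (\<lambda>\<omega>. (norm (elementary_version W E \<omega>))\<^sup>2)"
    unfolding norm_sq by (intro Bochner_Integration.integrable_sum integrable_mult_left cov) auto
  have "(\<integral>\<omega>. (norm (elementary_version W E \<omega>))\<^sup>2 \<partial>M)
      = (\<Sum>i<?n. \<Sum>j<?n. (\<integral>\<omega>. ?c i \<omega> * ?c j \<omega> \<partial>M) * inner (target (E ! i)) (target (E ! j)))"
    unfolding norm_sq by (subst integral_double_sum) (use cov(1) in auto)
  also have "\<dots> = (\<Sum>i<?n. \<Sum>j<?n. (\<integral>s. ?ind i s * ?ind j s \<partial>lborel) * ?w i j)"
    by (intro sum.cong refl) (simp add: cov(2) ac_simps)
  also have "\<dots> = (\<integral>s. H s \<partial>lborel)"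
    unfolding H_def by (simp add: int_ind)
  finally have eq: "(\<integral>\<omega>. (norm (elementary_version W E \<omega>))\<^sup>2 \<partial>M) = (\<integral>s. H s \<partial>lborel)" .
  have sums: "(\<lambda>k. (norm (elementary_fun E s (eigenfun (Suc k))))\<^sup>2) sums H s" for s
  proof -
    have "(\<lambda>k. \<Sum>i<?n. \<Sum>j<?n. ?ind i s * ?ind j s * inner (target (E ! i)) (target (E ! j))
        * (inner (eigenfun (Suc k)) (source (E ! i)) * inner (eigenfun (Suc k)) (source (E ! j))))
      sums (\<Sum>i<?n. \<Sum>j<?n. ?ind i s * ?ind j s * inner (target (E ! i)) (target (E ! j))
        * inner (source (E ! i)) (source (E ! j)))"
      by (intro sums_sum sums_mult parseval)
    moreover have "(norm (elementary_fun E s (eigenfun (Suc k))))\<^sup>2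
      = (\<Sum>i<?n. \<Sum>j<?n. ?ind i s * ?ind j s * inner (target (E ! i)) (target (E ! j))
        * (inner (eigenfun (Suc k)) (source (E ! i)) * inner (eigenfun (Suc k)) (source (E ! j))))" for k
      unfolding elementary_fun_nth norm_scaleR_sum_squared
      by (intro sum.cong refl) (simp add: inner_commute)
    ultimately show ?thesis by (simp add: H_def ac_simps)
  qed
  have H_nonneg: "0 \<le> H s" for s
    using sums_le[OF _ sums_zero sums[of s]] by simp
  have hs: "hs_norm_sq (elementary_fun E s) = ennreal (H s)" for s
    unfolding hs_norm_sq_def by (rule suminf_ennreal_eq[OF _ sums]) simp
  \<comment> \<open>The covariances give integrals over the whole line; this restricts them to
    [0,t].\<close>
  have H_out: "H s = 0" if "s \<notin> {0..t}" for s
    unfolding H_def using on that by (intro sum.neutral ballI) (force simp: indicator_def)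
  have "(\<integral>\<^sup>+\<omega>. ennreal ((norm (elementary_version W E \<omega>))\<^sup>2) \<partial>M) = ennreal (\<integral>s. H s \<partial>lborel)"
    using int_norm by (subst nn_integral_eq_integral) (auto simp: eq)
  also have "\<dots> = (\<integral>\<^sup>+s. ennreal (H s) \<partial>lborel)"
    using H_nonneg int_ind unfolding H_def
    by (intro nn_integral_eq_integral[symmetric] Bochner_Integration.integrable_sum integrable_mult_left) auto
  also have "\<dots> = (\<integral>\<^sup>+s\<in>{0..t}. hs_norm_sq (elementary_fun E s) \<partial>lborel)"
    using H_out by (intro nn_integral_cong) (auto simp: hs indicator_def)
  finally show ?thesis .
qed

section \<open>From elementary integrands to stochastic integrals\<close>

definition elementary_diff :: "'h::real_inner elementary \<Rightarrow> 'h elementary \<Rightarrow> 'h elementary" where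
  "elementary_diff E F = E @ map (\<lambda>(a, b, g, f). (a, b, g, - f)) F"

lemma elementary_on_diff: "elementary_on t E \<Longrightarrow> elementary_on t F \<Longrightarrow> elementary_on t (elementary_diff E F)"
  by (auto simp: elementary_on_def elementary_diff_def)

lemma sum_list_minus: "(\<Sum>x\<leftarrow>xs. - f x) = - (\<Sum>x\<leftarrow>xs. f x :: 'a::ab_group_add)"
  by (induction xs) auto

lemma elementary_fun_diff: "elementary_fun (elementary_diff E F) s x = elementary_fun E s x - elementary_fun F s x"
  by (simp add: elementary_fun_def elementary_diff_def o_def case_prod_unfold sum_list_minus)

lemma elementary_integral_diff:
  "elementary_integral W (elementary_diff E F) \<omega> = elementary_integral W E \<omega> - elementary_integral W F \<omega>"
  by (simp add: elementary_integral_def elementary_diff_def o_def case_prod_unfold sum_list_minus)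

lemma norm_diff_squared_le:
  fixes a b c :: "'a::real_normed_vector"
  shows "(norm (a - b))\<^sup>2 \<le> 2 * (norm (a - c))\<^sup>2 + 2 * (norm (b - c))\<^sup>2"
proof -
  have "norm (a - b) \<le> norm (a - c) + norm (b - c)"
    using norm_triangle_ineq4[of "a - c" "b - c"] by simp
  then have "(norm (a - b))\<^sup>2 \<le> (norm (a - c) + norm (b - c))\<^sup>2" by (intro power_mono) auto
  also have "\<dots> \<le> 2 * (norm (a - c))\<^sup>2 + 2 * (norm (b - c))\<^sup>2"
    using sum_squares_bound[of "norm (a - c)" "norm (b - c)"] by (simp add: power2_sum)
  finally show ?thesis .
qed

lemma ennreal_norm_diff_squared_le:
  "ennreal ((norm (a - b))\<^sup>2) \<le> 2 * ennreal ((norm (a - c))\<^sup>2) + 2 * ennreal ((norm (b - c))\<^sup>2)"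
proof -
  have "ennreal ((norm (a - b))\<^sup>2) \<le> ennreal (2 * (norm (a - c))\<^sup>2 + 2 * (norm (b - c))\<^sup>2)"
    by (intro ennreal_leI norm_diff_squared_le)
  then show ?thesis by (simp add: ennreal_plus ennreal_mult'')
qed

lemma hs_norm_sq_diff_le:
  "hs_norm_sq (\<lambda>x. R x - S x) \<le> 2 * hs_norm_sq (\<lambda>x. R x - P x) + 2 * hs_norm_sq (\<lambda>x. S x - P x)"
proof -
  have "hs_norm_sq (\<lambda>x. R x - S x) \<le> (\<Sum>k. 2 * ennreal ((norm (R (eigenfun (Suc k)) - P (eigenfun (Suc k))))\<^sup>2)
      + 2 * ennreal ((norm (S (eigenfun (Suc k)) - P (eigenfun (Suc k))))\<^sup>2))"
    unfolding hs_norm_sq_def by (intro suminf_le ennreal_norm_diff_squared_le) auto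
  also have "\<dots> = 2 * hs_norm_sq (\<lambda>x. R x - P x) + 2 * hs_norm_sq (\<lambda>x. S x - P x)"
    unfolding hs_norm_sq_def by (subst suminf_add[symmetric]) auto
  finally show ?thesis .
qed

text \<open>\<open>hs_norm_sq\<close> sees \<open>\<Phi>\<close> only on the sines, where it acts by
  measurable scalars, so measurability of \<open>\<Phi>\<close> as an operator-valued function never
  has to be defined.\<close>

lemma hs_norm_sq_diff_measurable:
  assumes diag: "\<And>s k. s \<in> {0..t} \<Longrightarrow> k \<ge> 1 \<Longrightarrow> \<Phi> s (eigenfun k) = a k s *\<^sub>R eigenfun k"
    and a[measurable]: "\<And>k. a k \<in> borel_measurable borel"
  shows "(\<lambda>s. hs_norm_sq (\<lambda>x. elementary_fun E s x - \<Phi> s x) * indicator {0..t} s) \<in> borel_measurable lborel"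
proof -
  have [measurable]: "(\<lambda>s. norm (elementary_fun E s (eigenfun (Suc k)) - a (Suc k) s *\<^sub>R eigenfun (Suc k))) \<in> borel_measurable lborel" for k
  proof -
    have "(\<lambda>s. norm (elementary_fun E s (eigenfun (Suc k)) - (\<Sum>i\<in>{0::nat}. a (Suc k) s *\<^sub>R eigenfun (Suc k)))) \<in> borel_measurable lborel"
    proof (rule measurable_norm_diff_scaleR_sum)
      show "(\<lambda>s. elementary_fun E s (eigenfun (Suc k))) \<in> borel_measurable lborel"
        unfolding elementary_fun_nth by (intro measurable_scaleR_sum) auto
    qed simp
    then show ?thesis by simp
  qed
  have "(\<lambda>s. (\<Sum>k. ennreal ((norm (elementary_fun E s (eigenfun (Suc k)) - a (Suc k) s *\<^sub>R eigenfun (Suc k)))\<^sup>2)) * indicator {0..t} s) \<in> borel_measurable lborel"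
    by measurable
  also have "(\<lambda>s. (\<Sum>k. ennreal ((norm (elementary_fun E s (eigenfun (Suc k)) - a (Suc k) s *\<^sub>R eigenfun (Suc k)))\<^sup>2)) * indicator {0..t} s)
      = (\<lambda>s. hs_norm_sq (\<lambda>x. elementary_fun E s x - \<Phi> s x) * indicator {0..t} s)"
    by (auto simp: hs_norm_sq_def indicator_def diag)
  finally show ?thesis .
qed

text \<open>X comes with some approximating sequence E, whereas the proof needs a chosen integrand
  D. Two uses of |a - b|^2 \<le> 2 |a - c|^2 + 2 |b - c|^2, one of them after the isometry, give the
  bound 4 \<delta> + 4 A_m + 2 B_m, where A_m and B_m tend to 0.\<close>

lemma stochastic_integral_approx:
  assumes W: "cylindrical_wiener M W" and X: "is_stochastic_integral M W \<Phi> t X"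
    and diag: "\<And>s k. s \<in> {0..t} \<Longrightarrow> k \<ge> 1 \<Longrightarrow> \<Phi> s (eigenfun k) = a k s *\<^sub>R eigenfun k"
    and a: "\<And>k. a k \<in> borel_measurable borel"
    and D: "elementary_on t D"
    and \<delta>: "(\<integral>\<^sup>+s\<in>{0..t}. hs_norm_sq (\<lambda>x. elementary_fun D s x - \<Phi> s x) \<partial>lborel) \<le> \<delta>"
  shows "(\<integral>\<^sup>+\<omega>. ennreal ((norm (elementary_integral W D \<omega> - X \<omega>))\<^sup>2) \<partial>M) \<le> 4 * \<delta>"
proof -
  obtain E where E: "\<And>m :: nat. elementary_on t (E m)"
    and A: "(\<lambda>m. \<integral>\<^sup>+s\<in>{0..t}. hs_norm_sq (\<lambda>x. elementary_fun (E m) s x - \<Phi> s x) \<partial>lborel) \<longlonglongrightarrow> 0"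
    and B: "(\<lambda>m. \<integral>\<^sup>+\<omega>. ennreal ((norm (elementary_integral W (E m) \<omega> - X \<omega>))\<^sup>2) \<partial>M) \<longlonglongrightarrow> 0"
    and X_meas: "X \<in> borel_measurable M"
    using X unfolding is_stochastic_integral_def by auto
  let ?A = "\<lambda>m. \<integral>\<^sup>+s\<in>{0..t}. hs_norm_sq (\<lambda>x. elementary_fun (E m) s x - \<Phi> s x) \<partial>lborel"
  let ?B = "\<lambda>m. \<integral>\<^sup>+\<omega>. ennreal ((norm (elementary_integral W (E m) \<omega> - X \<omega>))\<^sup>2) \<partial>M"
  let ?V = "elementary_version W"
  have bound: "(\<integral>\<^sup>+\<omega>. ennreal ((norm (elementary_integral W D \<omega> - X \<omega>))\<^sup>2) \<partial>M) \<le> 4 * \<delta> + 4 * ?A m + 2 * ?B m" for m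
  proof -
    note AE_D = elementary_version_AE[OF W D] and AE_E = elementary_version_AE[OF W E[of m]]
    have [measurable]: "(\<lambda>\<omega>. norm (X \<omega> - ?V D \<omega>)) \<in> borel_measurable M" "(\<lambda>\<omega>. norm (X \<omega> - ?V (E m) \<omega>)) \<in> borel_measurable M"
      "(\<lambda>\<omega>. norm (?V D \<omega> - ?V (E m) \<omega>)) \<in> borel_measurable M"
      using elementary_version_measurable[OF W D] D E X_meas
      by (auto intro: norm_diff_elementary_version_measurable[OF W])
    have [measurable]: "(\<lambda>s. hs_norm_sq (\<lambda>x. elementary_fun F s x - \<Phi> s x) * indicator {0..t} s) \<in> borel_measurable lborel" for F
      using diag a by (rule hs_norm_sq_diff_measurable)
    have "AE \<omega> in M. ?V (elementary_diff D (E m)) \<omega> = ?V D \<omega> - ?V (E m) \<omega>"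
      using AE_D AE_E elementary_version_AE[OF W elementary_on_diff[OF D E[of m]]]
      by eventually_elim (simp add: elementary_integral_diff)
    then have "(\<integral>\<^sup>+\<omega>. ennreal ((norm (?V D \<omega> - ?V (E m) \<omega>))\<^sup>2) \<partial>M)
        = (\<integral>\<^sup>+\<omega>. ennreal ((norm (?V (elementary_diff D (E m)) \<omega>))\<^sup>2) \<partial>M)"
      by (intro nn_integral_cong_AE) auto
    also have "\<dots> = (\<integral>\<^sup>+s\<in>{0..t}. hs_norm_sq (\<lambda>x. elementary_fun D s x - elementary_fun (E m) s x) \<partial>lborel)"
      using ito_isometry_elementary[OF W elementary_on_diff[OF D E[of m]]]
      by (simp add: elementary_fun_diff[abs_def])
    also have "\<dots> \<le> (\<integral>\<^sup>+s. 2 * (hs_norm_sq (\<lambda>x. elementary_fun D s x - \<Phi> s x) * indicator {0..t} s)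
        + 2 * (hs_norm_sq (\<lambda>x. elementary_fun (E m) s x - \<Phi> s x) * indicator {0..t} s) \<partial>lborel)"
      by (intro nn_integral_mono) (auto simp: indicator_def intro: hs_norm_sq_diff_le)
    also have "\<dots> = 2 * (\<integral>\<^sup>+s\<in>{0..t}. hs_norm_sq (\<lambda>x. elementary_fun D s x - \<Phi> s x) \<partial>lborel) + 2 * ?A m"
      by (subst nn_integral_add) (auto simp: nn_integral_cmult)
    also have "\<dots> \<le> 2 * \<delta> + 2 * ?A m"
      using \<delta> by (intro add_mono mult_left_mono) auto
    finally have DE: "(\<integral>\<^sup>+\<omega>. ennreal ((norm (?V D \<omega> - ?V (E m) \<omega>))\<^sup>2) \<partial>M) \<le> 2 * \<delta> + 2 * ?A m" .
    have "(\<integral>\<^sup>+\<omega>. ennreal ((norm (elementary_integral W D \<omega> - X \<omega>))\<^sup>2) \<partial>M)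
        = (\<integral>\<^sup>+\<omega>. ennreal ((norm (?V D \<omega> - X \<omega>))\<^sup>2) \<partial>M)"
      using AE_D by (intro nn_integral_cong_AE) auto
    also have "\<dots> \<le> (\<integral>\<^sup>+\<omega>. 2 * ennreal ((norm (?V D \<omega> - ?V (E m) \<omega>))\<^sup>2) + 2 * ennreal ((norm (X \<omega> - ?V (E m) \<omega>))\<^sup>2) \<partial>M)"
      by (intro nn_integral_mono ennreal_norm_diff_squared_le)
    also have "\<dots> = 2 * (\<integral>\<^sup>+\<omega>. ennreal ((norm (?V D \<omega> - ?V (E m) \<omega>))\<^sup>2) \<partial>M)
        + 2 * (\<integral>\<^sup>+\<omega>. ennreal ((norm (X \<omega> - ?V (E m) \<omega>))\<^sup>2) \<partial>M)"
      by (subst nn_integral_add) (auto simp: nn_integral_cmult)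
    also have "(\<integral>\<^sup>+\<omega>. ennreal ((norm (X \<omega> - ?V (E m) \<omega>))\<^sup>2) \<partial>M) = ?B m"
      using AE_E by (intro nn_integral_cong_AE) (auto simp: norm_minus_commute)
    also have "2 * (\<integral>\<^sup>+\<omega>. ennreal ((norm (?V D \<omega> - ?V (E m) \<omega>))\<^sup>2) \<partial>M) + 2 * ?B m \<le> 2 * (2 * \<delta> + 2 * ?A m) + 2 * ?B m"
      by (intro add_mono mult_left_mono DE) auto
    also have "\<dots> = 4 * \<delta> + 4 * ?A m + 2 * ?B m"
      by (simp add: distrib_left mult.assoc[symmetric])
    finally show ?thesis .
  qed
  have "(\<lambda>m. 4 * \<delta> + 4 * ?A m + 2 * ?B m) \<longlonglongrightarrow> 4 * \<delta> + 4 * 0 + 2 * 0"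
    by (intro tendsto_add tendsto_const ennreal_tendsto_cmult A B) auto
  then show ?thesis
    using bound by (intro LIMSEQ_le_const[of _ "4 * \<delta>"]) auto
qed

section \<open>Discretised stochastic convolutions\<close>

definition grid :: "real \<Rightarrow> nat \<Rightarrow> nat \<Rightarrow> real" where
  "grid T N i = T * real i / real N"

lemma grid_mono: "T \<ge> 0 \<Longrightarrow> i \<le> j \<Longrightarrow> grid T N i \<le> grid T N j"
  by (simp add: grid_def divide_right_mono mult_left_mono)

lemma grid_0: "grid T N 0 = 0" by (simp add: grid_def)

lemma grid_N: "N \<ge> 1 \<Longrightarrow> grid T N N = T" by (simp add: grid_def)

lemma grid_Suc: "grid T N (Suc i) - grid T N i = T / real N"
  by (simp add: grid_def diff_divide_distrib[symmetric] algebra_simps)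

lemma grid_nonneg: "T \<ge> 0 \<Longrightarrow> 0 \<le> grid T N i"
  using grid_mono[of T 0 i N] by (simp add: grid_0)

text \<open>The integrand S(T - s) Q^(1/2) cut off after the mode K, with each exponential frozen at
  the left end of its time cell.\<close>

definition heat_grid :: "(nat \<Rightarrow> real) \<Rightarrow> real \<Rightarrow> nat \<Rightarrow> nat \<Rightarrow> L2 elementary" where
  "heat_grid c T K N = concat (map (\<lambda>k. map (\<lambda>i. (grid T N i, grid T N (Suc i), eigenfun k,
      (c k * exp (- eigenval k * (T - grid T N i))) *\<^sub>R eigenfun k)) [0..<N]) [1..<Suc K])"

definition heat_noise :: "(real \<Rightarrow> L2 \<Rightarrow> 'w \<Rightarrow> real) \<Rightarrow> real \<Rightarrow> nat \<Rightarrow> nat \<Rightarrow> 'w \<Rightarrow> real" where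
  "heat_noise W T N k \<omega> = (\<Sum>i<N. exp (- eigenval k * (T - grid T N i))
      * (W (grid T N (Suc i)) (eigenfun k) \<omega> - W (grid T N i) (eigenfun k) \<omega>))"

lemma sum_list_concat_map: "(\<Sum>x\<leftarrow>concat xss. f x) = (\<Sum>xs\<leftarrow>xss. \<Sum>x\<leftarrow>xs. f x :: 'a::comm_monoid_add)"
  by (induction xss) auto

lemma sum_heat_grid:
  fixes f :: "_ \<Rightarrow> 'a::comm_monoid_add"
  shows "(\<Sum>x\<leftarrow>heat_grid c T K N. f x) = (\<Sum>k=1..K. \<Sum>i<N. f (grid T N i, grid T N (Suc i), eigenfun k,
      (c k * exp (- eigenval k * (T - grid T N i))) *\<^sub>R eigenfun k))"
  unfolding heat_grid_def sum_list_concat_map map_map o_def interv_sum_list_conv_sum_set_nat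
  by (intro sum.cong) auto

lemma elementary_on_heat_grid:
  assumes "T > 0"
  shows "elementary_on T (heat_grid c T K N)"
proof -
  have "grid T N (Suc i) \<le> T" if "i < N" for i
    using grid_mono[of T "Suc i" N N] grid_N[of N T] that assms by simp
  then show ?thesis
    using assms by (auto simp: elementary_on_def heat_grid_def grid_nonneg grid_mono)
qed

lemma elementary_integral_heat_grid:
  "elementary_integral W (heat_grid c T K N) \<omega> = (\<Sum>k=1..K. (c k * heat_noise W T N k \<omega>) *\<^sub>R eigenfun k)"
  unfolding elementary_integral_def sum_heat_grid
  by (intro sum.cong refl) (simp add: heat_noise_def sum_distrib_left scaleR_sum_left ac_simps)

lemma elementary_fun_heat_grid:
  assumes j: "j \<ge> 1"
  shows "elementary_fun (heat_grid c T K N) s (eigenfun j) =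
    (if j \<le> K then c j * (\<Sum>i<N. indicator {grid T N i<..grid T N (Suc i)} s * exp (- eigenval j * (T - grid T N i))) else 0)
      *\<^sub>R eigenfun j" (is "_ = (if _ then ?a else _) *\<^sub>R _")
proof -
  have "elementary_fun (heat_grid c T K N) s (eigenfun j) = (\<Sum>k=1..K. if k = j then ?a *\<^sub>R eigenfun j else 0)"
    unfolding elementary_fun_def sum_heat_grid
    using j by (intro sum.cong refl)
      (auto simp: eigenfun_orthonormal sum_distrib_left scaleR_sum_left ac_simps
        simp del: sum_mult_indicator sum_indicator_mult sum_indicator_scaleR)
  then show ?thesis using j
    by (simp add: sum.delta del: sum_mult_indicator sum_indicator_mult sum_indicator_scaleR)
qed

lemma sum_indicator_Ioc:
  fixes f :: "nat \<Rightarrow> real"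
  assumes "\<And>i j. i \<le> j \<Longrightarrow> f i \<le> f j"
  shows "(\<Sum>i<n. indicator {f i<..f (Suc i)} s :: real) = indicator {f 0<..f n} s"
proof (induction n)
  case (Suc n)
  have "f 0 \<le> f n" "f n \<le> f (Suc n)" using assms by auto
  then show ?case using Suc by (auto simp: indicator_def)
qed simp

lemma exp_decay_lipschitz:
  fixes l :: real
  assumes "0 \<le> l" "a \<le> b" "b \<le> T"
  shows "\<bar>exp (- l * (T - a)) - exp (- l * (T - b))\<bar> \<le> l * (b - a)"
proof -
  have eq: "exp (- l * (T - a)) = exp (- l * (T - b)) * exp (- (l * (b - a)))"
    by (simp add: exp_add[symmetric] algebra_simps)
  have "1 - exp (- (l * (b - a))) \<le> l * (b - a)"
    using exp_ge_add_one_self[of "- (l * (b - a))"] by simp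
  moreover have "0 \<le> 1 - exp (- (l * (b - a)))" using assms by simp
  moreover have "exp (- l * (T - b)) \<le> 1" using assms by simp
  ultimately have "exp (- l * (T - b)) * (1 - exp (- (l * (b - a)))) \<le> 1 * (l * (b - a))"
    by (intro mult_mono) auto
  moreover have "\<bar>exp (- l * (T - a)) - exp (- l * (T - b))\<bar> = exp (- l * (T - b)) * (1 - exp (- (l * (b - a))))"
  proof -
    have "exp (- l * (T - b)) * exp (- (l * (b - a))) \<le> exp (- l * (T - b))"
      using assms by (intro mult_left_le) auto
    then show ?thesis unfolding eq by (simp add: right_diff_distrib)
  qed
  ultimately show ?thesis by simp
qed

text \<open>The half-open cells partition (0,T], so exactly one summand survives; it is the
  exponential at a point at distance at most T/N to the left of s.\<close>

lemma grid_exp_error: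
  assumes T: "T > 0" and N: "N \<ge> 1" and l: "l \<ge> 0" and s: "0 < s" "s \<le> T"
  shows "\<bar>(\<Sum>i<N. indicator {grid T N i<..grid T N (Suc i)} s * exp (- l * (T - grid T N i))) - exp (- l * (T - s))\<bar>
    \<le> l * (T / real N)"
proof -
  let ?I = "\<lambda>i. indicator {grid T N i<..grid T N (Suc i)} s :: real"
  have one: "(\<Sum>i<N. ?I i) = 1"
    using sum_indicator_Ioc[of "grid T N" s N] grid_mono[of T] T s N by (simp add: grid_0 grid_N)
  have eq: "(\<Sum>i<N. ?I i * exp (- l * (T - grid T N i))) - exp (- l * (T - s))
      = (\<Sum>i<N. ?I i * (exp (- l * (T - grid T N i)) - exp (- l * (T - s))))"
    by (simp add: right_diff_distrib sum_subtractf sum_distrib_right[symmetric] one)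
  have "\<bar>(\<Sum>i<N. ?I i * exp (- l * (T - grid T N i))) - exp (- l * (T - s))\<bar>
      \<le> (\<Sum>i<N. \<bar>?I i * (exp (- l * (T - grid T N i)) - exp (- l * (T - s)))\<bar>)"
    unfolding eq by (rule sum_abs)
  also have "\<dots> \<le> (\<Sum>i<N. ?I i * (l * (T / real N)))"
  proof (rule sum_mono)
    fix i
    show "\<bar>?I i * (exp (- l * (T - grid T N i)) - exp (- l * (T - s)))\<bar> \<le> ?I i * (l * (T / real N))"
    proof (cases "s \<in> {grid T N i<..grid T N (Suc i)}")
      case True
      then have i: "grid T N i \<le> s" "s \<le> grid T N (Suc i)" by auto
      have "\<bar>exp (- l * (T - grid T N i)) - exp (- l * (T - s))\<bar> \<le> l * (s - grid T N i)"
        by (rule exp_decay_lipschitz[OF l i(1) s(2)])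
      also have "\<dots> \<le> l * (T / real N)"
        by (rule mult_left_mono[OF _ l]) (use i grid_Suc[of T N i] in linarith)
      finally show ?thesis
        unfolding indicator_eq_1_iff[THEN iffD2, OF True] mult_1 .
    qed simp
  qed
  also have "\<dots> = l * (T / real N)" unfolding sum_distrib_right[symmetric] one by simp
  finally show ?thesis .
qed

text \<open>The first K modes carry only the time discretisation error; each remaining mode is lost
  altogether and costs at most c_k^2. The sequence b collects both, with mode k + 1 at index
  k.\<close>

lemma heat_grid_hs_bound:
  assumes T: "T > 0" and N: "N \<ge> 1" and c: "summable (\<lambda>k. (c (Suc k))\<^sup>2)"
    and diag: "\<And>s k. s \<in> {0..T} \<Longrightarrow> k \<ge> 1 \<Longrightarrow> \<Phi> s (eigenfun k) = (c k * exp (- eigenval k * (T - s))) *\<^sub>R eigenfun k"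
  shows "(\<integral>\<^sup>+s\<in>{0..T}. hs_norm_sq (\<lambda>x. elementary_fun (heat_grid c T K N) s x - \<Phi> s x) \<partial>lborel)
    \<le> ennreal (T * ((\<Sum>k<K. (c (Suc k))\<^sup>2 * (eigenval (Suc k) * (T / real N))\<^sup>2) + (\<Sum>k. (c (Suc (k + K)))\<^sup>2)))"
proof -
  define b where "b k = (if k < K then (c (Suc k))\<^sup>2 * (eigenval (Suc k) * (T / real N))\<^sup>2 else (c (Suc k))\<^sup>2)" for k
  have tail: "summable (\<lambda>k. b (k + K))" using c by (simp add: b_def summable_iff_shift[of "\<lambda>k. (c (Suc k))\<^sup>2"])
  then have b: "summable b" by (simp add: summable_iff_shift)
  have suminf_b: "suminf b = (\<Sum>k<K. (c (Suc k))\<^sup>2 * (eigenval (Suc k) * (T / real N))\<^sup>2) + (\<Sum>k. (c (Suc (k + K)))\<^sup>2)"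
    using suminf_split_initial_segment[OF b, of K] by (simp add: b_def)
  have b_nonneg: "0 \<le> b k" for k by (simp add: b_def)
  have le: "hs_norm_sq (\<lambda>x. elementary_fun (heat_grid c T K N) s x - \<Phi> s x) \<le> ennreal (suminf b)"
    if s: "0 < s" "s \<le> T" for s
  proof -
    have "(norm (elementary_fun (heat_grid c T K N) s (eigenfun (Suc k)) - \<Phi> s (eigenfun (Suc k))))\<^sup>2 \<le> b k" for k
    proof -
      let ?A = "\<Sum>i<N. indicator {grid T N i<..grid T N (Suc i)} s * exp (- eigenval (Suc k) * (T - grid T N i))"
      let ?e = "exp (- eigenval (Suc k) * (T - s))"
      have \<Phi>: "\<Phi> s (eigenfun (Suc k)) = (c (Suc k) * ?e) *\<^sub>R eigenfun (Suc k)"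
        using diag[of s "Suc k"] s by simp
      have lam: "0 < eigenval (Suc k)" by (rule eigenval_pos) simp
      show ?thesis
      proof (cases "k < K")
        case True
        then have "elementary_fun (heat_grid c T K N) s (eigenfun (Suc k)) - \<Phi> s (eigenfun (Suc k))
            = (c (Suc k) * (?A - ?e)) *\<^sub>R eigenfun (Suc k)"
          unfolding \<Phi> by (subst elementary_fun_heat_grid) (simp_all add: right_diff_distrib scaleR_diff_left)
        then have "(norm (elementary_fun (heat_grid c T K N) s (eigenfun (Suc k)) - \<Phi> s (eigenfun (Suc k))))\<^sup>2
            = (c (Suc k))\<^sup>2 * (?A - ?e)\<^sup>2"
          by (simp add: norm_eigenfun power_mult_distrib)
        also have "\<dots> \<le> (c (Suc k))\<^sup>2 * (eigenval (Suc k) * (T / real N))\<^sup>2"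
        proof (rule mult_left_mono)
          have "\<bar>?A - ?e\<bar> \<le> eigenval (Suc k) * (T / real N)"
            using T N lam s by (intro grid_exp_error) auto
          then show "(?A - ?e)\<^sup>2 \<le> (eigenval (Suc k) * (T / real N))\<^sup>2"
            using T lam by (intro abs_le_square_iff[THEN iffD1]) (auto simp: abs_of_nonneg)
        qed simp
        finally show ?thesis using True by (simp add: b_def)
      next
        case False
        then have "elementary_fun (heat_grid c T K N) s (eigenfun (Suc k)) = 0"
          by (subst elementary_fun_heat_grid) auto
        then have "(norm (elementary_fun (heat_grid c T K N) s (eigenfun (Suc k)) - \<Phi> s (eigenfun (Suc k))))\<^sup>2
            = (c (Suc k))\<^sup>2 * ?e\<^sup>2"
          unfolding \<Phi> by (simp add: norm_eigenfun power_mult_distrib)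
        also have "\<dots> \<le> (c (Suc k))\<^sup>2 * 1"
        proof (rule mult_left_mono)
          have "?e \<le> 1" using lam s by simp
          then show "?e\<^sup>2 \<le> 1" by (simp add: power_le_one)
        qed simp
        finally show ?thesis using False by (simp add: b_def)
      qed
    qed
    then have "hs_norm_sq (\<lambda>x. elementary_fun (heat_grid c T K N) s x - \<Phi> s x) \<le> (\<Sum>k. ennreal (b k))"
      unfolding hs_norm_sq_def by (intro suminf_le ennreal_leI) auto
    also have "\<dots> = ennreal (suminf b)" using b_nonneg b by (intro suminf_ennreal2) auto
    finally show ?thesis .
  qed
  \<comment> \<open>s = 0 belongs to no cell, so the pointwise bound is available only for s >
    0.\<close>
  have "AE s in lborel. s \<noteq> (0::real)" by (rule AE_lborel_singleton)
  then have "(\<integral>\<^sup>+s\<in>{0..T}. hs_norm_sq (\<lambda>x. elementary_fun (heat_grid c T K N) s x - \<Phi> s x) \<partial>lborel)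
      \<le> (\<integral>\<^sup>+s\<in>{0..T}. ennreal (suminf b) \<partial>lborel)"
    by (intro nn_integral_mono_AE) (auto elim!: eventually_mono simp: indicator_def intro!: le)
  also have "\<dots> = ennreal (suminf b) * ennreal T"
    using T by (simp add: nn_integral_cmult_indicator)
  also have "\<dots> = ennreal (T * suminf b)"
    using T suminf_nonneg[OF b b_nonneg] by (simp add: ennreal_mult mult.commute)
  finally show ?thesis by (simp add: suminf_b)
qed

text \<open>The order of the two limits matters: K is chosen first to make the tail small, then N
  depending on K, because the discretisation error involves the unbounded eigenvalues of the first K
  modes.\<close>

lemma heat_grid_hs_small:
  assumes T: "T > 0" and c: "summable (\<lambda>k. (c (Suc k))\<^sup>2)" and \<epsilon>: "\<epsilon> > 0"
    and diag: "\<And>s k. s \<in> {0..T} \<Longrightarrow> k \<ge> 1 \<Longrightarrow> \<Phi> s (eigenfun k) = (c k * exp (- eigenval k * (T - s))) *\<^sub>R eigenfun k"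
  shows "\<forall>\<^sub>F K in sequentially. \<forall>\<^sub>F N in sequentially.
    (\<integral>\<^sup>+s\<in>{0..T}. hs_norm_sq (\<lambda>x. elementary_fun (heat_grid c T K N) s x - \<Phi> s x) \<partial>lborel) \<le> ennreal \<epsilon>"
proof -
  have "\<epsilon> / (2 * T) > 0" using T \<epsilon> by simp
  from suminf_exist_split[OF this c]
  obtain K0 where K0': "\<forall>n\<ge>K0. norm (\<Sum>i. (c (Suc (i + n)))\<^sup>2) < \<epsilon> / (2 * T)"
    by (rule exE)
  have K0: "(\<Sum>i. (c (Suc (i + n)))\<^sup>2) < \<epsilon> / (2 * T)" if "n \<ge> K0" for n
    using K0'[rule_format, OF that] unfolding real_norm_def abs_less_iff by (rule conjunct1)
  show ?thesis
  proof (rule eventually_sequentiallyI[of K0])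
    fix K assume K: "K \<ge> K0"
    have "(\<lambda>N. \<Sum>k<K. (c (Suc k))\<^sup>2 * (eigenval (Suc k) * (T / real N))\<^sup>2) \<longlonglongrightarrow> (\<Sum>k<K. (c (Suc k))\<^sup>2 * (eigenval (Suc k) * 0)\<^sup>2)"
      by (intro tendsto_intros real_tendsto_divide_at_top[OF tendsto_const] filterlim_real_sequentially)
    then have "(\<lambda>N. \<Sum>k<K. (c (Suc k))\<^sup>2 * (eigenval (Suc k) * (T / real N))\<^sup>2) \<longlonglongrightarrow> 0" by simp
    then have "\<forall>\<^sub>F N in sequentially. (\<Sum>k<K. (c (Suc k))\<^sup>2 * (eigenval (Suc k) * (T / real N))\<^sup>2) < \<epsilon> / (2 * T)"
      by (rule order_tendstoD) (use T \<epsilon> in simp)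
    then show "\<forall>\<^sub>F N in sequentially.
      (\<integral>\<^sup>+s\<in>{0..T}. hs_norm_sq (\<lambda>x. elementary_fun (heat_grid c T K N) s x - \<Phi> s x) \<partial>lborel) \<le> ennreal \<epsilon>"
      using eventually_ge_at_top[of "1::nat"]
    proof eventually_elim
      case (elim N)
      have "T * ((\<Sum>k<K. (c (Suc k))\<^sup>2 * (eigenval (Suc k) * (T / real N))\<^sup>2) + (\<Sum>k. (c (Suc (k + K)))\<^sup>2))
          \<le> T * (\<epsilon> / (2 * T) + \<epsilon> / (2 * T))"
        using elim K0[OF K] T by (intro mult_left_mono add_mono) auto
      also have "\<dots> = \<epsilon>" using T by simp
      finally have "ennreal (T * ((\<Sum>k<K. (c (Suc k))\<^sup>2 * (eigenval (Suc k) * (T / real N))\<^sup>2) + (\<Sum>k. (c (Suc (k + K)))\<^sup>2))) \<le> ennreal \<epsilon>"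
        by (rule ennreal_leI)
      with heat_grid_hs_bound[OF T elim(2) c] show ?case
        by (rule order_trans) (rule diag)
    qed
  qed
qed

lemma heat_grid_approx:
  assumes W: "cylindrical_wiener M W" and X: "is_stochastic_integral M W \<Phi> T X"
    and T: "T > 0" and c: "summable (\<lambda>k. (c (Suc k))\<^sup>2)" and \<epsilon>: "\<epsilon> > 0"
    and diag: "\<And>s k. s \<in> {0..T} \<Longrightarrow> k \<ge> 1 \<Longrightarrow> \<Phi> s (eigenfun k) = (c k * exp (- eigenval k * (T - s))) *\<^sub>R eigenfun k"
  shows "\<forall>\<^sub>F K in sequentially. \<forall>\<^sub>F N in sequentially.
    (\<integral>\<^sup>+\<omega>. ennreal ((norm ((\<Sum>k=1..K. (c k * heat_noise W T N k \<omega>) *\<^sub>R eigenfun k) - X \<omega>))\<^sup>2) \<partial>M) \<le> ennreal (4 * \<epsilon>)"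
proof -
  have "\<forall>\<^sub>F K in sequentially. \<forall>\<^sub>F N in sequentially.
    (\<integral>\<^sup>+s\<in>{0..T}. hs_norm_sq (\<lambda>x. elementary_fun (heat_grid c T K N) s x - \<Phi> s x) \<partial>lborel) \<le> ennreal \<epsilon>"
    by (rule heat_grid_hs_small[OF T c \<epsilon>]) (rule diag)
  then show ?thesis
  proof (rule eventually_mono, elim eventually_mono)
    fix K N
    assume *: "(\<integral>\<^sup>+s\<in>{0..T}. hs_norm_sq (\<lambda>x. elementary_fun (heat_grid c T K N) s x - \<Phi> s x) \<partial>lborel) \<le> ennreal \<epsilon>"
    have "(\<integral>\<^sup>+\<omega>. ennreal ((norm (elementary_integral W (heat_grid c T K N) \<omega> - X \<omega>))\<^sup>2) \<partial>M) \<le> 4 * ennreal \<epsilon>"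
      by (rule stochastic_integral_approx[OF W X _ _ elementary_on_heat_grid[OF T] *]) (rule diag, auto)
    then show "(\<integral>\<^sup>+\<omega>. ennreal ((norm ((\<Sum>k=1..K. (c k * heat_noise W T N k \<omega>) *\<^sub>R eigenfun k) - X \<omega>))\<^sup>2) \<partial>M) \<le> ennreal (4 * \<epsilon>)"
      using \<epsilon> by (simp add: elementary_integral_heat_grid ennreal_mult'')
  qed
qed

section \<open>Moments and independence of the discretised noise\<close>

lemma wiener_version_unit: "norm e = 1 \<Longrightarrow> wiener_version W t e = W t e"
  by (simp add: wiener_version_def fun_eq_iff)

lemma heat_noise_alt:
  "k \<ge> 1 \<Longrightarrow> heat_noise W T N k \<omega> = (\<Sum>i<N. exp (- eigenval k * (T - grid T N i))
      * wiener_increment W (grid T N i) (grid T N (Suc i)) (eigenfun k) \<omega>)"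
  by (simp add: heat_noise_def wiener_increment_def wiener_version_unit norm_eigenfun)

text \<open>In every cell the left-endpoint term is at most the increment of the antiderivative g,
  by x \<le> exp x - 1, and the increments telescope. The bound holds for each N, so no limit of the
  variances is taken.\<close>

lemma exp_Riemann_sum_le:
  assumes T: "T > 0" and N: "N \<ge> 1" and l: "l > 0"
  shows "(\<Sum>i<N. (exp (- l * (T - grid T N i)))\<^sup>2 * (T / real N)) \<le> (1 - exp (- 2 * l * T)) / (2 * l)"
proof -
  define g where "g i = exp (- 2 * l * (T - grid T N i)) / (2 * l)" for i
  have "(exp (- l * (T - grid T N i)))\<^sup>2 * (T / real N) \<le> g (Suc i) - g i" for i
  proof -
    let ?h = "T / real N"
    have "grid T N (Suc i) = grid T N i + ?h" using grid_Suc[of T N i] by simp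
    then have e1: "exp (- 2 * l * (T - grid T N (Suc i))) = exp (- 2 * l * (T - grid T N i)) * exp (2 * l * ?h)"
      by (simp add: exp_add[symmetric] algebra_simps)
    have e2: "(exp (- l * (T - grid T N i)))\<^sup>2 = exp (- 2 * l * (T - grid T N i))"
      by (simp add: exp_double[symmetric] mult.assoc)
    have "2 * l * ?h \<le> exp (2 * l * ?h) - 1" using exp_ge_add_one_self[of "2 * l * ?h"] by linarith
    then have "?h \<le> (exp (2 * l * ?h) - 1) / (2 * l)"
      using l by (simp add: le_divide_eq mult.commute)
    then have "exp (- 2 * l * (T - grid T N i)) * ?h \<le> exp (- 2 * l * (T - grid T N i)) * ((exp (2 * l * ?h) - 1) / (2 * l))"
      by (rule mult_left_mono) simp
    also have "\<dots> = g (Suc i) - g i"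
      unfolding g_def e1 by (simp add: right_diff_distrib diff_divide_distrib)
    finally show ?thesis unfolding e2 .
  qed
  then have "(\<Sum>i<N. (exp (- l * (T - grid T N i)))\<^sup>2 * (T / real N)) \<le> (\<Sum>i<N. g (Suc i) - g i)"
    by (rule sum_mono)
  also have "\<dots> = g N - g 0" by (rule sum_lessThan_telescope)
  also have "\<dots> = (1 - exp (- 2 * l * T)) / (2 * l)"
    using N by (simp add: g_def grid_0 grid_N diff_divide_distrib)
  finally show ?thesis .
qed

text \<open>Increments over different cells are uncorrelated, so only the diagonal of the double sum
  survives and becomes a Riemann sum.\<close>

lemma heat_noise_moments:
  assumes W: "cylindrical_wiener M W" and T: "T > 0" and k: "k \<ge> 1" and N: "N \<ge> 1"
  shows "heat_noise W T N k \<in> borel_measurable M" "integrable M (heat_noise W T N k)"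
    "(\<integral>\<omega>. heat_noise W T N k \<omega> \<partial>M) = 0" "integrable M (\<lambda>\<omega>. (heat_noise W T N k \<omega>)\<^sup>2)"
    "(\<integral>\<omega>. (heat_noise W T N k \<omega>)\<^sup>2 \<partial>M) \<le> (1 - exp (- 2 * eigenval k * T)) / (2 * eigenval k)"
proof -
  note bm = brownian_moments[OF cylindrical_wiener_unit[OF W norm_eigenfun[OF k]] grid_nonneg grid_nonneg]
  have T0: "T \<ge> 0" using T by simp
  note W1 = bm(1)[OF T0 T0] and W2 = bm(3)[OF T0 T0] and W3 = bm(4)[OF T0 T0]
  show "heat_noise W T N k \<in> borel_measurable M"
    unfolding heat_noise_def[abs_def] by (intro borel_measurable_sum borel_measurable_times borel_measurable_diff borel_measurable_const W1)
  show "integrable M (heat_noise W T N k)"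
    unfolding heat_noise_def[abs_def] by (intro Bochner_Integration.integrable_sum integrable_mult_right Bochner_Integration.integrable_diff W2)
  show "(\<integral>\<omega>. heat_noise W T N k \<omega> \<partial>M) = 0"
    unfolding heat_noise_def[abs_def]
    by (simp add: W2 W3 Bochner_Integration.integral_sum)
  let ?a = "\<lambda>i. exp (- eigenval k * (T - grid T N i))"
  let ?I = "\<lambda>i. wiener_increment W (grid T N i) (grid T N (Suc i)) (eigenfun k)"
  have sq: "(heat_noise W T N k \<omega>)\<^sup>2 = (\<Sum>i<N. \<Sum>j<N. ?a i * ?a j * (?I i \<omega> * ?I j \<omega>))" for \<omega>
    unfolding heat_noise_alt[OF k] power2_eq_square sum_product by (simp add: ac_simps)
  have overlap: "(\<integral>s. indicator {grid T N i<..grid T N (Suc i)} s * indicator {grid T N j<..grid T N (Suc j)} s \<partial>lborel)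
      = (if i = j then T / real N else 0 :: real)" for i j
  proof (cases "i = j")
    case True
    have "(\<lambda>s. indicator {grid T N i<..grid T N (Suc i)} s * indicator {grid T N i<..grid T N (Suc i)} s :: real)
      = indicator {grid T N i<..grid T N (Suc i)}" by (auto simp: indicator_def fun_eq_iff)
    then show ?thesis using True grid_mono[OF T0, of i "Suc i" N] grid_Suc[of T N i] by (simp add: measure_def)
  next
    case False
    then have "grid T N (Suc i) \<le> grid T N j \<or> grid T N (Suc j) \<le> grid T N i"
      using grid_mono[OF T0, of "Suc i" j N] grid_mono[OF T0, of "Suc j" i N] by linarith
    then have "(\<lambda>s. indicator {grid T N i<..grid T N (Suc i)} s * indicator {grid T N j<..grid T N (Suc j)} s :: real) = (\<lambda>_. 0)"
      by (auto simp: indicator_def fun_eq_iff)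
    then show ?thesis using False by simp
  qed
  have cov: "integrable M (\<lambda>\<omega>. ?I i \<omega> * ?I j \<omega>)" "(\<integral>\<omega>. ?I i \<omega> * ?I j \<omega> \<partial>M) = (if i = j then T / real N else 0)" for i j
    using wiener_increment_covariance[OF W, of "grid T N i" "grid T N (Suc i)" "grid T N j" "grid T N (Suc j)"
        "eigenfun k" "eigenfun k"] k grid_nonneg[OF T0] grid_mono[OF T0, of _ "Suc _"]
    by (simp_all add: overlap eigenfun_orthonormal)
  show "integrable M (\<lambda>\<omega>. (heat_noise W T N k \<omega>)\<^sup>2)"
    unfolding sq by (intro Bochner_Integration.integrable_sum integrable_mult_right cov)
  have "(\<integral>\<omega>. (heat_noise W T N k \<omega>)\<^sup>2 \<partial>M) = (\<Sum>i<N. \<Sum>j<N. ?a i * ?a j * (if i = j then T / real N else 0))"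
    unfolding sq by (subst integral_double_sum) (simp_all add: cov)
  also have "\<dots> = (\<Sum>i<N. (?a i)\<^sup>2 * (T / real N))"
    by (intro sum.cong refl) (simp add: if_distrib[of "\<lambda>x. _ * x"] sum.delta' power2_eq_square cong: if_cong)
  also have "\<dots> \<le> (1 - exp (- 2 * eigenval k * T)) / (2 * eigenval k)"
    by (rule exp_Riemann_sum_le[OF T N eigenval_pos[OF k]])
  finally show "(\<integral>\<omega>. (heat_noise W T N k \<omega>)\<^sup>2 \<partial>M) \<le> (1 - exp (- 2 * eigenval k * T)) / (2 * eigenval k)" .
qed

text \<open>Each noise is a measurable function of the path in a single direction, and the paths in
  orthonormal directions are independent.\<close>

lemma heat_noise_indep:
  assumes W: "cylindrical_wiener M W" and T: "T > 0"
  shows "prob_space.indep_vars M (\<lambda>_. borel) (\<lambda>k. heat_noise W T N (Suc k)) {..<K}"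
proof -
  interpret prob_space M using W by (rule cylindrical_wiener_prob_space)
  have T0: "T \<ge> 0" using T by simp
  have "indep_vars (\<lambda>_. Pi\<^sub>M {0..} (\<lambda>_. borel)) (\<lambda>i \<omega>. \<lambda>t\<in>{0..}. W t (eigenfun (Suc i)) \<omega>) {..<K}"
    by (rule cylindrical_wiener_orthonormal(2)[OF W]) (simp add: eigenfun_orthonormal)
  then have "indep_vars (\<lambda>_. borel) (\<lambda>k \<omega>. (\<lambda>x. \<Sum>i<N. exp (- eigenval (Suc k) * (T - grid T N i))
      * (x (grid T N (Suc i)) - x (grid T N i))) (\<lambda>t\<in>{0..}. W t (eigenfun (Suc k)) \<omega>)) {..<K}"
    by (rule indep_vars_compose2)
      (intro borel_measurable_sum borel_measurable_times borel_measurable_const borel_measurable_diff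
        measurable_component_singleton, auto simp: grid_nonneg[OF T0])
  then show ?thesis by (simp add: heat_noise_def[abs_def] grid_nonneg[OF T0])
qed

section \<open>The weak error\<close>

lemma continuous_on_lipschitz_1:
  fixes f :: "'a::real_normed_vector \<Rightarrow> 'b::real_normed_vector"
  assumes "\<And>x y. norm (f x - f y) \<le> norm (x - y)"
  shows "continuous_on UNIV f"
  unfolding continuous_on_iff dist_norm by (meson assms order_le_less_trans)

context
  fixes M :: "'w measure" and W :: "real \<Rightarrow> L2 \<Rightarrow> 'w \<Rightarrow> real" and T :: real and N :: nat and c :: "nat \<Rightarrow> real"
  assumes W: "cylindrical_wiener M W" and T: "T > 0" and N: "N \<ge> 1"
begin

text \<open>One family for both solutions: it approximates u(T) for large K and u_n(T) for K =
  n.\<close>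

definition galerkin_grid :: "nat \<Rightarrow> 'w \<Rightarrow> L2" where
  "galerkin_grid K \<omega> = (\<Sum>k=1..K. (c k * heat_noise W T N k \<omega>) *\<^sub>R eigenfun k)"

lemma galerkin_grid_measurable: "galerkin_grid K \<in> borel_measurable M"
  unfolding galerkin_grid_def[abs_def]
  by (intro measurable_scaleR_sum borel_measurable_times borel_measurable_const heat_noise_moments(1)[OF W T _ N]) auto

lemma norm_diff_galerkin_grid_measurable:
  assumes "X \<in> borel_measurable M"
  shows "(\<lambda>\<omega>. norm (X \<omega> - galerkin_grid K \<omega>)) \<in> borel_measurable M"
  unfolding galerkin_grid_def
  by (intro measurable_norm_diff_scaleR_sum assms borel_measurable_times borel_measurable_const heat_noise_moments(1)[OF W T _ N]) auto

text \<open>The first factor depends only on the noises 1, ..., n, hence is independent of the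
  centred noise k > n.\<close>

lemma expectation_orthogonal_noise:
  assumes \<psi>: "continuous_on UNIV \<psi>" "\<And>x. \<bar>\<psi> x\<bar> \<le> B" and k: "n < k"
  shows "integrable M (\<lambda>\<omega>. \<psi> (galerkin_grid n \<omega>) * heat_noise W T N k \<omega>)"
    "(\<integral>\<omega>. \<psi> (galerkin_grid n \<omega>) * heat_noise W T N k \<omega> \<partial>M) = 0"
proof -
  interpret prob_space M using W by (rule cylindrical_wiener_prob_space)
  have k1: "k \<ge> 1" using k by simp
  have \<psi>_meas: "\<psi> \<in> borel_measurable borel" by (rule borel_measurable_continuous_onI) (rule \<psi>)
  note noise = heat_noise_moments[OF W T k1 N]
  let ?X = "\<lambda>i. heat_noise W T N (Suc i)"
  \<comment> \<open>\<open>?X\<close> counts from 0: mode i sits at i - 1, so the first n modes fill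
    the indices below n and mode k sits at k - 1 \<ge> n.\<close>
  let ?Y = "\<lambda>x. \<psi> (\<Sum>i=1..n. (c i * x (i - 1)) *\<^sub>R eigenfun i)"
  have "indep_var (Pi\<^sub>M {..<n} (\<lambda>_. borel)) (\<lambda>\<omega>. restrict (\<lambda>i. ?X i \<omega>) {..<n})
      (Pi\<^sub>M {k - 1} (\<lambda>_. borel)) (\<lambda>\<omega>. restrict (\<lambda>i. ?X i \<omega>) {k - 1})"
    by (rule indep_var_restrict[OF heat_noise_indep[OF W T, of N k]]) (use k in auto)
  then have "indep_var borel (?Y \<circ> (\<lambda>\<omega>. restrict (\<lambda>i. ?X i \<omega>) {..<n}))
      borel ((\<lambda>x. x (k - 1)) \<circ> (\<lambda>\<omega>. restrict (\<lambda>i. ?X i \<omega>) {k - 1}))"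
  proof (rule indep_var_compose)
    have "(\<lambda>x. \<Sum>i=1..n. (c i * x (i - 1)) *\<^sub>R eigenfun i) \<in> borel_measurable (Pi\<^sub>M {..<n} (\<lambda>_. borel))"
      by (intro measurable_scaleR_sum borel_measurable_times borel_measurable_const measurable_component_singleton) auto
    then show "?Y \<in> borel_measurable (Pi\<^sub>M {..<n} (\<lambda>_. borel))"
      by (rule measurable_compose[OF _ \<psi>_meas])
    show "(\<lambda>x. x (k - 1)) \<in> borel_measurable (Pi\<^sub>M {k - 1} (\<lambda>_. borel))"
      by (rule measurable_component_singleton) simp
  qed
  moreover have "?Y \<circ> (\<lambda>\<omega>. restrict (\<lambda>i. ?X i \<omega>) {..<n}) = (\<lambda>\<omega>. \<psi> (galerkin_grid n \<omega>))"
    unfolding galerkin_grid_def o_def by (intro ext arg_cong[of _ _ \<psi>] sum.cong) auto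
  moreover have "(\<lambda>x. x (k - 1)) \<circ> (\<lambda>\<omega>. restrict (\<lambda>i. ?X i \<omega>) {k - 1}) = heat_noise W T N k"
    using k1 by (auto simp: o_def fun_eq_iff)
  ultimately have ind: "indep_var borel (\<lambda>\<omega>. \<psi> (galerkin_grid n \<omega>)) borel (heat_noise W T N k)" by simp
  have int: "integrable M (\<lambda>\<omega>. \<psi> (galerkin_grid n \<omega>))"
    by (rule integrable_const_bound[where B = B])
      (use \<psi>(2) measurable_compose[OF galerkin_grid_measurable \<psi>_meas] in auto)
  show "integrable M (\<lambda>\<omega>. \<psi> (galerkin_grid n \<omega>) * heat_noise W T N k \<omega>)"
    by (rule indep_var_integrable[OF ind int noise(2)])
  show "(\<integral>\<omega>. \<psi> (galerkin_grid n \<omega>) * heat_noise W T N k \<omega> \<partial>M) = 0"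
    by (subst indep_var_lebesgue_integral[OF ind int noise(2)]) (simp add: noise(3))
qed

text \<open>The linear Taylor term is expanded along the sines, so that independence is needed only
  for the scalar functions x \<mapsto> D\<phi>(x) e_k, which are bounded and continuous.\<close>

lemma weak_error_galerkin_grid:
  assumes diff: "\<And>x. \<phi> differentiable (at x)"
    and D1: "\<And>x. norm (deriv1 \<phi> x) \<le> 1"
    and D2: "\<And>x y. norm (deriv1 \<phi> x - deriv1 \<phi> y) \<le> norm (x - y)"
    and bdd: "\<And>x. \<bar>\<phi> x\<bar> \<le> B" and n: "n \<le> K"
  shows "\<bar>(\<integral>\<omega>. \<phi> (galerkin_grid K \<omega>) \<partial>M) - (\<integral>\<omega>. \<phi> (galerkin_grid n \<omega>) \<partial>M)\<bar>
    \<le> (\<Sum>k=n+1..K. (c k)\<^sup>2 * ((1 - exp (- 2 * eigenval k * T)) / (2 * eigenval k))) / 2"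
proof -
  interpret prob_space M using W by (rule cylindrical_wiener_prob_space)
  let ?\<xi> = "heat_noise W T N" and ?J = galerkin_grid
  define h where "h \<omega> = (\<Sum>k=n+1..K. (c k * ?\<xi> k \<omega>) *\<^sub>R eigenfun k)" for \<omega>
  note noise = heat_noise_moments[OF W T _ N]
  have "{1..K} = {1..n} \<union> {n+1..K}" using n by auto
  then have J: "?J K \<omega> = ?J n \<omega> + h \<omega>" for \<omega>
    unfolding galerkin_grid_def h_def by (simp add: sum.union_disjoint)
  have norm_h: "(norm (h \<omega>))\<^sup>2 = (\<Sum>k=n+1..K. (c k)\<^sup>2 * (?\<xi> k \<omega>)\<^sup>2)" for \<omega>
  proof -
    have "(norm (h \<omega>))\<^sup>2 = (\<Sum>k=n+1..K. \<Sum>j=n+1..K. if j = k then (c k)\<^sup>2 * (?\<xi> k \<omega>)\<^sup>2 else 0)"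
      unfolding h_def norm_scaleR_sum_squared
      by (intro sum.cong refl) (auto simp: eigenfun_orthonormal power2_eq_square)
    then show ?thesis by (simp add: sum.delta)
  qed
  have int_h: "integrable M (\<lambda>\<omega>. (norm (h \<omega>))\<^sup>2)"
    unfolding norm_h by (intro Bochner_Integration.integrable_sum integrable_mult_right noise(4)) auto
  have "\<bar>\<phi> x - \<phi> y\<bar> \<le> norm (x - y)" for x y
    using lipschitz_of_deriv1[of \<phi> 1 x y] diff D1 by simp
  then have \<phi>_meas: "\<phi> \<in> borel_measurable borel"
    by (intro borel_measurable_continuous_onI continuous_on_lipschitz_1) simp
  have int_\<phi>: "integrable M (\<lambda>\<omega>. \<phi> (?J m \<omega>))" for m
    by (rule integrable_const_bound[where B = B])
      (use bdd measurable_compose[OF galerkin_grid_measurable \<phi>_meas] in auto)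
  have D_le: "\<bar>deriv1 \<phi> x (eigenfun k)\<bar> \<le> 1" if "k \<ge> 1" for x k
    using norm_blinfun[of "deriv1 \<phi> x" "eigenfun k"] D1[of x] that by (simp add: norm_eigenfun)
  have D_cont: "continuous_on UNIV (\<lambda>x. deriv1 \<phi> x (eigenfun k))" for k
    by (intro continuous_intros continuous_on_lipschitz_1 D2)
  have D_eq: "deriv1 \<phi> (?J n \<omega>) (h \<omega>) = (\<Sum>k=n+1..K. c k * (deriv1 \<phi> (?J n \<omega>) (eigenfun k) * ?\<xi> k \<omega>))" for \<omega>
    unfolding h_def blinfun.sum_right blinfun.scaleR_right by (simp add: ac_simps)
  have orth: "integrable M (\<lambda>\<omega>. deriv1 \<phi> (?J n \<omega>) (eigenfun k) * ?\<xi> k \<omega>)"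
    "(\<integral>\<omega>. deriv1 \<phi> (?J n \<omega>) (eigenfun k) * ?\<xi> k \<omega> \<partial>M) = 0" if "k \<in> {n+1..K}" for k
    using expectation_orthogonal_noise[OF D_cont D_le, of k n k] that by auto
  have int_D: "integrable M (\<lambda>\<omega>. deriv1 \<phi> (?J n \<omega>) (h \<omega>))"
    unfolding D_eq by (intro Bochner_Integration.integrable_sum integrable_mult_right orth)
  have zero: "(\<integral>\<omega>. deriv1 \<phi> (?J n \<omega>) (h \<omega>) \<partial>M) = 0"
    unfolding D_eq
    by (subst Bochner_Integration.integral_sum) (auto simp: orth intro!: sum.neutral)
  have "(\<integral>\<omega>. \<phi> (?J K \<omega>) \<partial>M) - (\<integral>\<omega>. \<phi> (?J n \<omega>) \<partial>M)
      = (\<integral>\<omega>. \<phi> (?J K \<omega>) - \<phi> (?J n \<omega>) - deriv1 \<phi> (?J n \<omega>) (h \<omega>) \<partial>M)"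
    using int_\<phi> int_D zero by simp
  then have "\<bar>(\<integral>\<omega>. \<phi> (?J K \<omega>) \<partial>M) - (\<integral>\<omega>. \<phi> (?J n \<omega>) \<partial>M)\<bar>
      \<le> (\<integral>\<omega>. \<bar>\<phi> (?J K \<omega>) - \<phi> (?J n \<omega>) - deriv1 \<phi> (?J n \<omega>) (h \<omega>)\<bar> \<partial>M)"
    by (simp only: integral_abs_bound)
  also have "\<dots> \<le> (\<integral>\<omega>. (norm (h \<omega>))\<^sup>2 / 2 \<partial>M)"
  proof (rule integral_mono)
    show "integrable M (\<lambda>\<omega>. \<bar>\<phi> (?J K \<omega>) - \<phi> (?J n \<omega>) - deriv1 \<phi> (?J n \<omega>) (h \<omega>)\<bar>)"
      using int_\<phi> int_D by (intro integrable_abs Bochner_Integration.integrable_diff)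
    show "integrable M (\<lambda>\<omega>. (norm (h \<omega>))\<^sup>2 / 2)" using int_h by simp
    show "\<bar>\<phi> (?J K \<omega>) - \<phi> (?J n \<omega>) - deriv1 \<phi> (?J n \<omega>) (h \<omega>)\<bar> \<le> (norm (h \<omega>))\<^sup>2 / 2" for \<omega>
      unfolding J by (rule taylor_second_order_bound[OF diff D2])
  qed
  also have "\<dots> = (\<Sum>k=n+1..K. (c k)\<^sup>2 * (\<integral>\<omega>. (?\<xi> k \<omega>)\<^sup>2 \<partial>M)) / 2"
  proof -
    have "(\<integral>\<omega>. (norm (h \<omega>))\<^sup>2 \<partial>M) = (\<Sum>k=n+1..K. \<integral>\<omega>. (c k)\<^sup>2 * (?\<xi> k \<omega>)\<^sup>2 \<partial>M)"
      unfolding norm_h by (intro Bochner_Integration.integral_sum integrable_mult_right noise(4)) auto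
    then show ?thesis by simp
  qed
  also have "\<dots> \<le> (\<Sum>k=n+1..K. (c k)\<^sup>2 * ((1 - exp (- 2 * eigenval k * T)) / (2 * eigenval k))) / 2"
    by (intro divide_right_mono sum_mono mult_left_mono noise(5)) auto
  finally show ?thesis .
qed

text \<open>With d the distance, d \<le> \<epsilon> + d^2 / \<epsilon> turns a second moment of at
  most 4 \<epsilon>^2 directly into the bound \<epsilon> + 4 \<epsilon>.\<close>

lemma expectation_diff_galerkin_grid:
  fixes \<phi> :: "L2 \<Rightarrow> real"
  assumes X: "X \<in> borel_measurable M" and lip: "\<And>x y. \<bar>\<phi> x - \<phi> y\<bar> \<le> norm (x - y)"
    and bdd: "\<And>x. \<bar>\<phi> x\<bar> \<le> B" and \<epsilon>: "\<epsilon> > 0"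
    and le: "(\<integral>\<^sup>+\<omega>. ennreal ((norm (galerkin_grid K \<omega> - X \<omega>))\<^sup>2) \<partial>M) \<le> ennreal (4 * \<epsilon>\<^sup>2)"
  shows "\<bar>(\<integral>\<omega>. \<phi> (X \<omega>) \<partial>M) - (\<integral>\<omega>. \<phi> (galerkin_grid K \<omega>) \<partial>M)\<bar> \<le> 5 * \<epsilon>"
proof -
  interpret prob_space M using W by (rule cylindrical_wiener_prob_space)
  let ?d = "\<lambda>\<omega>. norm (X \<omega> - galerkin_grid K \<omega>)"
  have [measurable]: "?d \<in> borel_measurable M" using X by (rule norm_diff_galerkin_grid_measurable)
  have \<phi>_meas: "\<phi> \<in> borel_measurable borel"
    using lip by (intro borel_measurable_continuous_onI continuous_on_lipschitz_1) simp
  have int: "integrable M (\<lambda>\<omega>. \<phi> (Z \<omega>))" if "Z \<in> borel_measurable M" for Z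
    by (rule integrable_const_bound[where B = B]) (use bdd measurable_compose[OF that \<phi>_meas] in auto)
  note int_X = int[OF X] and int_J = int[OF galerkin_grid_measurable[of K]]
  have le': "(\<integral>\<^sup>+\<omega>. ennreal ((?d \<omega>)\<^sup>2) \<partial>M) \<le> ennreal (4 * \<epsilon>\<^sup>2)"
    using le by (simp add: norm_minus_commute)
  have int_d: "integrable M (\<lambda>\<omega>. (?d \<omega>)\<^sup>2)"
    by (rule integrableI_bounded) (use le' in \<open>auto intro: order_le_less_trans\<close>)
  have "ennreal (\<integral>\<omega>. (?d \<omega>)\<^sup>2 \<partial>M) \<le> ennreal (4 * \<epsilon>\<^sup>2)"
    using le' nn_integral_eq_integral[OF int_d] by simp
  then have d_le: "(\<integral>\<omega>. (?d \<omega>)\<^sup>2 \<partial>M) \<le> 4 * \<epsilon>\<^sup>2" by (simp add: ennreal_le_iff)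
  have pt: "\<bar>\<phi> (X \<omega>) - \<phi> (galerkin_grid K \<omega>)\<bar> \<le> \<epsilon> + (?d \<omega>)\<^sup>2 / \<epsilon>" for \<omega>
  proof (cases "?d \<omega> \<le> \<epsilon>")
    case True
    then show ?thesis using lip[of "X \<omega>" "galerkin_grid K \<omega>"] \<epsilon>
      by (intro order_trans[OF lip]) (auto intro: add_increasing2)
  next
    case False
    then have "?d \<omega> * \<epsilon> \<le> ?d \<omega> * ?d \<omega>" by (intro mult_left_mono) auto
    then have "?d \<omega> \<le> (?d \<omega>)\<^sup>2 / \<epsilon>" using \<epsilon> by (simp add: le_divide_eq power2_eq_square)
    then show ?thesis using lip[of "X \<omega>" "galerkin_grid K \<omega>"] \<epsilon> by linarith
  qed
  have "\<bar>(\<integral>\<omega>. \<phi> (X \<omega>) \<partial>M) - (\<integral>\<omega>. \<phi> (galerkin_grid K \<omega>) \<partial>M)\<bar>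
      = \<bar>\<integral>\<omega>. \<phi> (X \<omega>) - \<phi> (galerkin_grid K \<omega>) \<partial>M\<bar>"
    using int_X int_J by simp
  also have "\<dots> \<le> (\<integral>\<omega>. \<bar>\<phi> (X \<omega>) - \<phi> (galerkin_grid K \<omega>)\<bar> \<partial>M)"
    by (rule integral_abs_bound)
  also have "\<dots> \<le> (\<integral>\<omega>. \<epsilon> + (?d \<omega>)\<^sup>2 / \<epsilon> \<partial>M)"
    using int_X int_J int_d pt by (intro integral_mono) auto
  also have "\<dots> = \<epsilon> + (\<integral>\<omega>. (?d \<omega>)\<^sup>2 \<partial>M) / \<epsilon>"
    using int_d by (simp add: prob_space)
  also have "\<dots> \<le> \<epsilon> + 4 * \<epsilon>\<^sup>2 / \<epsilon>"
    using d_le \<epsilon> by (intro add_left_mono divide_right_mono) auto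
  also have "\<dots> = 5 * \<epsilon>" using \<epsilon> by (simp add: power2_eq_square)
  finally show ?thesis .
qed

end

theorem proposition4p2:
  fixes M :: "'w measure"
    and W :: "real \<Rightarrow> L2 \<Rightarrow> 'w \<Rightarrow> real"
    and S :: "real \<Rightarrow> L2 \<Rightarrow> L2"
    and Q Qhalf :: "L2 \<Rightarrow> L2"
    and q :: "nat \<Rightarrow> real"
    and u :: "real \<Rightarrow> 'w \<Rightarrow> L2"
    and u_gal :: "nat \<Rightarrow> real \<Rightarrow> 'w \<Rightarrow> L2"
    and \<phi> :: "L2 \<Rightarrow> real"
    and T :: real
  assumes prob: "prob_space M"
    and wiener: "cylindrical_wiener M W"
    and semigroup: "C0_semigroup S" "semigroup_generator S = dirichlet_laplacian"
    and Q: "symmetric_nonneg Q" "trace_class Q"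
    and Q_eigen: "\<And>k. k \<ge> 1 \<Longrightarrow> Q (eigenfun k) = q k *\<^sub>R eigenfun k"
    and q: "\<And>k. k \<ge> 1 \<Longrightarrow> q k > 0" "summable (\<lambda>k. q (Suc k))"
    and Qhalf: "is_sqrt_of Qhalf Q"
    and u: "mild_solution M W S Qhalf u"
    and u_gal: "\<And>n. n \<ge> 1 \<Longrightarrow> galerkin_solution M W Qhalf n (u_gal n)"
    and T: "T > 0"
    and \<phi>: "\<phi> \<in> Cb2" "Cb2_norm \<phi> \<le> 1"
  shows "\<forall>n\<ge>1. weak_error M \<phi> (u T) (u_gal n T) \<le>
    1 / 4 * (\<Sum>j. q (n + 1 + j) / eigenval (n + 1 + j) * (1 - exp (- 2 * eigenval (n + 1 + j) * T)))"
proof (intro allI impI)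
  fix n :: nat assume n: "n \<ge> 1"
  let ?f = "\<lambda>k. q k / eigenval k * (1 - exp (- 2 * eigenval k * T))"
  define c where "c k = sqrt (q k)" for k
  \<comment> \<open>The Galerkin integrand has the same diagonal form as the full one with these
    truncated coefficients, so \<open>heat_grid_approx\<close> covers both.\<close>
  define c' where "c' k = (if k \<le> n then c k else 0)" for k
  have c_sq: "(c k)\<^sup>2 = q k" if "k \<ge> 1" for k
    using q(1)[OF that] by (simp add: c_def)
  have c_sum: "summable (\<lambda>k. (c (Suc k))\<^sup>2)" using q(2) by (simp add: c_sq)
  then have c'_sum: "summable (\<lambda>k. (c' (Suc k))\<^sup>2)"
    by (rule summable_comparison_test'[where N = 0]) (simp add: c'_def)
  have Qhalf_eigen: "Qhalf (eigenfun k) = c k *\<^sub>R eigenfun k" if "k \<ge> 1" for k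
    unfolding c_def by (rule sqrt_operator_eigenvector[OF Qhalf Q_eigen[OF that] q(1)[OF that]])
  have u_int: "is_stochastic_integral M W (\<lambda>s. S (T - s) \<circ> Qhalf) T (u T)"
    using u T by (simp add: mild_solution_def)
  have gal_int: "is_stochastic_integral M W (\<lambda>s. galerkin_semigroup n (T - s) \<circ> Qhalf) T (u_gal n T)"
    using u_gal[OF n] T by (simp add: galerkin_solution_def)
  have u_diag: "(S (T - s) \<circ> Qhalf) (eigenfun k) = (c k * exp (- eigenval k * (T - s))) *\<^sub>R eigenfun k"
    if "s \<in> {0..T}" "k \<ge> 1" for s k
  proof -
    have "bounded_linear (S (T - s))" using semigroup(1) that by (simp add: C0_semigroup_def)
    then show ?thesis
      using that dirichlet_semigroup_eigenfun[OF semigroup, of "T - s" k]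
      by (simp add: Qhalf_eigen linear_simps)
  qed
  have gal_diag: "(galerkin_semigroup n (T - s) \<circ> Qhalf) (eigenfun k) = (c' k * exp (- eigenval k * (T - s))) *\<^sub>R eigenfun k"
    if "s \<in> {0..T}" "k \<ge> 1" for s k
  proof -
    have "(galerkin_semigroup n (T - s) \<circ> Qhalf) (eigenfun k)
        = (\<Sum>j=1..n. if j = k then (c k * exp (- eigenval k * (T - s))) *\<^sub>R eigenfun k else 0)"
      unfolding o_def galerkin_semigroup_eq[OF semigroup]
      using that by (intro sum.cong refl) (auto simp: Qhalf_eigen eigenfun_orthonormal)
    then show ?thesis using that by (auto simp: sum.delta c'_def)
  qed
  have \<phi>_diff: "\<And>x. \<phi> differentiable (at x)" "\<And>x. deriv1 \<phi> differentiable (at x)"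
    using \<phi>(1) by (auto simp: Cb2_def)
  note D = Cb2_norm_bounds[OF \<phi>(2)]
  obtain B where B: "\<And>x. \<bar>\<phi> x\<bar> \<le> B"
    using \<phi>(1) by (auto simp: Cb2_def bounded_iff)
  have lip: "\<bar>\<phi> x - \<phi> y\<bar> \<le> norm (x - y)" for x y
    using lipschitz_of_deriv1[OF \<phi>_diff(1) D(1), of x y] by simp
  have lip': "norm (deriv1 \<phi> x - deriv1 \<phi> y) \<le> norm (x - y)" for x y
    using lipschitz_of_deriv1[OF \<phi>_diff(2), of 1 x y] D(2) by (simp add: deriv2_def)
  have f_nonneg: "0 \<le> ?f k" if "k \<ge> 1" for k
    using q(1)[OF that] eigenval_pos[OF that] T by (intro mult_nonneg_nonneg divide_nonneg_nonneg) auto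
  \<comment> \<open>Every \<lambda>_k is at least 1, so the terms are dominated by q_k. Summability
    is needed for the \<open>suminf\<close> to bound its partial sums.\<close>
  have f_sum: "summable (\<lambda>j. ?f (n + 1 + j))"
  proof (rule summable_comparison_test'[where N = 0])
    show "summable (\<lambda>j. q (n + 1 + j))"
      using q(2) summable_iff_shift[of "\<lambda>k. q (Suc k)" n] by (simp add: add.commute)
    show "norm (?f (n + 1 + j)) \<le> q (n + 1 + j)" for j
    proof -
      let ?k = "n + 1 + j"
      have "1 \<le> eigenval ?k"
      proof -
        have "1 * 1 \<le> real ?k * pi" using pi_gt3 by (intro mult_mono) auto
        then show ?thesis unfolding eigenval_def by (simp add: one_le_power)
      qed
      then have "q ?k / eigenval ?k \<le> q ?k" "0 \<le> q ?k / eigenval ?k"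
        using q(1)[of ?k] by (auto simp: divide_le_eq mult_left_le_one_le)
      then have "?f ?k \<le> q ?k * 1" using q(1)[of ?k] eigenval_pos[of ?k] T by (intro mult_mono) auto
      then show ?thesis using f_nonneg[of ?k] by simp
    qed
  qed
  show "weak_error M \<phi> (u T) (u_gal n T) \<le> 1 / 4 * (\<Sum>j. ?f (n + 1 + j))"
  proof (rule field_le_epsilon)
    fix e :: real assume e: "e > 0"
    \<comment> \<open>Each of the two approximations costs 5 \<epsilon>, together e.\<close>
    define \<epsilon> where "\<epsilon> = e / 10"
    have \<epsilon>: "\<epsilon> > 0" using e by (simp add: \<epsilon>_def)
    then have \<epsilon>2: "\<epsilon>\<^sup>2 > 0" by simp
    have "\<forall>\<^sub>F K in sequentially. \<forall>\<^sub>F N in sequentially.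
      (\<integral>\<^sup>+\<omega>. ennreal ((norm ((\<Sum>k=1..K. (c k * heat_noise W T N k \<omega>) *\<^sub>R eigenfun k) - u T \<omega>))\<^sup>2) \<partial>M) \<le> ennreal (4 * \<epsilon>\<^sup>2)"
      by (rule heat_grid_approx[OF wiener u_int T c_sum \<epsilon>2]) (rule u_diag)
    moreover have "\<forall>\<^sub>F K in sequentially. \<forall>\<^sub>F N in sequentially.
      (\<integral>\<^sup>+\<omega>. ennreal ((norm ((\<Sum>k=1..K. (c' k * heat_noise W T N k \<omega>) *\<^sub>R eigenfun k) - u_gal n T \<omega>))\<^sup>2) \<partial>M) \<le> ennreal (4 * \<epsilon>\<^sup>2)"
      by (rule heat_grid_approx[OF wiener gal_int T c'_sum \<epsilon>2]) (rule gal_diag)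
    \<comment> \<open>A common K and a common N are required, so that both sums are built from the
      same noises.\<close>
    ultimately have "\<forall>\<^sub>F K in sequentially. K \<ge> n \<and> (\<forall>\<^sub>F N in sequentially. N \<ge> 1 \<and>
      (\<integral>\<^sup>+\<omega>. ennreal ((norm ((\<Sum>k=1..K. (c k * heat_noise W T N k \<omega>) *\<^sub>R eigenfun k) - u T \<omega>))\<^sup>2) \<partial>M) \<le> ennreal (4 * \<epsilon>\<^sup>2) \<and>
      (\<integral>\<^sup>+\<omega>. ennreal ((norm ((\<Sum>k=1..K. (c' k * heat_noise W T N k \<omega>) *\<^sub>R eigenfun k) - u_gal n T \<omega>))\<^sup>2) \<partial>M) \<le> ennreal (4 * \<epsilon>\<^sup>2))"
      using eventually_ge_at_top[of n]
      by eventually_elim (simp only: eventually_conj_iff eventually_ge_at_top simp_thms)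
    from eventually_happens'[OF sequentially_bot this] obtain K where K: "K \<ge> n" and ev_N: "\<forall>\<^sub>F N in sequentially. N \<ge> 1 \<and>
      (\<integral>\<^sup>+\<omega>. ennreal ((norm ((\<Sum>k=1..K. (c k * heat_noise W T N k \<omega>) *\<^sub>R eigenfun k) - u T \<omega>))\<^sup>2) \<partial>M) \<le> ennreal (4 * \<epsilon>\<^sup>2) \<and>
      (\<integral>\<^sup>+\<omega>. ennreal ((norm ((\<Sum>k=1..K. (c' k * heat_noise W T N k \<omega>) *\<^sub>R eigenfun k) - u_gal n T \<omega>))\<^sup>2) \<partial>M) \<le> ennreal (4 * \<epsilon>\<^sup>2)"
      by (elim exE conjE)
    from eventually_happens'[OF sequentially_bot ev_N] obtain N where N: "N \<ge> 1"
      and apx: "(\<integral>\<^sup>+\<omega>. ennreal ((norm ((\<Sum>k=1..K. (c k * heat_noise W T N k \<omega>) *\<^sub>R eigenfun k) - u T \<omega>))\<^sup>2) \<partial>M) \<le> ennreal (4 * \<epsilon>\<^sup>2)"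
      and apx': "(\<integral>\<^sup>+\<omega>. ennreal ((norm ((\<Sum>k=1..K. (c' k * heat_noise W T N k \<omega>) *\<^sub>R eigenfun k) - u_gal n T \<omega>))\<^sup>2) \<partial>M) \<le> ennreal (4 * \<epsilon>\<^sup>2)"
      by (elim exE conjE)
    \<comment> \<open>The truncated coefficients reduce the K-mode sum to its first n modes.\<close>
    have "(\<Sum>k=1..K. (c' k * heat_noise W T N k \<omega>) *\<^sub>R eigenfun k) = galerkin_grid W T N c n \<omega>" for \<omega>
    proof -
      have "(\<Sum>k=1..K. (c' k * heat_noise W T N k \<omega>) *\<^sub>R eigenfun k) = (\<Sum>k=1..n. (c' k * heat_noise W T N k \<omega>) *\<^sub>R eigenfun k)"
        using K by (intro sum.mono_neutral_right) (auto simp: c'_def)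
      then show ?thesis by (simp add: galerkin_grid_def[OF wiener T N] c'_def)
    qed
    note gal = this
    have meas: "u T \<in> borel_measurable M" "u_gal n T \<in> borel_measurable M"
      using u_int gal_int by (auto simp: is_stochastic_integral_def)
    have 1: "\<bar>(\<integral>\<omega>. \<phi> (u T \<omega>) \<partial>M) - (\<integral>\<omega>. \<phi> (galerkin_grid W T N c K \<omega>) \<partial>M)\<bar> \<le> 5 * \<epsilon>"
      using expectation_diff_galerkin_grid[OF wiener T N meas(1) lip B \<epsilon>] apx
      by (simp add: galerkin_grid_def[OF wiener T N])
    have 2: "\<bar>(\<integral>\<omega>. \<phi> (u_gal n T \<omega>) \<partial>M) - (\<integral>\<omega>. \<phi> (galerkin_grid W T N c n \<omega>) \<partial>M)\<bar> \<le> 5 * \<epsilon>"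
      using expectation_diff_galerkin_grid[OF wiener T N meas(2) lip B \<epsilon>] apx' unfolding gal .
    have 3: "\<bar>(\<integral>\<omega>. \<phi> (galerkin_grid W T N c K \<omega>) \<partial>M) - (\<integral>\<omega>. \<phi> (galerkin_grid W T N c n \<omega>) \<partial>M)\<bar>
        \<le> (\<Sum>k=n+1..K. (c k)\<^sup>2 * ((1 - exp (- 2 * eigenval k * T)) / (2 * eigenval k))) / 2"
      by (rule weak_error_galerkin_grid[OF wiener T N \<phi>_diff(1) D(1) lip' B K])
    \<comment> \<open>The 1/2 from Taylor's formula meets the 1/(2 \<lambda>_k) from the
      variance.\<close>
    have "(\<Sum>k=n+1..K. (c k)\<^sup>2 * ((1 - exp (- 2 * eigenval k * T)) / (2 * eigenval k))) / 2 = 1 / 4 * (\<Sum>k=n+1..K. ?f k)"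
      unfolding sum_distrib_left sum_divide_distrib by (intro sum.cong refl) (simp add: c_sq)
    also have "(\<Sum>k=n+1..K. ?f k) = (\<Sum>j<K - n. ?f (n + 1 + j))"
      by (rule sum.reindex_bij_witness[of _ "\<lambda>j. n + 1 + j" "\<lambda>k. k - (n + 1)"]) auto
    also have "1 / 4 * (\<Sum>j<K - n. ?f (n + 1 + j)) \<le> 1 / 4 * (\<Sum>j. ?f (n + 1 + j))"
      by (intro mult_left_mono sum_le_suminf f_sum f_nonneg) auto
    finally have 4: "(\<Sum>k=n+1..K. (c k)\<^sup>2 * ((1 - exp (- 2 * eigenval k * T)) / (2 * eigenval k))) / 2
        \<le> 1 / 4 * (\<Sum>j. ?f (n + 1 + j))" .
    have "5 * \<epsilon> + 5 * \<epsilon> = e" by (simp add: \<epsilon>_def)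
    then show "weak_error M \<phi> (u T) (u_gal n T) \<le> 1 / 4 * (\<Sum>j. ?f (n + 1 + j)) + e"
      unfolding weak_error_def using 1 2 3 4 by linarith
  qed
qed

end
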